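(* Let $P$ be a biobjective combinatorial optimization problem. Then the Dichotomic Approach with access to an algorithm to solve the lexicographic version of $P$ enumerates the nondominated extreme points of $P$. Moreover, if the lexicographic version of $P$ is solvable in polynomial time, the points are enumerated with incremental delay.
   Context: A biobjective combinatorial optimization (BOCO) problem $P$ is a collection of instances $(\mathcal{S},C)$ with implicitly given solution set $\mathcal{S}\subseteq\{0,1\}^n$ and $C\in\mathbb{Q}^{2\times n}$ with rows $c_1,c_2$; the input size is $n+\langle C\rangle$, where $\langle\cdot\rangle$ is binary encoding length. The nondominated extreme points of an instance are the extreme points of the polyhedron $\{Cx\mid x\in\operatorname{conv}\mathcal{S}\}+\mathbb{R}^2_{\ge}$. The lexicographic version of $P$ is the problem: given an instance and $\ell\in\mathbb{Q}^2$, $\ell\ge0$, solve $$P^{\mathrm{Lex\text{-}WS}}(\ell):\quad \operatorname{lexmin}\{(\ell^{T}Cx,\ c_1x,\ c_2x)\mid x\in\mathcal{S}\},$$ where lexmin is the minimum in the lexicographic order. Below, "an optimal solution $y$" means $y=Cx$ for an optimal $x$. The Dichotomic Approach with access to a lexicographic algorithm, on an instance with $\mathcal{S}\ne\emptyset$ (if $\mathcal S=\emptyset$, nothing is output): 1. Compute optimal solutions $y^0$ and $y^1$ of $P^{\mathrm{Lex\text{-}WS}}((1,0))$ and $P^{\mathrm{Lex\text{-}WS}}((0,1))$. If $y^0=y^1$, output this point and terminate. Otherwise output $y^0,y^1$ and put the pair $(y^0,y^1)$ into a queue $\mathcal{Q}$. 2. While $\mathcal{Q}$ is nonempty: remove a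 pair $(y^2,y^3)$ from $\mathcal{Q}$, set $\lambda:=(|y^2_2-y^3_2|,\ |y^2_1-y^3_1|)$, and compute an optimal solution $\bar y$ of $P^{\mathrm{Lex\text{-}WS}}(\lambda)$. If $\lambda^{T}y^2=\lambda^{T}\bar y=\lambda^{T}y^3$, discard $\bar y$. Otherwise output $\bar y$ and add the pairs $(\bar y,y^2)$ and $(\bar y,y^3)$ to $\mathcal{Q}$. Enumerating means that each nondominated extreme point is output exactly once and the algorithm terminates. The $0$-th delay is the time before the first output, the $i$-th delay is the time between the $i$-th and $(i+1)$-th outputs, and the last delay is the time between the last output and termination. Incremental delay means that, on a RAM with memory cells of polynomially bounded bit length, each $i$-th delay is bounded by a polynomial in the input size and the number of points output before the $i$-th output. *)

theory Defs
  imports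
    "HOL-Analysis.Analysis"
    "HOL-Library.Multiset"
    "HOL-Library.Log_Nat"
    "HOL-Computational_Algebra.Polynomial"
    "Jordan_Normal_Form.Matrix"
begin

hide_type (open) Finite_Cartesian_Product.vec
hide_const (open) Finite_Cartesian_Product.vec
unbundle no vec_syntax
unbundle no inner_syntax
text \<open>
  The solution set of an instance is given implicitly: \<open>descr\<close> is the data (a graph, a matroid,
  ...) through which an algorithm sees it. Nothing is required of the description; in
  particular running times are measured in \<open>n + \<langle>C\<rangle>\<close>, to which it does not contribute.
\<close>

record boco_instance =
  sols :: "int vec set"
  cost :: "rat mat"
  descr :: "int list"

definition nvars :: "boco_instance \<Rightarrow> nat" where
  "nvars I = dim_col (cost I)"

definition boco_problem :: "boco_instance set \<Rightarrow> bool" where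
  "boco_problem P \<longleftrightarrow> (\<forall>I\<in>P. cost I \<in> carrier_mat 2 (nvars I) \<and>
     sols I \<subseteq> {x \<in> carrier_vec (nvars I). \<forall>j<nvars I. x $ j \<in> {0, 1}})"

definition img :: "boco_instance \<Rightarrow> int vec \<Rightarrow> rat \<times> rat" where
  "img I x = (let z = cost I *\<^sub>v map_vec rat_of_int x in (z $ 0, z $ 1))"

definition wsum :: "rat \<times> rat \<Rightarrow> rat \<times> rat \<Rightarrow> rat" where
  "wsum l y = fst l * fst y + snd l * snd y"

definition lex_objective :: "boco_instance \<Rightarrow> rat \<times> rat \<Rightarrow> int vec \<Rightarrow> rat \<times> rat \<times> rat" where
  "lex_objective I l x = (wsum l (img I x), img I x)"

definition lex_less :: "((rat \<times> rat \<times> rat) \<times> (rat \<times> rat \<times> rat)) set" where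
  "lex_less = {(a, b). a < b} <*lex*> {(a, b). a < b} <*lex*> {(a, b). a < b}"

definition lex_optimal :: "boco_instance \<Rightarrow> rat \<times> rat \<Rightarrow> int vec \<Rightarrow> bool" where
  "lex_optimal I l x \<longleftrightarrow> x \<in> sols I \<and>
     (\<forall>x'\<in>sols I. lex_objective I l x = lex_objective I l x' \<or>
        (lex_objective I l x, lex_objective I l x') \<in> lex_less)"

text \<open>An algorithm for the lexicographic version answers \<open>None\<close> on infeasible instances.\<close>

type_synonym lex_alg = "boco_instance \<Rightarrow> rat \<times> rat \<Rightarrow> int vec option"

definition solves_lex :: "boco_instance set \<Rightarrow> lex_alg \<Rightarrow> bool" where
  "solves_lex P alg \<longleftrightarrow> (\<forall>I\<in>P. \<forall>l. fst l \<ge> 0 \<and> snd l \<ge> 0 \<longrightarrow>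
     (case alg I l of None \<Rightarrow> sols I = {} | Some x \<Rightarrow> lex_optimal I l x))"

definition conv_vec :: "nat \<Rightarrow> real vec set \<Rightarrow> real vec set" where
  "conv_vec n X = {vec n (\<lambda>j. \<Sum>x\<in>F. u x * x $ j) | F u.
     finite F \<and> F \<subseteq> X \<and> (\<forall>x\<in>F. u x \<ge> 0) \<and> sum u F = 1}"

definition upper_image :: "boco_instance \<Rightarrow> (real \<times> real) set" where
  "upper_image I = {((map_mat real_of_rat (cost I) *\<^sub>v x) $ 0 + r,
                     (map_mat real_of_rat (cost I) *\<^sub>v x) $ 1 + s) | x r s.
     x \<in> conv_vec (nvars I) (map_vec real_of_int ` sols I) \<and> r \<ge> 0 \<and> s \<ge> 0}"

definition nondominated_extreme_points :: "boco_instance \<Rightarrow> (real \<times> real) set" where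
  "nondominated_extreme_points I = {y. y extreme_point_of upper_image I}"

definition real_point :: "rat \<times> rat \<Rightarrow> real \<times> real" where
  "real_point y = (real_of_rat (fst y), real_of_rat (snd y))"

definition lists_nondominated_extreme_points :: "boco_instance \<Rightarrow> (rat \<times> rat) list \<Rightarrow> bool" where
  "lists_nondominated_extreme_points I ys \<longleftrightarrow>
     distinct ys \<and> real_point ` set ys = nondominated_extreme_points I"

text \<open>
  A state consists of the points output so far, in order, and the pairs that are still in the
  queue. The next pair to be treated may be any element of the queue.
\<close>

type_synonym da_state = "(rat \<times> rat) list \<times> ((rat \<times> rat) \<times> (rat \<times> rat)) multiset"

definition da_start :: "lex_alg \<Rightarrow> boco_instance \<Rightarrow> da_state" where
  "da_start alg I = (case (alg I (1, 0), alg I (0, 1)) of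
       (Some x0, Some x1) \<Rightarrow>
         (let y0 = img I x0; y1 = img I x1
          in if y0 = y1 then ([y0], {#}) else ([y0, y1], {#(y0, y1)#}))
     | _ \<Rightarrow> ([], {#}))"

definition da_weight :: "rat \<times> rat \<Rightarrow> rat \<times> rat \<Rightarrow> rat \<times> rat" where
  "da_weight y2 y3 = (\<bar>snd y2 - snd y3\<bar>, \<bar>fst y2 - fst y3\<bar>)"

inductive da_step :: "lex_alg \<Rightarrow> boco_instance \<Rightarrow> da_state \<Rightarrow> da_state \<Rightarrow> bool"
  for alg :: lex_alg and I :: boco_instance where
  discard: "da_step alg I (out, add_mset (y2, y3) Q) (out, Q)"
    if "l = da_weight y2 y3" "alg I l = Some x"
      "wsum l y2 = wsum l (img I x) \<and> wsum l (img I x) = wsum l y3"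
| split: "da_step alg I (out, add_mset (y2, y3) Q)
            (out @ [img I x], add_mset (img I x, y2) (add_mset (img I x, y3) Q))"
    if "l = da_weight y2 y3" "alg I l = Some x"
      "\<not> (wsum l y2 = wsum l (img I x) \<and> wsum l (img I x) = wsum l y3)"

definition da_run :: "lex_alg \<Rightarrow> boco_instance \<Rightarrow> (rat \<times> rat) list \<Rightarrow> bool" where
  "da_run alg I ys \<longleftrightarrow> (da_step alg I)\<^sup>*\<^sup>* (da_start alg I) (ys, {#})"

text \<open>The second conjunct also excludes getting stuck with pairs left in the queue.\<close>

definition da_enumerates :: "lex_alg \<Rightarrow> boco_instance \<Rightarrow> bool" where
  "da_enumerates alg I \<longleftrightarrow>
     (\<nexists>s. s 0 = da_start alg I \<and> (\<forall>k::nat. da_step alg I (s k) (s (Suc k)))) \<and>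
     (\<forall>out Q. (da_step alg I)\<^sup>*\<^sup>* (da_start alg I) (out, Q) \<and> (\<nexists>s. da_step alg I (out, Q) s) \<longrightarrow>
        Q = {#} \<and> lists_nondominated_extreme_points I out)"

text \<open>
  A unit-cost RAM with integer memory cells, initially 0, a random-access read-only input and a
  write-only output. A cell used as an address is read with \<open>nat\<close>, so negative values address
  cell 0; reading past the end of the input yields 0, and \<open>Div\<close> by 0 yields 0. The machine has
  halted when the program counter is outside the program.
\<close>

datatype instr =
    Const nat int
  | Add nat nat nat
  | Sub nat nat nat
  | Mul nat nat nat
  | Div nat nat nat
  | Load nat nat
  | Store nat nat
  | Input nat nat
  | Output nat
  | Jump nat
  | JumpPos nat nat

record config =
  pc :: nat
  mem :: "nat \<Rightarrow> int"
  written :: "int list"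

definition assign :: "nat \<Rightarrow> int \<Rightarrow> config \<Rightarrow> config" where
  "assign a v s = s\<lparr>pc := Suc (pc s), mem := (mem s)(a := v)\<rparr>"

fun exec_instr :: "int list \<Rightarrow> instr \<Rightarrow> config \<Rightarrow> config" where
  "exec_instr inp (Const a v) s = assign a v s"
| "exec_instr inp (Add a b c) s = assign a (mem s b + mem s c) s"
| "exec_instr inp (Sub a b c) s = assign a (mem s b - mem s c) s"
| "exec_instr inp (Mul a b c) s = assign a (mem s b * mem s c) s"
| "exec_instr inp (Div a b c) s = assign a (mem s b div mem s c) s"
| "exec_instr inp (Load a b) s = assign a (mem s (nat (mem s b))) s"
| "exec_instr inp (Store a b) s = assign (nat (mem s a)) (mem s b) s"
| "exec_instr inp (Input a b) s =
     assign a (let k = nat (mem s b) in if k < length inp then inp ! k else 0) s"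
| "exec_instr inp (Output a) s = s\<lparr>pc := Suc (pc s), written := written s @ [mem s a]\<rparr>"
| "exec_instr inp (Jump k) s = s\<lparr>pc := k\<rparr>"
| "exec_instr inp (JumpPos a k) s = s\<lparr>pc := (if mem s a > 0 then k else Suc (pc s))\<rparr>"

definition ram_step :: "instr list \<Rightarrow> int list \<Rightarrow> config \<Rightarrow> config" where
  "ram_step M inp s = (if pc s < length M then exec_instr inp (M ! pc s) s else s)"

definition ram_at :: "instr list \<Rightarrow> int list \<Rightarrow> nat \<Rightarrow> config" where
  "ram_at M inp t = (ram_step M inp ^^ t) \<lparr>pc = 0, mem = (\<lambda>_. 0), written = []\<rparr>"

definition halted_at :: "instr list \<Rightarrow> int list \<Rightarrow> nat \<Rightarrow> bool" where
  "halted_at M inp t \<longleftrightarrow> pc (ram_at M inp t) \<ge> length M"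

definition halting_time :: "instr list \<Rightarrow> int list \<Rightarrow> nat" where
  "halting_time M inp = (LEAST t. halted_at M inp t)"

definition cells_bounded :: "instr list \<Rightarrow> int list \<Rightarrow> nat \<Rightarrow> bool" where
  "cells_bounded M inp w \<longleftrightarrow> (\<forall>t a. bitlen \<bar>mem (ram_at M inp t) a\<bar> \<le> int w)"

text \<open>The encoding length of an integer \<open>p\<close> is \<open>1 + \<lceil>log 2 (\<bar>p\<bar> + 1)\<rceil> = 1 + bitlen \<bar>p\<bar>\<close>; rationals are
  encoded by their reduced fraction with positive denominator.\<close>

definition int_size :: "int \<Rightarrow> nat" where
  "int_size p = 1 + nat (bitlen \<bar>p\<bar>)"

definition rat_size :: "rat \<Rightarrow> nat" where
  "rat_size r = (case quotient_of r of (p, q) \<Rightarrow> int_size p + int_size q)"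

definition mat_size :: "rat mat \<Rightarrow> nat" where
  "mat_size A = (\<Sum>i<dim_row A. \<Sum>j<dim_col A. rat_size (A $$ (i, j)))"

definition input_size :: "boco_instance \<Rightarrow> nat" where
  "input_size I = nvars I + mat_size (cost I)"

definition point_size :: "rat \<times> rat \<Rightarrow> nat" where
  "point_size y = rat_size (fst y) + rat_size (snd y)"

definition enc_rat :: "rat \<Rightarrow> int list" where
  "enc_rat r = (case quotient_of r of (p, q) \<Rightarrow> [p, q])"

definition enc_point :: "rat \<times> rat \<Rightarrow> int list" where
  "enc_point y = enc_rat (fst y) @ enc_rat (snd y)"

definition enc_instance :: "boco_instance \<Rightarrow> int list" where
  "enc_instance I = int (nvars I) #
     concat (map enc_rat (list_of_vec (row (cost I) 0) @ list_of_vec (row (cost I) 1))) @ descr I"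

fun enc_answer :: "int vec option \<Rightarrow> int list" where
  "enc_answer None = [0]"
| "enc_answer (Some x) = 1 # list_of_vec x"

definition computes_lex_in_poly_time ::
    "boco_instance set \<Rightarrow> instr list \<Rightarrow> lex_alg \<Rightarrow> bool" where
  "computes_lex_in_poly_time P A alg \<longleftrightarrow> (\<exists>q w :: nat poly. \<forall>I\<in>P. \<forall>l. fst l \<ge> 0 \<and> snd l \<ge> 0 \<longrightarrow>
     (let inp = enc_point l @ enc_instance I; N = input_size I + point_size l
      in cells_bounded A inp (poly w N) \<and>
         (\<exists>t\<le>poly q N. halted_at A inp t \<and> written (ram_at A inp t) = enc_answer (alg I l))))"

text \<open>A point is written as four integers, and counts as output once all four have been written.
  \<open>output_time M inp i\<close> is the time of the \<open>i\<close>-th output, and 0 for \<open>i = 0\<close>.\<close>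

definition output_time :: "instr list \<Rightarrow> int list \<Rightarrow> nat \<Rightarrow> nat" where
  "output_time M inp i = (LEAST t. length (written (ram_at M inp t)) \<ge> 4 * i)"

text \<open>The \<open>i\<close>-th delay of a halting run with \<open>k\<close> outputs, for \<open>i \<le> k\<close>; \<open>i\<close> points have been output
  before it.\<close>

definition delay :: "instr list \<Rightarrow> int list \<Rightarrow> nat \<Rightarrow> nat \<Rightarrow> nat" where
  "delay M inp k i =
     (if i < k then output_time M inp (Suc i) else halting_time M inp) - output_time M inp i"

text \<open>\<open>q\<close> is a polynomial in two variables: the coefficients of the powers of \<open>m\<close> are polynomials in \<open>n\<close>.\<close>

definition poly2 :: "nat poly poly \<Rightarrow> nat \<Rightarrow> nat \<Rightarrow> nat" where
  "poly2 q m n = poly (poly q [:m:]) n"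

definition outputs_with_incremental_delay ::
    "boco_instance set \<Rightarrow> instr list \<Rightarrow> (boco_instance \<Rightarrow> (rat \<times> rat) list \<Rightarrow> bool) \<Rightarrow> bool" where
  "outputs_with_incremental_delay P M R \<longleftrightarrow>
     (\<exists>(q :: nat poly poly) (w :: nat poly). \<forall>I\<in>P. let inp = enc_instance I in
        cells_bounded M inp (poly w (input_size I)) \<and>
        (\<exists>t. halted_at M inp t) \<and>
        (\<exists>ys. written (ram_at M inp (halting_time M inp)) = concat (map enc_point ys) \<and> R I ys \<and>
           (\<forall>i\<le>length ys. delay M inp (length ys) i \<le> poly2 q (input_size I) i)))"

end

theory Submission
  imports Defs
begin

text \<open>
  A lexicographic optimum for nonnegative weights is an extreme point of the upper image, and for a
  pair of extreme points either some outcome lies strictly below the line through them, and then the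
  optimum lies strictly between them, or no extreme point lies between them. Counting for every
  abscissa the outputs there and the queued pairs around it gives an invariant that is at most 1,
  and equal to 1 at extreme points; it yields both completeness and absence of repetitions. Twice
  the number of outputs minus the size of the queue grows by 1 in every step, so that a run with
  \<open>k\<close> outputs has at most \<open>2 k\<close> steps.

  On the RAM, the lexicographic algorithm is simulated by an interpreter. Every call uses its own row
  of a two-dimensional memory, so nothing has to be cleared. The queue is a stack of points
  sorted along the frontier, in which neighbours are the pairs still to be treated.
\<close>

section \<open>Extreme points of the upper image\<close>

text \<open>Tie-breaking is what makes every output extreme: a mere weighted-sum optimum may lie
  inside an edge of the frontier, or be dominated when a weight is zero. Once outputs are extreme,
  the geometry reduces to one planar fact: an extreme point never lies on or above a segment between
  two other outcomes. The delay claim concerns one RAM program, about whose subroutine only input,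
  output, time and cell size are known. A call may leave values at addresses that are exponentially
  large and unknown to the caller, so cleaning up would need a log of all writes. Separate rows cost
  only address length: their number is exponential in \<open>nvars I\<close>, but its bit length is
  linear. The free choice of the pair in \<open>da_step\<close> is what permits a stack. Since
  \<open>enc_point\<close> demands reduced fractions, each output also needs a gcd, which is why the
  number of Euclidean iterations matters.\<close>

locale boco =
  fixes I :: boco_instance
  assumes cost_carrier: "cost I \<in> carrier_mat 2 (nvars I)"
    and sols_01: "sols I \<subseteq> {x \<in> carrier_vec (nvars I). \<forall>j<nvars I. x $ j \<in> {0, 1}}"
begin

definition outcomes :: "(rat \<times> rat) set" where
  "outcomes = img I ` sols I"

text \<open>A 0/1 vector is determined by the positions of its ones. The bound later limits the
  number of calls and thereby the rows needed on the RAM.\<close>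

lemma finite_sols: "finite (sols I)" and card_sols_le: "card (sols I) \<le> 2 ^ nvars I"
proof -
  let ?f = "\<lambda>x::int vec. {j\<in>{..<nvars I}. x $ j = 1}"
  have inj: "inj_on ?f (sols I)"
  proof (rule inj_onI)
    fix x y assume xy: "x \<in> sols I" "y \<in> sols I" and eq: "?f x = ?f y"
    have "x $ j = y $ j" if "j < nvars I" for j
    proof -
      have "x $ j \<in> {0,1}" "y $ j \<in> {0,1}" using xy sols_01 that by auto
      moreover have "x $ j = 1 \<longleftrightarrow> y $ j = 1" using eq that by blast
      ultimately show ?thesis by auto
    qed
    moreover have "x \<in> carrier_vec (nvars I)" "y \<in> carrier_vec (nvars I)"
      using xy sols_01 by blast+
    ultimately show "x = y" by (intro eq_vecI) auto
  qed
  have sub: "?f ` sols I \<subseteq> Pow {..<nvars I}" by auto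
  show "finite (sols I)" using inj sub by (rule inj_on_finite) simp
  show "card (sols I) \<le> 2 ^ nvars I"
    using card_inj_on_le[OF inj sub] by (simp add: card_Pow)
qed

lemma finite_outcomes: "finite outcomes"
  by (simp add: outcomes_def finite_sols)

lemma card_outcomes_le: "card outcomes \<le> 2 ^ nvars I"
  unfolding outcomes_def using card_image_le[OF finite_sols] card_sols_le by (rule le_trans)

abbreviation real_img :: "real vec \<Rightarrow> real \<times> real" where
  "real_img v \<equiv> ((map_mat real_of_rat (cost I) *\<^sub>v v) $ 0, (map_mat real_of_rat (cost I) *\<^sub>v v) $ 1)"

lemma real_img_nth:
  assumes "i < 2" "v \<in> carrier_vec (nvars I)"
  shows "(map_mat real_of_rat (cost I) *\<^sub>v v) $ i
    = (\<Sum>j<nvars I. real_of_rat (cost I $$ (i, j)) * v $ j)"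
  using assms cost_carrier by (auto simp: scalar_prod_def atLeast0LessThan intro!: sum.cong)

lemma img_nth:
  assumes "i < 2" "x \<in> carrier_vec (nvars I)"
  shows "(cost I *\<^sub>v map_vec rat_of_int x) $ i
    = (\<Sum>j<nvars I. cost I $$ (i, j) * rat_of_int (x $ j))"
  using assms cost_carrier by (auto simp: scalar_prod_def atLeast0LessThan intro!: sum.cong)

lemma real_img_of_int:
  assumes "x \<in> sols I"
  shows "real_img (map_vec real_of_int x) = real_point (img I x)"
proof -
  have x: "x \<in> carrier_vec (nvars I)" using assms sols_01 by auto
  have "(map_mat real_of_rat (cost I) *\<^sub>v map_vec real_of_int x) $ i
      = real_of_rat ((cost I *\<^sub>v map_vec rat_of_int x) $ i)" if "i < 2" for i
    using x that by (simp add: img_nth real_img_nth of_rat_sum of_rat_mult)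
  then show ?thesis by (simp add: real_point_def img_def Let_def)
qed

lemma real_img_sum:
  assumes F: "F \<subseteq> carrier_vec (nvars I)"
  shows "real_img (vec (nvars I) (\<lambda>j. \<Sum>x\<in>F. u x * x $ j)) = (\<Sum>x\<in>F. u x *\<^sub>R real_img x)"
proof -
  let ?n = "nvars I"
  have "(map_mat real_of_rat (cost I) *\<^sub>v vec ?n (\<lambda>j. \<Sum>x\<in>F. u x * x $ j)) $ i
      = (\<Sum>x\<in>F. u x * (map_mat real_of_rat (cost I) *\<^sub>v x) $ i)" if "i < 2" for i
  proof -
    have "(map_mat real_of_rat (cost I) *\<^sub>v vec ?n (\<lambda>j. \<Sum>x\<in>F. u x * x $ j)) $ i
      = (\<Sum>j<?n. \<Sum>x\<in>F. real_of_rat (cost I $$ (i, j)) * (u x * x $ j))"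
      using that by (simp add: real_img_nth sum_distrib_left)
    also have "\<dots> = (\<Sum>x\<in>F. \<Sum>j<?n. real_of_rat (cost I $$ (i, j)) * (u x * x $ j))"
      by (rule sum.swap)
    also have "\<dots> = (\<Sum>x\<in>F. u x * (map_mat real_of_rat (cost I) *\<^sub>v x) $ i)"
      using F that by (intro sum.cong) (auto simp: real_img_nth sum_distrib_left mult_ac)
    finally show ?thesis .
  qed
  then show ?thesis by (simp add: prod_eq_iff fst_sum snd_sum)
qed

text \<open>A linear map commutes with convex combinations. From here on only the finite planar set
  \<open>outcomes\<close> matters for the geometry.\<close>

lemma upper_image_eq:
  "upper_image I = {(fst h + r, snd h + s) | h r s.
     h \<in> convex hull (real_point ` outcomes) \<and> r \<ge> 0 \<and> s \<ge> 0}"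
proof -
  let ?V = "map_vec real_of_int ` sols I"
  have V: "?V \<subseteq> carrier_vec (nvars I)" using sols_01 by auto
  have img: "real_img ` ?V = real_point ` outcomes"
    unfolding outcomes_def image_image by (intro image_cong refl real_img_of_int)
  have "real_img ` conv_vec (nvars I) ?V = convex hull (real_img ` ?V)"
  proof (intro equalityI subsetI)
    fix z assume "z \<in> real_img ` conv_vec (nvars I) ?V"
    then obtain F u where F: "finite F" "F \<subseteq> ?V" "\<forall>x\<in>F. u x \<ge> 0" "sum u F = 1"
      and z: "z = real_img (vec (nvars I) (\<lambda>j. \<Sum>x\<in>F. u x * x $ j))"
      unfolding conv_vec_def by blast
    have "z = (\<Sum>x\<in>F. u x *\<^sub>R real_img x)"
      unfolding z using F(2) V by (intro real_img_sum) auto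
    also have "\<dots> \<in> convex hull (real_img ` ?V)"
      using F by (intro convex_sum) (auto intro!: hull_inc)
    finally show "z \<in> convex hull (real_img ` ?V)" .
  next
    fix z assume z: "z \<in> convex hull (real_img ` ?V)"
    \<comment> \<open>Several solutions may share an outcome, so the weight of each outcome is given
      to one chosen preimage.\<close>
    let ?S = "real_img ` ?V" and ?g = "inv_into ?V real_img"
    have fin: "finite ?S" using finite_sols by simp
    obtain u where u: "\<forall>y\<in>?S. u y \<ge> 0" "sum u ?S = 1" "(\<Sum>y\<in>?S. u y *\<^sub>R y) = z"
      using z unfolding convex_hull_finite[OF fin] by blast
    have g: "?g y \<in> ?V" "real_img (?g y) = y" if "y \<in> ?S" for y
      using that by (rule inv_into_into, rule f_inv_into_f)
    have inj: "inj_on ?g ?S" by (rule inj_on_inv_into) simp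
    let ?u = "\<lambda>x. u (real_img x)"
    have "real_img (vec (nvars I) (\<lambda>j. \<Sum>x\<in>?g ` ?S. ?u x * x $ j)) = (\<Sum>x\<in>?g ` ?S. ?u x *\<^sub>R real_img x)"
      using g(1) V by (intro real_img_sum) blast
    also have "\<dots> = (\<Sum>y\<in>?S. u y *\<^sub>R y)"
      using g(2) by (subst sum.reindex[OF inj]) (auto simp del: Pair_inject intro!: sum.cong)
    finally have z': "z = real_img (vec (nvars I) (\<lambda>j. \<Sum>x\<in>?g ` ?S. ?u x * x $ j))" using u(3) by simp
    have "sum ?u (?g ` ?S) = sum u ?S"
      using g(2) by (subst sum.reindex[OF inj]) (auto simp del: Pair_inject intro!: sum.cong)
    then have "vec (nvars I) (\<lambda>j. \<Sum>x\<in>?g ` ?S. ?u x * x $ j) \<in> conv_vec (nvars I) ?V"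
      unfolding conv_vec_def using fin g u
      by (intro CollectI exI[of _ "?g ` ?S"] exI[of _ ?u]) auto
    then show "z \<in> real_img ` conv_vec (nvars I) ?V" unfolding z' by (rule imageI)
  qed
  then have "(\<exists>x. x \<in> conv_vec (nvars I) ?V \<and> h = real_img x) \<longleftrightarrow> h \<in> convex hull (real_point ` outcomes)" for h
    unfolding img by blast
  then show ?thesis unfolding upper_image_def by (auto; metis fst_conv snd_conv)
qed

lemma hull_subset_upper_image: "convex hull (real_point ` outcomes) \<subseteq> upper_image I"
proof
  fix h assume "h \<in> convex hull (real_point ` outcomes)"
  then show "h \<in> upper_image I"
    unfolding upper_image_eq by (intro CollectI exI[of _ h] exI[of _ 0]) simp
qed

text \<open>If \<open>e\<close> differed from \<open>h\<close>, it would be the midpoint of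
  \<open>h\<close> and \<open>h + 2 (e - h)\<close>; the latter is componentwise at least
  \<open>h\<close> and so belongs to the upper image as well.\<close>

lemma extreme_above_hull:
  assumes e: "e extreme_point_of upper_image I" and h: "h \<in> convex hull (real_point ` outcomes)"
    and le: "fst h \<le> fst e" "snd h \<le> snd e"
  shows "e = h"
proof (rule ccontr)
  assume ne: "e \<noteq> h"
  let ?d = "2 *\<^sub>R (e - h)"
  have hU: "h \<in> upper_image I" using h hull_subset_upper_image by blast
  have hd: "h + ?d \<in> upper_image I"
    unfolding upper_image_eq using h le
    by (intro CollectI exI[of _ h] exI[of _ "fst ?d"] exI[of _ "snd ?d"]) (auto simp: prod_eq_iff)
  have "h \<noteq> h + ?d" using ne by simp
  moreover have "e = (1 - 1 / 2) *\<^sub>R h + (1 / 2) *\<^sub>R (h + ?d)" by (simp add: prod_eq_iff field_simps)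
  ultimately have "e \<in> open_segment h (h + ?d)" unfolding in_segment
    by (intro conjI exI[of _ "1 / 2"]) auto
  with hd show False using e hU unfolding extreme_point_of_def by blast
qed

definition extreme :: "rat \<times> rat \<Rightarrow> bool" where
  "extreme y \<longleftrightarrow> real_point y \<in> nondominated_extreme_points I"

lemma inj_real_point: "inj real_point"
  by (auto simp: inj_def real_point_def prod_eq_iff)

text \<open>The quadrant part of an extreme point must vanish, and the extreme points of the hull of
  a set belong to the set. So extreme points are rational, which justifies the rational predicate
  \<open>extreme\<close>.\<close>

lemma extreme_point_outcome:
  assumes e: "e extreme_point_of upper_image I"
  shows "e \<in> real_point ` outcomes"
proof -
  have "e \<in> upper_image I" using e by (simp add: extreme_point_of_def)
  then obtain h r s where "e = (fst h + r, snd h + s)" "r \<ge> 0" "s \<ge> 0"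
    and h: "h \<in> convex hull (real_point ` outcomes)" unfolding upper_image_eq by blast
  then have "e = h" using extreme_above_hull[OF e h] by simp
  then have "e extreme_point_of (convex hull (real_point ` outcomes))"
    using e h hull_subset_upper_image unfolding extreme_point_of_def by blast
  then show ?thesis by (rule extreme_point_of_convex_hull)
qed

lemma nondominated_extreme_points_eq: "nondominated_extreme_points I = real_point ` {y. extreme y}"
  using extreme_point_outcome unfolding extreme_def nondominated_extreme_points_def by blast

lemma extreme_outcome: "extreme y \<Longrightarrow> y \<in> outcomes"
  using extreme_point_outcome[of "real_point y"] inj_real_point
  by (simp add: extreme_def nondominated_extreme_points_def inj_image_mem_iff)

text \<open>The form in which extremality enters the later planar arguments. The segment point with
  parameter \<open>u\<close> lies in the hull, hence equals \<open>a\<close> if it is componentwise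
  at most \<open>a\<close>, and no inner point of a segment is extreme. A rational parameter keeps
  later computations among rationals.\<close>

lemma extreme_above_segment:
  assumes a: "extreme a" and cd: "c \<in> outcomes" "d \<in> outcomes" and u: "0 \<le> u" "u \<le> 1"
    and le: "(1 - u) * fst c + u * fst d \<le> fst a" "(1 - u) * snd c + u * snd d \<le> snd a"
  shows "a = c \<or> a = d"
proof -
  have e: "real_point a extreme_point_of upper_image I"
    using a by (simp add: extreme_def nondominated_extreme_points_def)
  let ?u = "real_of_rat u"
  let ?h = "(1 - ?u) *\<^sub>R real_point c + ?u *\<^sub>R real_point d"
  have u': "0 \<le> ?u" "?u \<le> 1" using u by (auto simp: of_rat_less_eq[of _ 1, simplified])
  have seg: "?h \<in> closed_segment (real_point c) (real_point d)"
    unfolding closed_segment_def using u' by blast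
  have "closed_segment (real_point c) (real_point d) \<subseteq> convex hull (real_point ` outcomes)"
    unfolding segment_convex_hull using cd by (intro hull_mono) auto
  with seg have h: "?h \<in> convex hull (real_point ` outcomes)" by blast
  have r: "fst ?h = real_of_rat ((1 - u) * fst c + u * fst d)" "snd ?h = real_of_rat ((1 - u) * snd c + u * snd d)"
    by (simp_all add: real_point_def of_rat_add of_rat_mult of_rat_diff)
  have "real_point a = ?h"
    by (rule extreme_above_hull[OF e h]) (simp_all only: r, simp_all add: real_point_def of_rat_less_eq le)
  with seg have "real_point a \<in> closed_segment (real_point c) (real_point d)" by simp
  moreover have "real_point c \<in> upper_image I" "real_point d \<in> upper_image I"
    using cd hull_subset_upper_image hull_subset[of "real_point ` outcomes" convex] by blast+
  then have "real_point a \<notin> open_segment (real_point c) (real_point d)"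
    using e unfolding extreme_point_of_def by blast
  ultimately have "real_point a = real_point c \<or> real_point a = real_point d"
    by (auto simp: open_segment_def)
  then show ?thesis using inj_real_point by (auto dest: injD)
qed

lemma extreme_not_dominated:
  assumes "extreme a" "c \<in> outcomes" "fst c \<le> fst a" "snd c \<le> snd a"
  shows "a = c"
  using extreme_above_segment[OF assms(1,2,2), of 0] assms by simp

text \<open>Of two points with the same abscissa the lower one dominates the other. So abscissae
  identify extreme points, which permits \<open>cover\<close> to count by abscissa.\<close>

lemma extreme_fst_inj:
  assumes "extreme a" "extreme b" "fst a = fst b"
  shows "a = b"
proof (cases "snd a \<le> snd b")
  case True
  then show ?thesis using extreme_not_dominated[OF assms(2) extreme_outcome[OF assms(1)]] assms by simp
next
  case False
  then show ?thesis using extreme_not_dominated[OF assms(1) extreme_outcome[OF assms(2)]] assms by simp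
qed

lemma extreme_snd_less:
  assumes "extreme a" "extreme b" "fst a < fst b"
  shows "snd b < snd a"
proof (rule ccontr)
  assume "\<not> snd b < snd a"
  then have "b = a" using extreme_not_dominated[OF assms(2) extreme_outcome[OF assms(1)]] assms by simp
  then show False using assms by simp
qed

text \<open>The upper image lies in the convex set of points that are lexicographically not smaller
  than the optimum, so a proper convex combination can only hit the optimum trivially.\<close>

lemma lex_optimal_extreme:
  assumes opt: "lex_optimal I l x" and l: "fst l \<ge> 0" "snd l \<ge> 0"
  shows "extreme (img I x)"
proof -
  define y where "y = real_point (img I x)"
  define w where "w z = real_of_rat (fst l) * fst z + real_of_rat (snd l) * snd z" for z :: "real \<times> real"
  define K where "K = {z. w y < w z \<or> w y = w z \<and> (fst y < fst z \<or> fst y = fst z \<and> snd y \<le> snd z)}"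
  have w_real_point: "w (real_point z) = real_of_rat (wsum l z)" for z
    by (simp add: w_def real_point_def wsum_def of_rat_add of_rat_mult)
  have w_lin: "w (u *\<^sub>R a + v *\<^sub>R b) = u * w a + v * w b" for u v a b
    by (simp add: w_def algebra_simps)
  \<comment> \<open>One level of the lexicographic comparison: a proper mean of two numbers that are
    at least \<open>c\<close> exceeds \<open>c\<close> unless both equal \<open>c\<close>. It is
    applied to the weighted sum and then to each coordinate.\<close>
  have mix: "u * p + v * q > c \<or> u * p + v * q = c \<and> p = c \<and> q = c"
    if "u > 0" "v > 0" "u + v = 1" "p \<ge> c" "q \<ge> c" for u v p q c :: real
  proof (cases "p = c \<and> q = c")
    case True
    then show ?thesis using that by (auto simp flip: distrib_right)
  next
    case False
    have "u * (p - c) \<ge> 0" "v * (q - c) \<ge> 0" using that by auto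
    moreover have "u * (p - c) > 0 \<or> v * (q - c) > 0" using that False by auto
    ultimately have "u * (p - c) + v * (q - c) > 0" by linarith
    also have "u * (p - c) + v * (q - c) = u * p + v * q - (u + v) * c" by (simp add: algebra_simps)
    finally show ?thesis using that by simp
  qed
  have Kmix: "u *\<^sub>R a + v *\<^sub>R b \<in> K \<and> (u *\<^sub>R a + v *\<^sub>R b = y \<longrightarrow> a = y \<and> b = y)"
    if uv: "u > 0" "v > 0" "u + v = 1" and ab: "a \<in> K" "b \<in> K" for u v a b
  proof -
    have 1: "w a \<ge> w y" "w b \<ge> w y" using ab by (auto simp: K_def)
    consider "w (u *\<^sub>R a + v *\<^sub>R b) > w y" | "w (u *\<^sub>R a + v *\<^sub>R b) = w y" "w a = w y" "w b = w y"
      using mix[OF uv 1] by (auto simp: w_lin)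
    then show ?thesis
    proof cases
      case 1
      then show ?thesis by (auto simp: K_def)
    next
      case 2
      then have 3: "fst a \<ge> fst y" "fst b \<ge> fst y" using ab by (auto simp: K_def)
      consider "u * fst a + v * fst b > fst y" | "u * fst a + v * fst b = fst y" "fst a = fst y" "fst b = fst y"
        using mix[OF uv 3] by auto
      then show ?thesis
      proof cases
        case 1
        then show ?thesis using 2 by (auto simp: K_def)
      next
        case b: 2
        then have 4: "snd a \<ge> snd y" "snd b \<ge> snd y" using ab 2 by (auto simp: K_def)
        then show ?thesis using mix[OF uv 4] b 2 by (auto simp: K_def prod_eq_iff)
      qed
    qed
  qed
  have "convex K"
    unfolding convex_alt
  proof (intro ballI allI impI)
    fix a b u assume ab: "a \<in> K" "b \<in> K" and u: "0 \<le> u \<and> u \<le> (1::real)"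
    consider "u = 0" | "u = 1" | "0 < 1 - u" "0 < u" using u by fastforce
    then show "(1 - u) *\<^sub>R a + u *\<^sub>R b \<in> K"
      using Kmix[of "1 - u" u a b] ab by cases auto
  qed
  moreover have "real_point ` outcomes \<subseteq> K"
  proof
    fix z assume "z \<in> real_point ` outcomes"
    then obtain x' where x': "x' \<in> sols I" "z = real_point (img I x')" by (auto simp: outcomes_def)
    then have "lex_objective I l x = lex_objective I l x' \<or>
        (lex_objective I l x, lex_objective I l x') \<in> lex_less"
      using opt by (auto simp: lex_optimal_def)
    then show "z \<in> K"
      unfolding K_def mem_Collect_eq x'(2) y_def w_real_point
      by (cases "img I x"; cases "img I x'")
        (auto simp: lex_objective_def lex_less_def real_point_def of_rat_less of_rat_less_eq)
  qed
  ultimately have hull: "convex hull (real_point ` outcomes) \<subseteq> K" by (rule hull_minimal[rotated])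
  have UK: "upper_image I \<subseteq> K"
  proof
    fix z assume "z \<in> upper_image I"
    then obtain h r s where z: "z = (fst h + r, snd h + s)" "r \<ge> 0" "s \<ge> 0" and "h \<in> convex hull (real_point ` outcomes)"
      unfolding upper_image_eq by blast
    then have "h \<in> K" using hull by blast
    \<comment> \<open>If a component of \<open>l\<close> is zero, the translation may keep the
      weighted sum; the comparison then passes to the coordinates, which do not decrease.\<close>
    moreover have "real_of_rat (fst l) * r \<ge> 0" "real_of_rat (snd l) * s \<ge> 0" using z l by auto
    ultimately show "z \<in> K" using z by (auto simp: K_def w_def algebra_simps)
  qed
  have "y \<in> upper_image I"
    using opt hull_subset_upper_image hull_subset[of "real_point ` outcomes" convex]
    by (auto simp: y_def outcomes_def lex_optimal_def)
  moreover have "y \<notin> open_segment a b" if "a \<in> upper_image I" "b \<in> upper_image I" for a b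
  proof
    assume "y \<in> open_segment a b"
    then obtain u where u: "0 < u" "u < 1" "y = (1 - u) *\<^sub>R a + u *\<^sub>R b" and "a \<noteq> b"
      by (auto simp: in_segment)
    moreover have "a \<in> K" "b \<in> K" using that UK by auto
    ultimately show False using Kmix[of "1 - u" u a b] by auto
  qed
  ultimately show ?thesis
    by (simp add: extreme_def nondominated_extreme_points_def extreme_point_of_def y_def)
qed

section \<open>Order properties of lexicographic optima\<close>

lemma lex_optimal_outcome: "lex_optimal I l x \<Longrightarrow> img I x \<in> outcomes"
  by (simp add: lex_optimal_def outcomes_def)

lemma lex_optimal_le:
  assumes "lex_optimal I l x" "y \<in> outcomes"
  shows "wsum l (img I x) \<le> wsum l y"
    and "wsum l (img I x) = wsum l y \<Longrightarrow> fst (img I x) \<le> fst y"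
    and "wsum l (img I x) = wsum l y \<Longrightarrow> fst (img I x) = fst y \<Longrightarrow> snd (img I x) \<le> snd y"
proof -
  obtain x' where x': "x' \<in> sols I" "y = img I x'" using assms(2) by (auto simp: outcomes_def)
  then have "lex_objective I l x = lex_objective I l x' \<or>
      (lex_objective I l x, lex_objective I l x') \<in> lex_less"
    using assms(1) by (simp add: lex_optimal_def)
  then show "wsum l (img I x) \<le> wsum l y"
    and "wsum l (img I x) = wsum l y \<Longrightarrow> fst (img I x) \<le> fst y"
    and "wsum l (img I x) = wsum l y \<Longrightarrow> fst (img I x) = fst y \<Longrightarrow> snd (img I x) \<le> snd y"
    unfolding x'(2) lex_objective_def lex_less_def
    by (cases "img I x"; cases "img I x'"; auto)+
qed

lemma lex_optimal_img_unique:
  assumes "lex_optimal I l x" "lex_optimal I l x'"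
  shows "img I x = img I x'"
proof -
  have o: "img I x \<in> outcomes" "img I x' \<in> outcomes" using assms lex_optimal_outcome by auto
  have 1: "wsum l (img I x) = wsum l (img I x')"
    using lex_optimal_le(1)[OF assms(1) o(2)] lex_optimal_le(1)[OF assms(2) o(1)] by simp
  then have 2: "fst (img I x) = fst (img I x')"
    using lex_optimal_le(2)[OF assms(1) o(2)] lex_optimal_le(2)[OF assms(2) o(1)] by simp
  then show ?thesis
    using 1 lex_optimal_le(3)[OF assms(1) o(2)] lex_optimal_le(3)[OF assms(2) o(1)] by (simp add: prod_eq_iff)
qed

text \<open>The RAM calls the algorithm with the weight multiplied by the common denominator. The
  answer may be another solution than for the unscaled weight, but both are optimal for the latter
  and therefore have the same image.\<close>

lemma lex_optimal_scale:
  assumes "lex_optimal I (c * fst l, c * snd l) x" "c > 0"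
  shows "lex_optimal I l x"
proof -
  have "wsum (c * fst l, c * snd l) y = c * wsum l y" for y
    by (simp add: wsum_def algebra_simps)
  then show ?thesis using assms
    by (auto simp: lex_optimal_def lex_objective_def lex_less_def)
qed

end

section \<open>Correctness of the dichotomic approach\<close>

text \<open>Symmetric in the pair, because the splitting rule puts the new point first in both
  pairs, whichever side the other point is on.\<close>

definition between :: "rat \<Rightarrow> (rat \<times> rat) \<times> (rat \<times> rat) \<Rightarrow> bool" where
  "between t p \<longleftrightarrow> min (fst (fst p)) (fst (snd p)) < t \<and> t < max (fst (fst p)) (fst (snd p))"

text \<open>The outputs and the open intervals of the queued pairs never overlap, and splitting a pair
  at the new output leaves this number unchanged.\<close>

definition cover :: "da_state \<Rightarrow> rat \<Rightarrow> nat" where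
  "cover s t = length (filter (\<lambda>y. fst y = t) (fst s)) + size (filter_mset (between t) (snd s))"

lemma da_weight_commute: "da_weight a b = da_weight b a"
  by (simp add: da_weight_def abs_minus_commute)

locale lex_solver = boco +
  fixes alg :: lex_alg
  assumes alg_correct: "\<And>l. fst l \<ge> 0 \<Longrightarrow> snd l \<ge> 0 \<Longrightarrow>
     (case alg I l of None \<Rightarrow> sols I = {} | Some x \<Rightarrow> lex_optimal I l x)"
begin

lemma alg_Some: "fst l \<ge> 0 \<Longrightarrow> snd l \<ge> 0 \<Longrightarrow> alg I l = Some x \<Longrightarrow> lex_optimal I l x"
  using alg_correct[of l] by simp

lemma alg_None_iff: "fst l \<ge> 0 \<Longrightarrow> snd l \<ge> 0 \<Longrightarrow> alg I l = None \<longleftrightarrow> sols I = {}"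
  using alg_correct[of l] by (auto split: option.splits simp: lex_optimal_def)

lemma da_weight_sorted:
  assumes "extreme a" "extreme b" "fst a < fst b"
  shows "da_weight a b = (snd a - snd b, fst b - fst a)"
  using extreme_snd_less[OF assms] assms by (simp add: da_weight_def)

text \<open>The weight is a normal vector of the line through \<open>a\<close> and
  \<open>b\<close>.\<close>

lemma wsum_da_weight: 
  assumes "extreme a" "extreme b" "fst a < fst b"
  shows "wsum (da_weight a b) a = wsum (da_weight a b) b"
  unfolding da_weight_sorted[OF assms] by (simp add: wsum_def algebra_simps)

text \<open>If \<open>y\<close> is below the line but not to the right of \<open>a\<close>, the
  segment from \<open>y\<close> to \<open>b\<close> passes at or below \<open>a\<close>, which
  contradicts extremality. The other side is symmetric.\<close>

lemma split_between:
  assumes a: "extreme a" and b: "extreme b" and ab: "fst a < fst b"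
    and y: "y \<in> outcomes" "wsum (da_weight a b) y < wsum (da_weight a b) a"
  shows "fst a < fst y" "fst y < fst b"
proof -
  define l m where "l = snd a - snd b" and "m = fst b - fst a"
  have lm: "l > 0" "m > 0" using extreme_snd_less[OF a b ab] ab by (auto simp: l_def m_def)
  have y': "l * fst y + m * snd y < l * fst a + m * snd a" "l * fst a + m * snd a = l * fst b + m * snd b"
    using y(2) wsum_da_weight[OF a b ab] unfolding da_weight_sorted[OF a b ab] by (simp_all add: wsum_def l_def m_def)
  have ao: "a \<in> outcomes" "b \<in> outcomes" using a b extreme_outcome by auto
  show "fst a < fst y"
  proof (rule ccontr)
    assume "\<not> fst a < fst y"
    then have le: "fst y \<le> fst a" by simp
    \<comment> \<open>The parameter at which the segment from \<open>y\<close> to \<open>b\<close>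
      has the abscissa of \<open>a\<close>.\<close>
    define u where "u = (fst a - fst y) / (fst b - fst y)"
    have u: "0 \<le> u" "u \<le> 1" using le ab by (auto simp: u_def divide_le_eq)
    have f: "(1 - u) * fst y + u * fst b = fst a"
    proof -
      have "u * (fst b - fst y) = fst a - fst y" using le ab by (simp add: u_def)
      then show ?thesis by (simp add: algebra_simps)
    qed
    have "(1 - u) * (l * fst y + m * snd y) + u * (l * fst b + m * snd b) \<le> (1 - u) * (l * fst a + m * snd a) + u * (l * fst a + m * snd a)"
      by (rule add_mono[OF mult_left_mono mult_left_mono]) (use u y' in auto)
    also have "\<dots> = l * fst a + m * snd a" by (simp add: algebra_simps)
    also have "(1 - u) * (l * fst y + m * snd y) + u * (l * fst b + m * snd b)
      = l * ((1 - u) * fst y + u * fst b) + m * ((1 - u) * snd y + u * snd b)" by (simp add: algebra_simps)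
    finally have "m * ((1 - u) * snd y + u * snd b) \<le> m * snd a" by (simp add: f)
    then have "(1 - u) * snd y + u * snd b \<le> snd a" using lm by simp
    then have "a = y \<or> a = b" using extreme_above_segment[OF a y(1) ao(2) u] f by simp
    then show False using y(2) ab by auto
  qed
  show "fst y < fst b"
  proof (rule ccontr)
    assume "\<not> fst y < fst b"
    then have le: "fst b \<le> fst y" by simp
    define u where "u = (fst b - fst a) / (fst y - fst a)"
    have u: "0 \<le> u" "u \<le> 1" using le ab by (auto simp: u_def divide_le_eq)
    have f: "(1 - u) * fst a + u * fst y = fst b"
    proof -
      have "u * (fst y - fst a) = fst b - fst a" using le ab by (simp add: u_def)
      then show ?thesis by (simp add: algebra_simps)
    qed
    have "(1 - u) * (l * fst a + m * snd a) + u * (l * fst y + m * snd y) \<le> (1 - u) * (l * fst b + m * snd b) + u * (l * fst b + m * snd b)"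
      by (rule add_mono[OF mult_left_mono mult_left_mono]) (use u y' in auto)
    also have "\<dots> = l * fst b + m * snd b" by (simp add: algebra_simps)
    also have "(1 - u) * (l * fst a + m * snd a) + u * (l * fst y + m * snd y)
      = l * ((1 - u) * fst a + u * fst y) + m * ((1 - u) * snd a + u * snd y)" by (simp add: algebra_simps)
    finally have "m * ((1 - u) * snd a + u * snd y) \<le> m * snd b" by (simp add: f)
    then have "(1 - u) * snd a + u * snd y \<le> snd b" using lm by simp
    then have "b = a \<or> b = y" using extreme_above_segment[OF b ao(1) y(1) u] f by simp
    then show False using y y' ab by (auto simp: da_weight_sorted[OF a b] wsum_def l_def m_def)
  qed
qed

text \<open>An extreme point strictly between \<open>a\<close> and \<open>b\<close> that is not
  below the line would be on or above the segment from \<open>a\<close> to \<open>b\<close>.\<close>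

lemma no_extreme_between:
  assumes a: "extreme a" and b: "extreme b" and ab: "fst a < fst b"
    and e: "extreme e" and le: "wsum (da_weight a b) a \<le> wsum (da_weight a b) e"
  shows "\<not> (fst a < fst e \<and> fst e < fst b)"
proof
  assume bt: "fst a < fst e \<and> fst e < fst b"
  define l m where "l = snd a - snd b" and "m = fst b - fst a"
  have lm: "l > 0" "m > 0" using extreme_snd_less[OF a b ab] ab by (auto simp: l_def m_def)
  have le': "l * fst a + m * snd a \<le> l * fst e + m * snd e" "l * fst a + m * snd a = l * fst b + m * snd b"
    using le wsum_da_weight[OF a b ab] unfolding da_weight_sorted[OF a b ab] by (simp_all add: wsum_def l_def m_def)
  define u where "u = (fst e - fst a) / (fst b - fst a)"
  have u: "0 \<le> u" "u \<le> 1" using bt by (auto simp: u_def divide_le_eq)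
  have f: "(1 - u) * fst a + u * fst b = fst e"
  proof -
    have "u * (fst b - fst a) = fst e - fst a" using bt by (simp add: u_def)
    then show ?thesis by (simp add: algebra_simps)
  qed
  have "l * ((1 - u) * fst a + u * fst b) + m * ((1 - u) * snd a + u * snd b)
      = (1 - u) * (l * fst a + m * snd a) + u * (l * fst b + m * snd b)" by (simp add: algebra_simps)
  also have "\<dots> = l * fst a + m * snd a" unfolding le'(2)[symmetric] by (simp add: algebra_simps)
  finally have "m * ((1 - u) * snd a + u * snd b) \<le> m * snd e" using le' by (simp add: f)
  then have "(1 - u) * snd a + u * snd b \<le> snd e" using lm by simp
  then have "e = a \<or> e = b"
    using extreme_above_segment[OF e _ _ u, of a b] a b extreme_outcome f by simp
  then show False using bt by auto
qed

definition da_inv :: "da_state \<Rightarrow> bool" where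
  "da_inv s \<longleftrightarrow> (\<forall>y\<in>set (fst s). extreme y)
     \<and> (\<forall>(a, b)\<in>#snd s. extreme a \<and> extreme b \<and> fst a \<noteq> fst b)
     \<and> (\<forall>t. cover s t \<le> 1) \<and> (\<forall>e. extreme e \<longrightarrow> cover s (fst e) = 1)"

lemma da_inv_step:
  assumes inv: "da_inv s" and step: "da_step alg I s s'"
  shows "da_inv s'"
  using step
proof cases
  case (discard l y2 y3 x out Q)
  have p: "extreme y2" "extreme y3" "fst y2 \<noteq> fst y3" using inv discard by (auto simp: da_inv_def)
  have opt: "lex_optimal I l x" using discard by (intro alg_Some) (auto simp: da_weight_def)
  \<comment> \<open>The discard test says that the line already attains the minimum of the weighted
    sum, so removing the pair leaves \<open>cover\<close> unchanged at every extreme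
    abscissa.\<close>
  have no: "\<not> between (fst e) (y2, y3)" if e: "extreme e" for e
  proof -
    have le: "wsum l y2 \<le> wsum l e" "wsum l y3 \<le> wsum l e"
      using lex_optimal_le(1)[OF opt extreme_outcome[OF e]] discard by auto
    show ?thesis
    proof (cases "fst y2 < fst y3")
      case True
      then show ?thesis using no_extreme_between[OF p(1,2) True e] le discard by (auto simp: between_def)
    next
      case False
      then have lt: "fst y3 < fst y2" using p by simp
      show ?thesis using no_extreme_between[OF p(2,1) lt e] le lt discard by (auto simp: between_def da_weight_commute)
    qed
  qed
  have cov: "cover s t = cover s' t + (if between t (y2, y3) then 1 else 0)" for t
    using discard by (simp add: cover_def)
  have "cover s t \<le> 1" for t using inv unfolding da_inv_def by blast
  then have "cover s' t \<le> 1" for t using cov[of t] by (metis le_add1 le_trans)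
  moreover have "cover s' (fst e) = 1" if "extreme e" for e
  proof -
    have "cover s (fst e) = 1" using inv that unfolding da_inv_def by blast
    then show ?thesis using cov[of "fst e"] no[OF that] by simp
  qed
  ultimately show ?thesis using inv discard by (simp add: da_inv_def)
next
  case (split l y2 y3 x out Q)
  have p: "extreme y2" "extreme y3" "fst y2 \<noteq> fst y3" using inv split by (auto simp: da_inv_def)
  have opt: "lex_optimal I l x" using split by (intro alg_Some) (auto simp: da_weight_def)
  have l: "fst l \<ge> 0" "snd l \<ge> 0" using split by (auto simp: da_weight_def)
  let ?y = "img I x"
  have y: "extreme ?y" using lex_optimal_extreme[OF opt l] .
  have le: "wsum l ?y \<le> wsum l y2" "wsum l ?y \<le> wsum l y3"
    using lex_optimal_le(1)[OF opt] p extreme_outcome by auto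
  \<comment> \<open>The end points have equal weighted sums, so a failed test leaves only a strictly
    smaller value at the optimum.\<close>
  have bt: "between (fst ?y) (y2, y3)"
  proof (cases "fst y2 < fst y3")
    case True
    have "wsum l ?y < wsum l y2" using le wsum_da_weight[OF p(1,2) True] split by auto
    then show ?thesis using split_between[OF p(1,2) True lex_optimal_outcome[OF opt]] split True
      by (auto simp: between_def)
  next
    case False
    then have lt: "fst y3 < fst y2" using p by simp
    have "wsum l ?y < wsum l y3" using le wsum_da_weight[OF p(2,1) lt] split by (auto simp: da_weight_commute)
    then show ?thesis using split_between[OF p(2,1) lt lex_optimal_outcome[OF opt]] split lt
      by (auto simp: between_def da_weight_commute)
  qed
  have cov: "cover s' t = cover s t" for t
  proof -
    have "(if fst ?y = t then 1 else 0) + (if between t (?y, y2) then 1 else 0) + (if between t (?y, y3) then 1 else 0)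
       = (if between t (y2, y3) then 1 else 0 :: nat)"
      using bt unfolding between_def by (cases "fst y2 \<le> fst y3") (auto simp: min_def max_def)
    then show ?thesis unfolding split(1,2) cover_def by (simp split: if_splits)
  qed
  have "(\<forall>t. cover s' t \<le> 1) \<and> (\<forall>e. extreme e \<longrightarrow> cover s' (fst e) = 1)"
    using inv unfolding cov da_inv_def by blast
  then show ?thesis using inv split(1,2) p y bt
    by (auto simp: da_inv_def between_def)
qed

lemma da_inv_steps: "(da_step alg I)\<^sup>*\<^sup>* s s' \<Longrightarrow> da_inv s \<Longrightarrow> da_inv s'"
  by (induction rule: rtranclp_induct) (auto intro: da_inv_step)

lemma da_start_endpoints:
  assumes o: "lex_optimal I (1, 0) x0" "lex_optimal I (0, 1) x1"
  shows "extreme (img I x0)" "extreme (img I x1)"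
    and "\<And>y. y \<in> outcomes \<Longrightarrow> fst (img I x0) \<le> fst y"
    and "\<And>y. y \<in> outcomes \<Longrightarrow> snd (img I x1) \<le> snd y"
    and "img I x0 \<noteq> img I x1 \<Longrightarrow> fst (img I x0) < fst (img I x1)"
proof -
  show e: "extreme (img I x0)" "extreme (img I x1)"
    using o by (auto intro: lex_optimal_extreme)
  show *: "fst (img I x0) \<le> fst y" if "y \<in> outcomes" for y
    using lex_optimal_le(1)[OF o(1) that] by (simp add: wsum_def)
  show "snd (img I x1) \<le> snd y" if "y \<in> outcomes" for y
    using lex_optimal_le(1)[OF o(2) that] by (simp add: wsum_def)
  show "fst (img I x0) < fst (img I x1)" if "img I x0 \<noteq> img I x1"
    using extreme_fst_inj[OF e] *[OF extreme_outcome[OF e(2)]] that by fastforce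
qed

lemma da_start_cases:
  obtains (infeasible) "sols I = {}" "da_start alg I = ([], {#})"
  | (single) x0 x1 where "alg I (1, 0) = Some x0" "alg I (0, 1) = Some x1" "lex_optimal I (1, 0) x0" "lex_optimal I (0, 1) x1"
      "img I x0 = img I x1" "da_start alg I = ([img I x0], {#})"
  | (pair) x0 x1 where "alg I (1, 0) = Some x0" "alg I (0, 1) = Some x1" "lex_optimal I (1, 0) x0" "lex_optimal I (0, 1) x1"
      "img I x0 \<noteq> img I x1" "da_start alg I = ([img I x0, img I x1], {#(img I x0, img I x1)#})"
proof (cases "sols I = {}")
  case True
  then have "alg I (1, 0) = None" using alg_None_iff[of "(1, 0)"] by simp
  then show ?thesis using True infeasible by (simp add: da_start_def)
next
  case False
  then obtain x0 x1 where x: "alg I (1, 0) = Some x0" "alg I (0, 1) = Some x1"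
    using alg_None_iff[of "(1, 0)"] alg_None_iff[of "(0, 1)"] by auto
  moreover have "lex_optimal I (1, 0) x0" "lex_optimal I (0, 1) x1" using x by (auto intro: alg_Some)
  ultimately show ?thesis using single[of x0 x1] pair[of x0 x1]
    by (cases "img I x0 = img I x1") (auto simp: da_start_def Let_def)
qed

lemma da_inv_start: "da_inv (da_start alg I)"
proof (cases rule: da_start_cases)
  case infeasible
  have "\<not> extreme e" for e using infeasible extreme_outcome[of e] by (auto simp: outcomes_def)
  then show ?thesis using infeasible by (auto simp: da_inv_def cover_def)
next
  case (single x0 x1)
  note end_points = da_start_endpoints[OF single(3,4)]
  have "e = img I x0" if "extreme e" for e
    using extreme_not_dominated[OF that extreme_outcome[OF end_points(1)]]
      end_points(3,4)[OF extreme_outcome[OF that]] single(5) by simp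
  then have "cover (da_start alg I) (fst e) = 1" if "extreme e" for e
    using that single by (simp add: cover_def)
  then show ?thesis using single end_points by (auto simp: da_inv_def cover_def)
next
  case (pair x0 x1)
  note end_points = da_start_endpoints[OF pair(3,4)]
  let ?y0 = "img I x0" and ?y1 = "img I x1"
  have lt: "fst ?y0 < fst ?y1" using end_points(5) pair by simp
  \<comment> \<open>\<open>?y1\<close> minimizes the second coordinate, so it would dominate any
    extreme point to its right.\<close>
  have "fst e \<le> fst ?y1" if e: "extreme e" for e
  proof (rule ccontr)
    assume "\<not> fst e \<le> fst ?y1"
    then have "e = ?y1"
      using extreme_not_dominated[OF e extreme_outcome[OF end_points(2)]]
        end_points(4)[OF extreme_outcome[OF e]] by simp
    then show False using \<open>\<not> fst e \<le> fst ?y1\<close> by simp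
  qed
  then have range: "fst ?y0 \<le> fst e \<and> fst e \<le> fst ?y1" if "extreme e" for e
    using that end_points(3)[OF extreme_outcome[OF that]] by simp
  have "cover (da_start alg I) (fst e) = 1" if "extreme e" for e
    using range[OF that] lt unfolding pair cover_def between_def by auto
  moreover have "cover (da_start alg I) t \<le> 1" for t
    using pair lt by (auto simp: cover_def between_def)
  ultimately show ?thesis using pair end_points lt by (simp add: da_inv_def)
qed

lemma da_inv_distinct:
  assumes "da_inv (out, Q)"
  shows "distinct out"
proof (rule ccontr)
  assume "\<not> distinct out"
  then obtain y xs ys zs where "out = xs @ [y] @ ys @ [y] @ zs" by (blast dest: not_distinct_decomp)
  then have "cover (out, Q) (fst y) \<ge> 2" by (simp add: cover_def)
  moreover have "cover (out, Q) (fst y) \<le> 1" using assms by (simp add: da_inv_def)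
  ultimately show False by simp
qed

lemma da_inv_length:
  assumes "da_inv (out, Q)"
  shows "length out \<le> card outcomes"
proof -
  have "set out \<subseteq> outcomes" using assms extreme_outcome by (auto simp: da_inv_def)
  then have "card (set out) \<le> card outcomes" by (rule card_mono[OF finite_outcomes])
  then show ?thesis using da_inv_distinct[OF assms] by (simp add: distinct_card)
qed

lemma da_inv_final:
  assumes inv: "da_inv (out, {#})"
  shows "lists_nondominated_extreme_points I out"
proof -
  have "e \<in> set out" if e: "extreme e" for e
  proof -
    have "cover (out, {#}) (fst e) = 1" using inv e unfolding da_inv_def by blast
    then have "filter (\<lambda>y. fst y = fst e) out \<noteq> []" by (auto simp: cover_def)
    then obtain y where y: "y \<in> set out" "fst y = fst e" by (auto simp: filter_empty_conv)
    then show ?thesis using inv e extreme_fst_inj[of y e] by (auto simp: da_inv_def)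
  qed
  then have "set out = {y. extreme y}" using inv by (auto simp: da_inv_def)
  then show ?thesis using da_inv_distinct[OF inv]
    by (simp add: lists_nondominated_extreme_points_def nondominated_extreme_points_eq)
qed

definition progress :: "da_state \<Rightarrow> int" where
  "progress s = 2 * int (length (fst s)) - int (size (snd s))"

text \<open>A discard removes one pair; a split adds one point and, on balance, one pair. The change
  is 1 either way, although the queue may grow or shrink.\<close>

lemma progress_step: "da_step alg I s s' \<Longrightarrow> progress s' = progress s + 1"
  by (induction rule: da_step.induct) (auto simp: progress_def)

lemma progress_start_nonneg: "progress (da_start alg I) \<ge> 0"
  by (cases rule: da_start_cases) (auto simp: progress_def)

lemma progress_steps: "(da_step alg I ^^ k) s s' \<Longrightarrow> progress s' = progress s + int k"
  by (induction k arbitrary: s') (auto simp: progress_step)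

lemma progress_le:
  assumes "da_inv s"
  shows "progress s \<le> 2 * int (card outcomes)"
  using da_inv_length[of "fst s" "snd s"] assms by (simp add: progress_def)

text \<open>A queued pair has extreme end points, so the instance is feasible and the algorithm must
  answer.\<close>

lemma da_not_stuck:
  assumes inv: "da_inv (out, add_mset (a, b) Q)"
  shows "\<exists>s. da_step alg I (out, add_mset (a, b) Q) s"
proof -
  have "extreme a" using inv by (simp add: da_inv_def)
  then have "sols I \<noteq> {}" using extreme_outcome[of a] by (auto simp: outcomes_def)
  then obtain x where "alg I (da_weight a b) = Some x"
    using alg_None_iff[of "da_weight a b"] by (auto simp: da_weight_def)
  then show ?thesis using da_step.intros[OF refl, of alg I a b x] by blast
qed

theorem da_enumerates: "da_enumerates alg I"
  unfolding da_enumerates_def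
proof (intro conjI allI impI; (elim conjE)?)
  show "\<nexists>s. s 0 = da_start alg I \<and> (\<forall>k. da_step alg I (s k) (s (Suc k)))"
  proof
    assume "\<exists>s. s 0 = da_start alg I \<and> (\<forall>k. da_step alg I (s k) (s (Suc k)))"
    then obtain s where s: "s 0 = da_start alg I" "\<And>k. da_step alg I (s k) (s (Suc k))" by blast
    have inv: "da_inv (s k)" for k
      by (induction k) (use s da_inv_start da_inv_step in auto)
    have pr: "progress (s k) = progress (s 0) + int k" for k
    proof (induction k)
      case (Suc k)
      then show ?case using progress_step[OF s(2)[of k]] by simp
    qed simp
    have "progress (s (2 * card outcomes + 1)) \<le> 2 * int (card outcomes)"
      using progress_le[OF inv] .
    then show False using progress_start_nonneg s(1) pr[of "2 * card outcomes + 1"] by simp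
  qed
next
  fix out Q assume r: "(da_step alg I)\<^sup>*\<^sup>* (da_start alg I) (out, Q)" and stuck: "\<nexists>s. da_step alg I (out, Q) s"
  have inv: "da_inv (out, Q)" using da_inv_steps[OF r da_inv_start] .
  show "Q = {#}"
  proof (rule ccontr)
    assume "Q \<noteq> {#}"
    then obtain p Q' where "Q = add_mset p Q'" by (auto dest: multiset_nonemptyE multi_nonempty_split)
    then show False using da_not_stuck[of out "fst p" "snd p" Q'] inv stuck by simp
  qed
  then show "lists_nondominated_extreme_points I out" using da_inv_final inv by simp
qed

end

section \<open>Structured programs for the RAM\<close>

datatype com = Skip | Op instr | Seq com com (infixr ";;" 60) | If nat com com | While nat com

fun code_len :: "com \<Rightarrow> nat" where
  "code_len Skip = 0"
| "code_len (Op i) = 1"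
| "code_len (c ;; d) = code_len c + code_len d"
| "code_len (If r c d) = code_len c + code_len d + 2"
| "code_len (While r c) = code_len c + 3"

text \<open>Jumps are absolute, so code depends on its start \<open>p\<close>. The false branch of a
  conditional comes first because the only conditional jump is taken on a positive register; the
  second instruction of a loop is its exit.\<close>

fun code :: "nat \<Rightarrow> com \<Rightarrow> instr list" where
  "code p Skip = []"
| "code p (Op i) = [i]"
| "code p (c ;; d) = code p c @ code (p + code_len c) d"
| "code p (If r c d) = JumpPos r (p + code_len d + 2) # code (p + 1) d
     @ Jump (p + code_len d + code_len c + 2) # code (p + code_len d + 2) c"
| "code p (While r c) = JumpPos r (p + 2) # Jump (p + code_len c + 3) # code (p + 2) c @ [Jump p]"

lemma length_code [simp]: "length (code p c) = code_len c"
  by (induction c arbitrary: p) auto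

definition read_input :: "int list \<Rightarrow> int \<Rightarrow> int" where
  "read_input inp v = (if nat v < length inp then inp ! nat v else 0)"

text \<open>Collects the instructions that write exactly one cell, so that a single rule covers all
  of them.\<close>

fun assigned :: "int list \<Rightarrow> instr \<Rightarrow> (nat \<Rightarrow> int) \<Rightarrow> (nat \<times> int) option" where
  "assigned inp (Const a v) m = Some (a, v)"
| "assigned inp (Add a b c) m = Some (a, m b + m c)"
| "assigned inp (Sub a b c) m = Some (a, m b - m c)"
| "assigned inp (Mul a b c) m = Some (a, m b * m c)"
| "assigned inp (Div a b c) m = Some (a, m b div m c)"
| "assigned inp (Load a b) m = Some (a, m (nat (m b)))"
| "assigned inp (Store a b) m = Some (nat (m a), m b)"
| "assigned inp (Input a b) m = Some (a, read_input inp (m b))"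
| "assigned inp (Output a) m = None"
| "assigned inp (Jump k) m = None"
| "assigned inp (JumpPos a k) m = None"

type_synonym state = "(nat \<Rightarrow> int) \<times> int list \<times> nat"

text \<open>The third component of a state is an upper bound on the number of elapsed machine steps, not
  their exact number: both branches of a conditional are charged two steps.\<close>

inductive big_step :: "int list \<Rightarrow> int \<Rightarrow> com \<Rightarrow> state \<Rightarrow> state \<Rightarrow> bool" for inp B where
  Skip: "big_step inp B Skip s s"
| Assign: "assigned inp i m = Some (a, v) \<Longrightarrow> \<bar>v\<bar> \<le> B \<Longrightarrow>
    big_step inp B (Op i) (m, w, t) (m(a := v), w, t + 1)"
| Output: "big_step inp B (Op (Output a)) (m, w, t) (m, w @ [m a], t + 1)"
| Seq: "big_step inp B c s s' \<Longrightarrow> big_step inp B d s' s'' \<Longrightarrow> big_step inp B (c ;; d) s s''"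
| If: "big_step inp B (if m r > 0 then c else d) (m, w, t + 2) s \<Longrightarrow> big_step inp B (If r c d) (m, w, t) s"
| WhileF: "m r \<le> 0 \<Longrightarrow> big_step inp B (While r c) (m, w, t) (m, w, t + 2)"
| WhileT: "m r > 0 \<Longrightarrow> big_step inp B c (m, w, t + 2) s' \<Longrightarrow> big_step inp B (While r c) s' s'' \<Longrightarrow>
    big_step inp B (While r c) (m, w, t) s''"

inductive_cases SkipE: "big_step inp B Skip s s'"
inductive_cases OpE: "big_step inp B (Op i) s s'"
inductive_cases SeqE: "big_step inp B (c ;; d) s s'"
inductive_cases IfE: "big_step inp B (If r c d) s s'"
inductive_cases WhileE: "big_step inp B (While r c) s s'"

section \<open>Compiled programs on the machine\<close>

definition bounded_mem :: "int \<Rightarrow> (nat \<Rightarrow> int) \<Rightarrow> bool" where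
  "bounded_mem B m \<longleftrightarrow> (\<forall>a. \<bar>m a\<bar> \<le> B)"

text \<open>Every intermediate memory is required to be bounded, since \<open>cells_bounded\<close>
  speaks about all times.\<close>

definition reach :: "instr list \<Rightarrow> int list \<Rightarrow> int \<Rightarrow> nat \<Rightarrow> config \<Rightarrow> config \<Rightarrow> bool" where
  "reach M inp B k s s' \<longleftrightarrow> (ram_step M inp ^^ k) s = s' \<and>
     (\<forall>j\<le>k. bounded_mem B (mem ((ram_step M inp ^^ j) s)))"

lemma reach_refl: "bounded_mem B (mem s) \<Longrightarrow> reach M inp B 0 s s"
  by (simp add: reach_def)

lemma reach_trans:
  assumes "reach M inp B k s s'" "reach M inp B k' s' s''"
  shows "reach M inp B (k + k') s s''"
proof -
  have "bounded_mem B (mem ((ram_step M inp ^^ j) s))" if "j \<le> k + k'" for j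
  proof (cases "j \<le> k")
    case True
    then show ?thesis using assms by (simp add: reach_def)
  next
    case False
    then have "j = (j - k) + k" "j - k \<le> k'" using that by auto
    then obtain i where i: "j = i + k" "i \<le> k'" by blast
    then show ?thesis using assms by (simp add: reach_def funpow_add)
  qed
  moreover have "(ram_step M inp ^^ (k + k')) s = s''"
    using assms by (simp add: reach_def add.commute[of k] funpow_add)
  ultimately show ?thesis by (simp add: reach_def)
qed

lemma reach_step:
  assumes "ram_step M inp s = s'" "bounded_mem B (mem s)" "bounded_mem B (mem s')"
  shows "reach M inp B 1 s s'"
  using assms by (auto simp: reach_def le_Suc_eq)

definition code_at :: "instr list \<Rightarrow> nat \<Rightarrow> instr list \<Rightarrow> bool" where
  "code_at M p is \<longleftrightarrow> (\<forall>j<length is. p + j < length M \<and> M ! (p + j) = is ! j)"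

lemma code_at_Cons: "code_at M p (i # is) \<longleftrightarrow> p < length M \<and> M ! p = i \<and> code_at M (Suc p) is"
  by (simp add: code_at_def All_less_Suc2)

lemma code_at_append: "code_at M p (xs @ ys) \<longleftrightarrow> code_at M p xs \<and> code_at M (p + length xs) ys"
  by (induction xs arbitrary: p) (simp_all add: code_at_Cons, simp add: code_at_def)

lemma ram_step_at:
  "code_at M p (i # is) \<Longrightarrow> ram_step M inp \<lparr>pc = p, mem = m, written = w\<rparr> = exec_instr inp i \<lparr>pc = p, mem = m, written = w\<rparr>"
  by (simp add: code_at_Cons ram_step_def)

lemma exec_assigned:
  "assigned inp i m = Some (a, v) \<Longrightarrow>
   exec_instr inp i \<lparr>pc = p, mem = m, written = w\<rparr> = \<lparr>pc = Suc p, mem = m(a := v), written = w\<rparr>"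
  by (cases i) (auto simp: assign_def read_input_def Let_def)

lemma bounded_mem_upd: "bounded_mem B m \<Longrightarrow> \<bar>v\<bar> \<le> B \<Longrightarrow> bounded_mem B (m(a := v))"
  by (simp add: bounded_mem_def)

abbreviation conf :: "nat \<Rightarrow> state \<Rightarrow> config" where
  "conf p s \<equiv> \<lparr>pc = p, mem = fst s, written = fst (snd s)\<rparr>"

lemma big_step_reach:
  assumes "big_step inp B c s s'" "bounded_mem B (fst s)" "code_at M p (code p c)"
  shows "\<exists>k. reach M inp B k (conf p s) (conf (p + code_len c) s') \<and> bounded_mem B (fst s')
    \<and> snd (snd s) + k \<le> snd (snd s')"
  using assms
proof (induction arbitrary: p rule: big_step.induct)
  case (Skip s)
  then show ?case by (intro exI[of _ 0]) (simp add: reach_refl)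
next
  case (Assign i m a v w t)
  then show ?case
    by (intro exI[of _ 1] conjI reach_step) (simp_all add: ram_step_at exec_assigned bounded_mem_upd del: fun_upd_apply)
next
  case (Output a m w t)
  then show ?case
    by (intro exI[of _ 1] conjI reach_step) (auto simp: ram_step_at)
next
  case (Seq c s s' d s'')
  then obtain k where k: "reach M inp B k (conf p s) (conf (p + code_len c) s')" "bounded_mem B (fst s')"
    "snd (snd s) + k \<le> snd (snd s')" by (fastforce simp: code_at_append)
  with Seq obtain k' where "reach M inp B k' (conf (p + code_len c) s') (conf (p + code_len c + code_len d) s'')" "bounded_mem B (fst s'')"
    "snd (snd s') + k' \<le> snd (snd s'')" by (fastforce simp: code_at_append)
  with k show ?case by (intro exI[of _ "k + k'"]) (auto intro: reach_trans simp: add.assoc)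
next
  case (If m r c d w t s)
  show ?case
  proof (cases "m r > 0")
    case True
    let ?p = "p + code_len d + 2"
    have "code_at M ?p (code ?p c)" using If.prems by (simp add: code_at_append code_at_Cons)
    with True If obtain k where k: "reach M inp B k (conf ?p (m, w, t + 2)) (conf (?p + code_len c) s)" "bounded_mem B (fst s)"
      "t + 2 + k \<le> snd (snd s)" by fastforce
    moreover have "reach M inp B 1 (conf p (m, w, t)) (conf ?p (m, w, t + 2))"
      using If.prems True by (intro reach_step) (auto simp: ram_step_at)
    ultimately show ?thesis
      by (intro exI[of _ "1 + k"]) (auto dest: reach_trans simp: add_ac)
  next
    case False
    have "code_at M (p + 1) (code (p + 1) d)" using If.prems by (simp add: code_at_append code_at_Cons)
    with False If obtain k where k: "reach M inp B k (conf (p + 1) (m, w, t + 2)) (conf (p + 1 + code_len d) s)" "bounded_mem B (fst s)"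
      "t + 2 + k \<le> snd (snd s)" by fastforce
    moreover have "reach M inp B 1 (conf p (m, w, t)) (conf (p + 1) (m, w, t + 2))"
      using If.prems False by (intro reach_step) (auto simp: ram_step_at)
    moreover have "reach M inp B 1 (conf (p + 1 + code_len d) s) (conf (p + code_len d + code_len c + 2) s)"
      using If.prems k(2) by (intro reach_step) (auto simp: code_at_Cons code_at_append ram_step_def)
    ultimately have "reach M inp B (1 + k + 1) (conf p (m, w, t)) (conf (p + code_len d + code_len c + 2) s)"
      by (blast intro: reach_trans)
    then show ?thesis using k
      by (intro exI[of _ "1 + k + 1"]) (auto simp: add_ac)
  qed
next
  case (WhileF m r c w t)
  have "reach M inp B 1 (conf p (m, w, t)) (conf (p + 1) (m, w, t))"
    using WhileF by (intro reach_step) (auto simp: ram_step_at)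
  moreover have "reach M inp B 1 (conf (p + 1) (m, w, t)) (conf (p + code_len (While r c)) (m, w, t))"
    using WhileF by (intro reach_step) (auto simp: code_at_Cons ram_step_def)
  ultimately have "reach M inp B (1 + 1) (conf p (m, w, t)) (conf (p + code_len (While r c)) (m, w, t))"
    by (rule reach_trans)
  then show ?case using WhileF by (intro exI[of _ "1 + 1"]) simp
next
  case (WhileT m r c w t s' s'')
  have "code_at M (p + 2) (code (p + 2) c)" using WhileT.prems by (simp add: code_at_append code_at_Cons)
  with WhileT.IH(1)[of "p + 2"] WhileT.prems obtain k where
    k: "reach M inp B k (conf (p + 2) (m, w, t)) (conf (p + 2 + code_len c) s')" "bounded_mem B (fst s')"
      "t + 2 + k \<le> snd (snd s')" by auto
  obtain k' where
    k': "reach M inp B k' (conf p s') (conf (p + code_len (While r c)) s'')" "bounded_mem B (fst s'')"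
      "snd (snd s') + k' \<le> snd (snd s'')" using WhileT.IH(2)[OF k(2) WhileT.prems(2)] by auto
  have "reach M inp B 1 (conf p (m, w, t)) (conf (p + 2) (m, w, t))"
    using WhileT by (intro reach_step) (auto simp: ram_step_at)
  moreover have "reach M inp B 1 (conf (p + 2 + code_len c) s') (conf p s')"
    using WhileT.prems k(2) by (intro reach_step) (auto simp: code_at_Cons code_at_append ram_step_def)
  ultimately have "reach M inp B (1 + k + 1 + k') (conf p (m, w, t)) (conf (p + code_len (While r c)) s'')"
    using k k' by (blast intro: reach_trans)
  then show ?case using k k' by (intro exI[of _ "1 + k + 1 + k'"]) auto
qed

text \<open>The existential gives total correctness: a derivation of \<open>big_step\<close> ends in
  a final state and has checked the bound \<open>B\<close> for each assigned value.\<close>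

definition wp :: "int list \<Rightarrow> int \<Rightarrow> com \<Rightarrow> (state \<Rightarrow> bool) \<Rightarrow> state \<Rightarrow> bool" where
  "wp inp B c Q s \<longleftrightarrow> (\<exists>s'. big_step inp B c s s' \<and> Q s')"

lemma wp_Skip [simp]: "wp inp B Skip Q s \<longleftrightarrow> Q s"
proof -
  have "big_step inp B Skip s s' \<longleftrightarrow> s' = s" for s' by (auto intro: big_step.Skip elim: SkipE)
  then show ?thesis unfolding wp_def by simp
qed

lemma wp_Seq [simp]: "wp inp B (c ;; d) Q = wp inp B c (wp inp B d Q)"
proof
  fix s
  have "big_step inp B (c ;; d) s s'' \<longleftrightarrow> (\<exists>s'. big_step inp B c s s' \<and> big_step inp B d s' s'')" for s''
  proof
    show "\<exists>s'. big_step inp B c s s' \<and> big_step inp B d s' s''" if "big_step inp B (c ;; d) s s''"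
      using that by (cases rule: SeqE) (rule exI conjI | assumption)+
  next
    assume "\<exists>s'. big_step inp B c s s' \<and> big_step inp B d s' s''"
    then obtain s' where "big_step inp B c s s'" "big_step inp B d s' s''" by (elim exE conjE)
    then show "big_step inp B (c ;; d) s s''" by (rule big_step.Seq)
  qed
  then show "wp inp B (c ;; d) Q s \<longleftrightarrow> wp inp B c (wp inp B d Q) s" unfolding wp_def by blast
qed

lemma wp_Assign:
  "assigned inp i m = Some (a, v) \<Longrightarrow> wp inp B (Op i) Q (m, w, t) \<longleftrightarrow> \<bar>v\<bar> \<le> B \<and> Q (m(a := v), w, Suc t)"
proof -
  assume a: "assigned inp i m = Some (a, v)"
  have "big_step inp B (Op i) (m, w, t) s' \<longleftrightarrow> \<bar>v\<bar> \<le> B \<and> s' = (m(a := v), w, Suc t)" for s'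
  proof
    show "\<bar>v\<bar> \<le> B \<and> s' = (m(a := v), w, Suc t)" if "big_step inp B (Op i) (m, w, t) s'"
      using that a by (auto elim: OpE)
  qed (use a big_step.Assign[of inp i m a v B w t] in simp)
  then show ?thesis unfolding wp_def by simp
qed

lemma wp_Op [simp]:
  "wp inp B (Op (Const a v)) Q (m, w, t) \<longleftrightarrow> \<bar>v\<bar> \<le> B \<and> Q (m(a := v), w, Suc t)"
  "wp inp B (Op (Add a b c)) Q (m, w, t) \<longleftrightarrow> \<bar>m b + m c\<bar> \<le> B \<and> Q (m(a := m b + m c), w, Suc t)"
  "wp inp B (Op (Sub a b c)) Q (m, w, t) \<longleftrightarrow> \<bar>m b - m c\<bar> \<le> B \<and> Q (m(a := m b - m c), w, Suc t)"
  "wp inp B (Op (Mul a b c)) Q (m, w, t) \<longleftrightarrow> \<bar>m b * m c\<bar> \<le> B \<and> Q (m(a := m b * m c), w, Suc t)"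
  "wp inp B (Op (Div a b c)) Q (m, w, t) \<longleftrightarrow> \<bar>m b div m c\<bar> \<le> B \<and> Q (m(a := m b div m c), w, Suc t)"
  "wp inp B (Op (Load a b)) Q (m, w, t) \<longleftrightarrow> \<bar>m (nat (m b))\<bar> \<le> B \<and> Q (m(a := m (nat (m b))), w, Suc t)"
  "wp inp B (Op (Store a b)) Q (m, w, t) \<longleftrightarrow> \<bar>m b\<bar> \<le> B \<and> Q (m(nat (m a) := m b), w, Suc t)"
  "wp inp B (Op (Input a b)) Q (m, w, t) \<longleftrightarrow> \<bar>read_input inp (m b)\<bar> \<le> B \<and> Q (m(a := read_input inp (m b)), w, Suc t)"
  by (simp_all add: wp_Assign)

lemma wp_Output [simp]: "wp inp B (Op (Output a)) Q (m, w, t) \<longleftrightarrow> Q (m, w @ [m a], Suc t)"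
proof
  assume "wp inp B (Op (Output a)) Q (m, w, t)"
  then obtain s' where "big_step inp B (Op (Output a)) (m, w, t) s'" "Q s'" unfolding wp_def by blast
  then show "Q (m, w @ [m a], Suc t)" by (cases rule: OpE) auto
next
  assume "Q (m, w @ [m a], Suc t)"
  then show "wp inp B (Op (Output a)) Q (m, w, t)" unfolding wp_def
    using big_step.Output[of inp B a m w t] by auto
qed

lemma wp_If [simp]: "wp inp B (If r c d) Q (m, w, t) \<longleftrightarrow> wp inp B (if m r > 0 then c else d) Q (m, w, t + 2)"
proof -
  have "big_step inp B (If r c d) (m, w, t) s' \<longleftrightarrow> big_step inp B (if m r > 0 then c else d) (m, w, t + 2) s'" for s'
  proof
    show "big_step inp B (if m r > 0 then c else d) (m, w, t + 2) s'" if "big_step inp B (If r c d) (m, w, t) s'"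
      using that by (auto elim: IfE)
  qed (rule big_step.If)
  then show ?thesis by (simp only: wp_def)
qed

lemma wp_elim:
  assumes "wp inp B c Q s"
  obtains m w t where "big_step inp B c s (m, w, t)" "Q (m, w, t)"
  using assms unfolding wp_def by force

text \<open>For loops whose number of iterations is fixed beforehand: the initialization and the
  simulation of a call.\<close>

lemma wp_While:
  assumes "Inv i (m, w, t)" "i \<le> k"
    and body: "\<And>i m w t. i < k \<Longrightarrow> Inv i (m, w, t) \<Longrightarrow> m r > 0 \<and> wp inp B c (Inv (Suc i)) (m, w, t + 2)"
    and exit: "\<And>m w t. Inv k (m, w, t) \<Longrightarrow> m r \<le> 0 \<and> Q (m, w, t + 2)"
  shows "wp inp B (While r c) Q (m, w, t)"
  using assms(1,2)
proof (induction "k - i" arbitrary: i m w t)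
  case 0
  then have "m r \<le> 0" "Q (m, w, t + 2)" using exit[of m w t] by auto
  then show ?case unfolding wp_def using big_step.WhileF by blast
next
  case (Suc d)
  then have "i < k" by simp
  with body[OF this Suc.prems(1)] obtain m' w' t' where
    s: "m r > 0" "big_step inp B c (m, w, t + 2) (m', w', t')" "Inv (Suc i) (m', w', t')"
    by (metis wp_elim)
  have "wp inp B (While r c) Q (m', w', t')"
    using Suc.hyps(2) \<open>i < k\<close> s(3) by (intro Suc.hyps(1)) auto
  then obtain s' where "big_step inp B (While r c) (m', w', t') s'" "Q s'" unfolding wp_def by blast
  then show ?case using big_step.WhileT[of m r inp B c w t] s unfolding wp_def by blast
qed

text \<open>For loops whose number of iterations is only bounded, such as the Euclidean algorithm:
  each iteration must consume one unit of the budget \<open>j\<close>.\<close>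

lemma wp_While_budget:
  assumes "Inv j (m, w, t)"
    and "\<And>j m w t. Inv j (m, w, t) \<Longrightarrow> m r > 0 \<Longrightarrow> \<exists>j'. j = Suc j' \<and> wp inp B c (Inv j') (m, w, t + 2)"
    and "\<And>j m w t. Inv j (m, w, t) \<Longrightarrow> m r \<le> 0 \<Longrightarrow> Q (m, w, t + 2)"
  shows "wp inp B (While r c) Q (m, w, t)"
  using assms(1)
proof (induction j arbitrary: m w t)
  case 0
  then have "m r \<le> 0" using assms(2)[of 0 m w t] by fastforce
  then show ?case using assms(3)[OF 0] unfolding wp_def by (blast intro: big_step.WhileF)
next
  case (Suc j)
  show ?case
  proof (cases "m r > 0")
    case True
    then have "wp inp B c (Inv j) (m, w, t + 2)" using assms(2)[OF Suc.prems] by auto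
    then obtain m' w' t' where s: "big_step inp B c (m, w, t + 2) (m', w', t')" "Inv j (m', w', t')"
      by (rule wp_elim)
    obtain s' where "big_step inp B (While r c) (m', w', t') s'" "Q s'"
      using Suc.IH[OF s(2)] unfolding wp_def by blast
    then show ?thesis using big_step.WhileT[of m r inp B c w t] True s(1) unfolding wp_def by blast
  next
    case False
    then have "Q (m, w, t + 2)" using assms(3)[OF Suc.prems] by simp
    then show ?thesis using False unfolding wp_def by (auto intro!: exI big_step.WhileF)
  qed
qed

section \<open>Simulating the lexicographic algorithm\<close>

text \<open>Cells 0 to 3 hold the weight, and registers below 20 survive a call. Those from 20 to 31
  belong to the simulator, and \<open>sim\<close> ignores 26 to 31. All registers are below 64,
  where no \<open>cell\<close> lies.\<close>

abbreviation "rZero \<equiv> 4 :: nat"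
abbreviation "rOne \<equiv> 5 :: nat"
abbreviation "rN \<equiv> 6 :: nat"
abbreviation "rBig \<equiv> 7 :: nat"
abbreviation "rDen \<equiv> 8 :: nat"
abbreviation "rRow \<equiv> 20 :: nat"
abbreviation "rPC \<equiv> 21 :: nat"
abbreviation "rCnt \<equiv> 22 :: nat"
abbreviation "rY1 \<equiv> 23 :: nat"
abbreviation "rY2 \<equiv> 24 :: nat"
abbreviation "rFlag \<equiv> 25 :: nat"
abbreviation "rRun \<equiv> 26 :: nat"
abbreviation "rX \<equiv> 27 :: nat"
abbreviation "rZ \<equiv> 28 :: nat"
abbreviation "rT \<equiv> 29 :: nat"
abbreviation "rU \<equiv> 30 :: nat"
abbreviation "rV \<equiv> 31 :: nat"
abbreviation "rCall \<equiv> 32 :: nat"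

definition get_cell :: "nat \<Rightarrow> nat \<Rightarrow> com" where
  "get_cell a r = Op (Const r (int a)) ;; Op (Mul r r rBig) ;; Op (Add r r rRow) ;; Op (Load r r)"

definition put_cell :: "nat \<Rightarrow> nat \<Rightarrow> com" where
  "put_cell a r = Op (Const rT (int a)) ;; Op (Mul rT rT rBig) ;; Op (Add rT rT rRow) ;; Op (Store rT r)"

definition next_pc :: com where
  "next_pc = Op (Add rPC rPC rOne)"

text \<open>A nonpositive address is replaced by 0, matching \<open>nat\<close> in the semantics,
  before it is translated to the row of the call.\<close>

definition to_address :: com where
  "to_address = If rX Skip (Op (Const rX 0)) ;; Op (Mul rX rX rBig) ;; Op (Add rX rX rRow)"

text \<open>\<open>rT\<close> is the input position of a denominator and its predecessor that of the
  numerator. The division of \<open>rDen\<close> is exact for the common denominator, so the scaled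
  coefficient is an integer.\<close>

definition add_term :: "nat \<Rightarrow> com" where
  "add_term y = Op (Input rU rT) ;; Op (Div rU rDen rU) ;; Op (Sub rV rT rOne) ;; Op (Input rV rV) ;;
     Op (Mul rU rV rU) ;; Op (Mul rU rU rX) ;; Op (Add y y rU)"

text \<open>The answer of the lexicographic algorithm is not stored: every entry is multiplied with its two
  scaled cost coefficients as soon as it is written.\<close>

definition accumulate :: com where
  "accumulate = If rCnt
     (Op (Add rT rCnt rCnt) ;; add_term rY1 ;; Op (Add rT rT rN) ;; Op (Add rT rT rN) ;; add_term rY2)
     (Op (Add rFlag rX rZero)) ;; Op (Add rCnt rCnt rOne)"

text \<open>The encoded weight of the current call is in cells 0 to 3, and the remaining input of the simulated
  machine is our own input. A negative input position counts as 0; so does a negative address in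
  \<open>Load\<close>, hence positions up to 3 need no case distinction.\<close>

fun simulate :: "instr \<Rightarrow> com" where
  "simulate (Const a v) = Op (Const rX v) ;; put_cell a rX ;; next_pc"
| "simulate (Add a b c) = get_cell b rX ;; get_cell c rZ ;; Op (Add rX rX rZ) ;; put_cell a rX ;; next_pc"
| "simulate (Sub a b c) = get_cell b rX ;; get_cell c rZ ;; Op (Sub rX rX rZ) ;; put_cell a rX ;; next_pc"
| "simulate (Mul a b c) = get_cell b rX ;; get_cell c rZ ;; Op (Mul rX rX rZ) ;; put_cell a rX ;; next_pc"
| "simulate (Div a b c) = get_cell b rX ;; get_cell c rZ ;; Op (Div rX rX rZ) ;; put_cell a rX ;; next_pc"
| "simulate (Load a b) = get_cell b rX ;; to_address ;; Op (Load rX rX) ;; put_cell a rX ;; next_pc"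
| "simulate (Store a b) = get_cell a rX ;; get_cell b rZ ;; to_address ;; Op (Store rX rZ) ;; next_pc"
| "simulate (Input a b) = get_cell b rX ;; Op (Const rT 3) ;; Op (Sub rT rX rT) ;;
     If rT (Op (Sub rT rT rOne) ;; Op (Input rX rT)) (Op (Load rX rX)) ;; put_cell a rX ;; next_pc"
| "simulate (Output a) = get_cell a rX ;; accumulate ;; next_pc"
| "simulate (Jump k) = Op (Const rPC (int k))"
| "simulate (JumpPos a k) = get_cell a rX ;; If rX (Op (Const rPC (int k))) next_pc"

text \<open>The test with number \<open>k\<close> is reached only if the program counter is at least
  \<open>k\<close>, so a nonpositive difference means equality.\<close>

fun dispatch :: "nat \<Rightarrow> instr list \<Rightarrow> com" where
  "dispatch k [] = Skip"
| "dispatch k (i # is) = Op (Const rT (int k)) ;; Op (Sub rT rPC rT) ;; If rT (dispatch (Suc k) is) (simulate i)"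

text \<open>\<open>rRow\<close> is \<open>rBig\<close> plus the call number, which supplies the
  offset \<open>a + 1\<close> in \<open>cell\<close>. \<open>rRun\<close> is positive exactly while
  the simulated program counter is inside \<open>A\<close>.\<close>

definition call :: "instr list \<Rightarrow> com" where
  "call A = Op (Add rCall rCall rOne) ;; Op (Add rRow rCall rBig) ;; Op (Const rPC 0) ;; Op (Const rCnt 0) ;;
     Op (Const rY1 0) ;; Op (Const rY2 0) ;; Op (Const rFlag 0) ;; Op (Const rRun (int (length A))) ;;
     While rRun (dispatch 0 A ;; Op (Const rT (int (length A))) ;; Op (Sub rRun rT rPC))"

text \<open>Bounds addresses and jump targets. The immediate value of \<open>Const\<close> is left
  out: when executed, it ends up in a simulated cell and is bounded as such.\<close>

fun instr_max :: "instr \<Rightarrow> nat" where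
  "instr_max (Const a v) = a"
| "instr_max (Add a b c) = a + b + c"
| "instr_max (Sub a b c) = a + b + c"
| "instr_max (Mul a b c) = a + b + c"
| "instr_max (Div a b c) = a + b + c"
| "instr_max (Load a b) = a + b"
| "instr_max (Store a b) = a + b"
| "instr_max (Input a b) = a + b"
| "instr_max (Output a) = a"
| "instr_max (Jump k) = k"
| "instr_max (JumpPos a k) = a + k"

text \<open>The cost entry in row \<open>i\<close> and column \<open>j\<close> times
  \<open>den\<close>. The input starts with \<open>n\<close>, followed by numerator and denominator
  of each entry row by row, hence the offsets 1 and 2.\<close>

definition coef :: "int list \<Rightarrow> nat \<Rightarrow> int \<Rightarrow> nat \<Rightarrow> nat \<Rightarrow> int" where
  "coef inp n den i j = read_input inp (int (2 * (i * n + j) + 1)) * (den div read_input inp (int (2 * (i * n + j) + 2)))"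

text \<open>\<open>X\<close> bounds the values of the simulated machine and \<open>B\<close> those
  of the simulator. For \<open>a\<close> at most \<open>X\<close> and \<open>k < big\<close>, the
  address \<open>cell a k\<close> is less than \<open>(X + 2) * int big\<close>.\<close>

locale lex_ram =
  fixes inp :: "int list" and B X den :: int and big n :: nat
  assumes big: "64 \<le> big" and B: "(X + 2) * int big \<le> B" and X: "3 \<le> X"
    and n_le: "4 * int n + 4 \<le> B"
    and input_le: "\<And>k. k \<le> 4 * n \<Longrightarrow> \<bar>read_input inp (int k)\<bar> \<le> B"
    and den_le: "0 < den" "den \<le> B"
    and denominator_pos: "\<And>k. 0 < k \<Longrightarrow> k \<le> 2 * n \<Longrightarrow> 0 < read_input inp (int (2 * k))"
    and coef_sum_le: "\<And>i. i < 2 \<Longrightarrow> (\<Sum>j<n. \<bar>coef inp n den i j\<bar>) \<le> B"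
begin

text \<open>A number in base \<open>big\<close> with last digit \<open>k\<close>, so that different
  calls never share an address; the summand 1 leaves the addresses below \<open>big\<close> to the
  registers.\<close>

definition cell :: "nat \<Rightarrow> nat \<Rightarrow> nat" where
  "cell a k = (a + 1) * big + k"

lemma cell_eq_iff: "k < big \<Longrightarrow> k' < big \<Longrightarrow> cell a k = cell a' k' \<longleftrightarrow> a = a' \<and> k = k'"
proof
  assume k: "k < big" "k' < big" and eq: "cell a k = cell a' k'"
  have "cell a k mod big = k" "cell a' k' mod big = k'" "cell a k div big = a + 1" "cell a' k' div big = a' + 1"
    using k unfolding cell_def by (simp_all only: mod_mult_self3 div_mult_self3 mod_less div_less add_0_right)
  then show "a = a' \<and> k = k'" using eq by simp
qed simp

lemma cell_neq: "r < 64 \<Longrightarrow> cell a k \<noteq> r" "r < 64 \<Longrightarrow> r \<noteq> cell a k"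
  using big by (auto simp: cell_def)

lemma nat_cell: "nat (int a * int big + (int k + int big)) = cell a k"
  by (simp add: cell_def nat_eq_iff algebra_simps)

lemma X_B: "X + 3 \<le> B" "v \<le> X \<Longrightarrow> v \<le> B" "v \<le> X \<Longrightarrow> v + 1 \<le> B"
  "\<bar>v\<bar> \<le> X \<Longrightarrow> \<bar>v * int big\<bar> \<le> B"
  "k < big \<Longrightarrow> \<bar>v\<bar> \<le> X \<Longrightarrow> \<bar>v * int big + (int k + int big)\<bar> \<le> B"
  "k < big \<Longrightarrow> int k + int big \<le> B"
proof -
  have 1: "(X + 2) * 2 \<le> (X + 2) * int big" using X big by (intro mult_left_mono) auto
  with B show *: "X + 3 \<le> B" using X by simp
  then show "v \<le> X \<Longrightarrow> v \<le> B" "v \<le> X \<Longrightarrow> v + 1 \<le> B" by auto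
  have 2: "\<bar>v * int big\<bar> \<le> X * int big" if "\<bar>v\<bar> \<le> X"
    unfolding abs_mult using that by (intro mult_mono) auto
  have 3: "X * int big + 2 * int big \<le> B" using B by (simp add: algebra_simps)
  show "\<bar>v\<bar> \<le> X \<Longrightarrow> \<bar>v * int big\<bar> \<le> B" using 2 3 by linarith
  show "k < big \<Longrightarrow> \<bar>v\<bar> \<le> X \<Longrightarrow> \<bar>v * int big + (int k + int big)\<bar> \<le> B" using 2 3 by linarith
  have "X * int big \<ge> 0" using X by simp
  with 3 show "k < big \<Longrightarrow> int k + int big \<le> B" by linarith
qed

text \<open>The scaled objective of the part of the answer written so far. Position 0 is the
  feasibility flag, hence the shift; truncated subtraction makes the sum empty for
  \<open>ws = []\<close>.\<close>

definition partial :: "nat \<Rightarrow> int list \<Rightarrow> int" where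
  "partial i ws = (\<Sum>j<length ws - 1. coef inp n den i j * ws ! Suc j)"

text \<open>Inherited by prefixes, so it bounds the accumulated objectives at every moment of the
  run and not only at its end.\<close>

definition answer_ok :: "int list \<Rightarrow> bool" where
  "answer_ok ws \<longleftrightarrow> length ws \<le> Suc n \<and> set ws \<subseteq> {0, 1}"

lemma abs_partial_le:
  assumes "answer_ok ws"
  shows "\<bar>partial i ws\<bar> \<le> (\<Sum>j<n. \<bar>coef inp n den i j\<bar>)"
proof -
  have "\<bar>partial i ws\<bar> \<le> (\<Sum>j<length ws - 1. \<bar>coef inp n den i j * ws ! Suc j\<bar>)"
    unfolding partial_def by (rule sum_abs)
  also have "\<dots> \<le> (\<Sum>j<length ws - 1. \<bar>coef inp n den i j\<bar>)"
  proof (rule sum_mono)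
    fix j assume "j \<in> {..<length ws - 1}"
    then have "ws ! Suc j \<in> set ws" by auto
    then have "ws ! Suc j \<in> {0, 1}" using assms unfolding answer_ok_def by blast
    then show "\<bar>coef inp n den i j * ws ! Suc j\<bar> \<le> \<bar>coef inp n den i j\<bar>" by auto
  qed
  also have "\<dots> \<le> (\<Sum>j<n. \<bar>coef inp n den i j\<bar>)"
    using assms unfolding answer_ok_def by (intro sum_mono2) auto
  finally show ?thesis .
qed

lemma partial_append:
  "ws \<noteq> [] \<Longrightarrow> partial i (ws @ [v]) = partial i ws + coef inp n den i (length ws - 1) * v"
proof -
  assume "ws \<noteq> []"
  then obtain k where k: "length ws = Suc k" by (cases ws) auto
  then show ?thesis by (simp add: partial_def nth_append)
qed

lemma partial_short: "length ws \<le> 1 \<Longrightarrow> partial i ws = 0"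
  by (simp add: partial_def)

lemma abs_div_le: "0 < q \<Longrightarrow> \<bar>den div q\<bar> \<le> B" for q :: int
  using den_le zdiv_mono2[of den 1 q] by (simp add: pos_imp_zdiv_nonneg_iff)

lemma coef_le: "i < 2 \<Longrightarrow> j < n \<Longrightarrow> \<bar>coef inp n den i j\<bar> \<le> B"
  using member_le_sum[of j "{..<n}" "\<lambda>j. \<bar>coef inp n den i j\<bar>"] coef_sum_le[of i] by simp

lemma partial_le: "i < 2 \<Longrightarrow> answer_ok ws \<Longrightarrow> \<bar>partial i ws\<bar> \<le> B"
  using abs_partial_le[of ws i] coef_sum_le[of i] by simp

lemma wp_add_term:
  assumes idx: "m rT = int (2 * (i * n + j) + 2)" "i < 2" "j < n" and y: "y \<in> {rY1, rY2}"
    and regs: "m rDen = den" "m rOne = 1" "m rX \<in> {0, 1}"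
    and sum: "\<bar>m y + coef inp n den i j * m rX\<bar> \<le> B"
    and Q: "\<And>m' t'. m' y = m y + coef inp n den i j * m rX \<Longrightarrow> (\<And>r. r \<noteq> y \<Longrightarrow> r \<noteq> rU \<Longrightarrow> r \<noteq> rV \<Longrightarrow> m' r = m r) \<Longrightarrow>
      t' \<le> t + 7 \<Longrightarrow> Q (m', w, t')"
  shows "wp inp B (add_term y) Q (m, w, t)"
proof -
  let ?k = "i * n + j"
  have "i * n + j < 2 * n"
  proof -
    have "i = 0 \<or> i = 1" using idx(2) by auto
    then show ?thesis using idx(3) by auto
  qed
  then have k: "2 * ?k + 2 \<le> 4 * n" "2 * ?k + 1 \<le> 4 * n" "0 < ?k + 1" "?k + 1 \<le> 2 * n" by auto
  define p q c where "p = read_input inp (m rT - 1)" and "q = read_input inp (m rT)"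
    and "c = coef inp n den i j"
  have t: "m rT - 1 = int (2 * ?k + 1)" "\<bar>m rT - 1\<bar> \<le> B" using k(2) n_le idx(1) by linarith+
  have q: "\<bar>q\<bar> \<le> B" "0 < q" and p: "\<bar>p\<bar> \<le> B"
    using input_le[OF k(1)] input_le[OF k(2)] denominator_pos[OF k(3,4)]
    unfolding p_def q_def t(1) idx(1) by (simp_all add: algebra_simps)
  have c: "p * (den div q) = c" unfolding p_def q_def t(1) c_def coef_def by (simp add: idx(1))
  have x: "\<bar>c * m rX\<bar> \<le> B" "\<bar>c\<bar> \<le> B" using coef_le[OF idx(2,3)] regs(3) den_le by (auto simp: c_def)
  have ne: "y \<noteq> rU" "y \<noteq> rV" "y \<noteq> rT" "y \<noteq> rX" "y \<noteq> rDen" "y \<noteq> rOne" using y by auto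
  show ?thesis
    unfolding add_term_def
    using q p x t(2) abs_div_le[OF q(2)] sum ne ne[symmetric]
    by (simp add: regs(1,2) c flip: p_def q_def c_def) (auto intro!: Q simp: c_def)
qed

end

lemma ram_at_Suc: "ram_at M i (Suc t) = ram_step M i (ram_at M i t)"
  by (simp add: ram_at_def)


context lex_ram
begin

declare cell_neq [simp]

definition globals :: "(nat \<Rightarrow> int) \<Rightarrow> bool" where
  "globals m \<longleftrightarrow> m rZero = 0 \<and> m rOne = 1 \<and> m rN = int n \<and> m rBig = int big \<and> m rDen = den"

text \<open>Memory cell \<open>a\<close> of the \<open>k\<close>-th call of the lexicographic algorithm is kept in \<open>cell a k\<close>; the calls use
  distinct rows, so no memory has to be cleared between them. Rows 0 and 1 hold the stack.\<close>

definition sim :: "nat \<Rightarrow> config \<Rightarrow> (nat \<Rightarrow> int) \<Rightarrow> (nat \<Rightarrow> int) \<Rightarrow> bool" where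
  "sim k c m0 m \<longleftrightarrow> m rPC = int (pc c) \<and> m rRow = int k + int big \<and> m rCall = int k
     \<and> m rCnt = int (length (written c)) \<and> m rY1 = partial 0 (written c) \<and> m rY2 = partial 1 (written c)
     \<and> m rFlag = (if written c = [] then 0 else hd (written c))
     \<and> (\<forall>a. m (cell a k) = mem c a) \<and> (\<forall>r<20. m r = m0 r)
     \<and> (\<forall>a k'. k' < 2 \<or> k < k' \<and> k' < big \<longrightarrow> m (cell a k') = m0 (cell a k'))"

lemma sim_temp [simp]: "r \<in> {26..<32} \<Longrightarrow> sim k c m0 (m(r := v)) \<longleftrightarrow> sim k c m0 m"
  using cell_neq[of r] by (auto simp: sim_def)

text \<open>One simulated step from \<open>c\<close> to \<open>c'\<close>, started no later than
  \<open>t0\<close>; 45 generously bounds its cost. \<open>m0\<close> is the memory before the call,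
  which the stack rows and the rows of later calls must still agree with.\<close>

context
  fixes k :: nat and c c' :: config and m0 :: "nat \<Rightarrow> int" and w :: "int list" and Q :: "state \<Rightarrow> bool" and t0 :: nat
  assumes k: "2 \<le> k" "k < big" and globals: "globals m0"
    and mem_le: "\<And>a. \<bar>mem c a\<bar> \<le> X" "\<And>a. \<bar>mem c' a\<bar> \<le> X"
    and pc_le: "int (pc c) + 1 \<le> X"
    and Q: "\<And>m t. sim k c' m0 m \<Longrightarrow> t \<le> t0 + 45 \<Longrightarrow> Q (m, w, t)"
begin

lemma sim_globals:
  assumes "sim k c m0 m"
  shows "m rZero = 0" "m rOne = 1" "m rN = int n" "m rBig = int big" "m rDen = den" "m rRow = int k + int big"
    "m rPC = int (pc c)" "m (cell a k) = mem c a" "r < 20 \<Longrightarrow> m r = m0 r"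
  using assms globals by (simp_all add: sim_def globals_def)

lemma address_le:
  assumes "int a \<le> X"
  shows "int a \<le> B" "\<bar>int a * int big\<bar> \<le> B" "\<bar>int a * int big + (int k + int big)\<bar> \<le> B"
  using X_B(2)[OF assms] X_B(4)[of "int a"] X_B(5)[OF k(2), of "int a"] assms by auto

lemma mem_le_B: "\<bar>mem c a\<bar> \<le> B" "\<bar>mem c' a\<bar> \<le> B"
  using X_B(2)[OF mem_le(1)] X_B(2)[OF mem_le(2)] by auto

lemma pc_le_B: "int (pc c) + 1 \<le> B"
  using X_B(2)[OF pc_le] .

lemma wp_get_cell:
  assumes "sim k c m0 m" "int a \<le> X" "r \<in> {27..<32}"
  shows "wp inp B (get_cell a r) R (m, w, t) \<longleftrightarrow> R (m(r := mem c a), w, Suc (Suc (Suc (Suc t))))"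
proof -
  have "r \<noteq> rBig" "r \<noteq> rRow" "r \<noteq> cell a k" using assms(3) cell_neq[of r] by auto
  then show ?thesis
    using sim_globals[OF assms(1)] address_le[OF assms(2)] mem_le_B(1)[of a]
    by (simp add: get_cell_def nat_cell)
qed

lemma sim_upd_cell:
  assumes s: "sim k d m0 m"
  shows "sim k (d\<lparr>mem := (mem d)(a := v)\<rparr>) m0 (m(cell a k := v))"
proof -
  have ce: "cell b k = cell a k \<longleftrightarrow> b = a" for b using cell_eq_iff[OF k(2,2)] by simp
  have cn: "cell b k' \<noteq> cell a k" if "k' < 2 \<or> k < k' \<and> k' < big" for b k'
    using cell_eq_iff[of k' k b a] that k by auto
  show ?thesis using s unfolding sim_def by (simp add: ce cn)
qed

lemma wp_next:
  assumes s: "sim k (c'\<lparr>pc := pc c\<rparr>) m0 m" and c': "pc c' = Suc (pc c)" and t: "t \<le> t0 + 44"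
  shows "wp inp B next_pc Q (m, w, t)"
proof -
  have *: "sim k c' m0 (m(rPC := int (pc c) + 1))" using s c' unfolding sim_def by simp
  have "m rOne = 1" "m rPC = int (pc c)" using s globals by (simp_all add: sim_def globals_def)
  then show ?thesis unfolding next_pc_def using pc_le_B by simp (rule Q[OF *], use t in simp)
qed

lemma wp_put_next:
  assumes s: "sim k c m0 m" and a: "int a \<le> X" and c': "c' = assign a (m rX) c" and t: "t \<le> t0 + 40"
  shows "wp inp B (put_cell a rX) (wp inp B next_pc Q) (m, w, t)"
proof -
  have v: "\<bar>m rX\<bar> \<le> B" using mem_le_B(2)[of a] c' by (simp add: assign_def)
  have "sim k (c'\<lparr>pc := pc c\<rparr>) m0 (m(rT := u, cell a k := m rX))" for u
    using sim_upd_cell[of c "m(rT := u)" a "m rX"] s by (simp add: c' assign_def)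
  then show ?thesis
    unfolding put_cell_def
    using sim_globals[OF s] address_le[OF a] v
    by (simp add: nat_cell) (rule wp_next, use t c' in \<open>simp_all add: assign_def\<close>)
qed

lemma wp_jump:
  assumes s: "sim k c m0 m" and c': "c' = c\<lparr>pc := j\<rparr>" and j: "int j \<le> X" and t: "t \<le> t0 + 40"
  shows "wp inp B (Op (Const rPC (int j))) Q (m, w, t)"
proof -
  have *: "sim k c' m0 (m(rPC := int j))" using s unfolding sim_def c' by simp
  show ?thesis using X_B(2)[OF j] by simp (rule Q[OF *], use t in simp)
qed

lemma wp_to_address:
  assumes s: "sim k c m0 m" and v: "\<bar>m rX\<bar> \<le> X"
    and R: "\<And>t'. t' \<le> t + 5 \<Longrightarrow> R (m(rX := int (cell (nat (m rX)) k)), w, t')"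
  shows "wp inp B to_address R (m, w, t)"
proof -
  have "int (nat (m rX)) \<le> X" "int (nat (m rX)) = (if m rX > 0 then m rX else 0)" using v by auto
  note * = address_le[OF this(1), unfolded this(2)]
  have **: "int (cell (nat (m rX)) k) = (if m rX > 0 then m rX else 0) * int big + (int k + int big)"
    unfolding cell_def by (auto simp: algebra_simps)
  have ***: "B \<ge> 0" using den_le by simp
  show ?thesis
    unfolding to_address_def using * *** sim_globals[OF s] R[unfolded **]
    by (cases "m rX > 0") simp_all
qed

text \<open>The first written value is the feasibility flag. Hence \<open>rCnt\<close> is
  \<open>j + 1\<close> when entry \<open>j\<close> is written; its double \<open>2 * j + 2\<close>
  is the position of the denominator in the first row, and \<open>2 * n\<close> positions further is
  the one in the second row.\<close>

lemma wp_accumulate: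
  assumes s: "sim k c m0 m" and ok: "answer_ok (written c @ [m rX])"
    and R: "\<And>m' t'. sim k (c\<lparr>written := written c @ [m rX]\<rparr>) m0 m' \<Longrightarrow> t' \<le> t + 25 \<Longrightarrow> R (m', w, t')"
  shows "wp inp B accumulate R (m, w, t)"
proof (cases "written c")
  case Nil
  have x: "\<bar>m rX\<bar> \<le> B" "1 \<le> B" using ok den_le by (auto simp: answer_ok_def)
  have *: "sim k (c\<lparr>written := written c @ [m rX]\<rparr>) m0 (m(rFlag := m rX, rCnt := 1))"
    using s Nil by (simp add: sim_def partial_short)
  have "m rCnt = 0" using s Nil by (simp add: sim_def)
  then show ?thesis
    unfolding accumulate_def using sim_globals[OF s] x by simp (rule R[OF *], simp)
next
  case (Cons a ws)
  let ?j = "length ws" and ?x = "m rX"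
  have j: "?j < n" using ok Cons by (simp add: answer_ok_def)
  have x: "?x \<in> {0, 1}" using ok by (simp add: answer_ok_def)
  have cnt: "m rCnt = int ?j + 1" "int ?j + 2 \<le> B" "2 * int ?j + 2 \<le> B" "2 * int ?j + 2 + 2 * int n \<le> B"
    using s Cons j n_le by (simp_all add: sim_def)
  have p: "partial i (written c @ [?x]) = partial i (written c) + coef inp n den i ?j * ?x" for i
    using partial_append[of "written c" i ?x] Cons by simp
  have y: "m rY1 = partial 0 (written c)" "m rY2 = partial 1 (written c)" using s by (simp_all add: sim_def)
  have y_le: "\<bar>partial i (written c) + coef inp n den i ?j * ?x\<bar> \<le> B" if "i < 2" for i
    using partial_le[OF that ok] unfolding p .
  note g = sim_globals[OF s]
  have 2: "wp inp B (add_term rY2) (wp inp B (Op (Add rCnt rCnt rOne)) R) (m', w, t')"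
    if m': "m' rY1 = partial 0 (written c @ [?x])" "\<And>r. r \<notin> {rY1, rT, rU, rV} \<Longrightarrow> m' r = m r"
      "m' rT = int (2 * (1 * n + ?j) + 2)" and t': "t' \<le> t + 13" for m' t'
  proof (rule wp_add_term[where i = 1 and j = "length ws"])
    fix m'' t''
    assume m'': "m'' rY2 = m' rY2 + coef inp n den 1 ?j * m' rX"
      "\<And>r. r \<noteq> rY2 \<Longrightarrow> r \<noteq> rU \<Longrightarrow> r \<noteq> rV \<Longrightarrow> m'' r = m' r" "t'' \<le> t' + 7"
    have eq: "m'' r = m r" if "r \<notin> {rY1, rY2, rT, rU, rV}" for r using that m''(2)[of r] m'(2)[of r] by simp
    have "m'' rY2 = partial 1 (written c @ [?x])" "m'' rY1 = partial 0 (written c @ [?x])"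
      using m'' m' y(2) p[of 1] by simp_all
    moreover have "m'' (cell a i) = m (cell a i)" for a i by (rule eq) simp
    moreover have "\<forall>r<20. m'' r = m r" using eq by simp
    ultimately have *: "sim k (c\<lparr>written := written c @ [?x]\<rparr>) m0 (m''(rCnt := 2 + int ?j))"
      using s Cons by (simp add: sim_def eq)
    have "m'' rCnt = int ?j + 1" "m'' rOne = 1" using eq cnt(1) g(2) by simp_all
    then show "wp inp B (Op (Add rCnt rCnt rOne)) R (m'', w, t'')"
      using cnt(2) by simp (rule R[OF *], use t' m''(3) in simp)
  qed (use m' g x y y_le[of 1] j in simp_all)
  have 1: "wp inp B (add_term rY1) (wp inp B (Op (Add rT rT rN)) (wp inp B (Op (Add rT rT rN))
      (wp inp B (add_term rY2) (wp inp B (Op (Add rCnt rCnt rOne)) R)))) (m', w, t')"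
    if m': "m' = m(rT := 2 * int ?j + 2)" and t': "t' \<le> t + 4" for m' t'
  proof (rule wp_add_term[where i = 0 and j = "length ws"])
    fix m'' t''
    assume m'': "m'' rY1 = m' rY1 + coef inp n den 0 ?j * m' rX"
      "\<And>r. r \<noteq> rY1 \<Longrightarrow> r \<noteq> rU \<Longrightarrow> r \<noteq> rV \<Longrightarrow> m'' r = m' r" "t'' \<le> t' + 7"
    have 3: "m'' rT = 2 * int ?j + 2" "m'' rN = int n" using m''(2) m' g by simp_all
    show "wp inp B (Op (Add rT rT rN)) (wp inp B (Op (Add rT rT rN))
      (wp inp B (add_term rY2) (wp inp B (Op (Add rCnt rCnt rOne)) R))) (m'', w, t'')"
      using 3 cnt n_le by simp (rule 2, use m'' m' t' y(1) p[of 0] in simp_all)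
  qed (use m' g x y y_le[of 0] j in simp_all)
  show ?thesis
    unfolding accumulate_def using cnt by simp (rule 1, simp_all)
qed

lemma wp_simulate:
  assumes s: "sim k c m0 m" and i: "int (instr_max i) \<le> X"
    and c': "c' = exec_instr (map m0 [0, 1, 2, 3] @ inp) i c"
    and ok: "answer_ok (written c')" and t: "t \<le> t0"
  shows "wp inp B (simulate i) Q (m, w, t)"
proof (cases i)
  case (Const a v)
  have v: "\<bar>v\<bar> \<le> B" using mem_le_B(2)[of a] c' Const by (simp add: assign_def)
  show ?thesis using s i c' t v unfolding Const by simp (rule wp_put_next, simp_all)
next
  case (Add a b d)
  have v: "\<bar>mem c b + mem c d\<bar> \<le> B" using mem_le_B(2)[of a] c' Add by (simp add: assign_def)
  show ?thesis using s i c' t v unfolding Add by (simp add: wp_get_cell) (rule wp_put_next, simp_all)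
next
  case (Sub a b d)
  have v: "\<bar>mem c b - mem c d\<bar> \<le> B" using mem_le_B(2)[of a] c' Sub by (simp add: assign_def)
  show ?thesis using s i c' t v unfolding Sub by (simp add: wp_get_cell) (rule wp_put_next, simp_all)
next
  case (Mul a b d)
  have v: "\<bar>mem c b * mem c d\<bar> \<le> B" using mem_le_B(2)[of a] c' Mul by (simp add: assign_def)
  show ?thesis using s i c' t v unfolding Mul by (simp add: wp_get_cell) (rule wp_put_next, simp_all)
next
  case (Div a b d)
  have v: "\<bar>mem c b div mem c d\<bar> \<le> B" using mem_le_B(2)[of a] c' Div by (simp add: assign_def)
  show ?thesis using s i c' t v unfolding Div by (simp add: wp_get_cell) (rule wp_put_next, simp_all)
next
  case (Load a b)
  show ?thesis
    using s i c' t mem_le mem_le_B sim_globals(8)[OF s] unfolding Load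
    by (simp add: wp_get_cell) (rule wp_to_address, simp_all, rule wp_put_next, simp_all)
next
  case (Store a b)
  show ?thesis
    using s i c' t mem_le mem_le_B sim_globals(8)[OF s] unfolding Store
    by (simp add: wp_get_cell)
      (rule wp_to_address, simp_all, rule wp_next, simp_all add: assign_def sim_upd_cell)
next
  case (Input a b)
  let ?v = "mem c b" and ?inp' = "map m0 [0, 1, 2, 3] @ inp"
  define x where "x = read_input ?inp' ?v"
  have c'': "c' = assign a x c" using c' Input by (simp add: x_def read_input_def Let_def)
  have x_le: "\<bar>x\<bar> \<le> B" using mem_le_B(2)[of a] c'' by (simp add: assign_def)
  have v_le: "\<bar>?v - 3\<bar> \<le> B" if "?v > 3" using mem_le_B(1)[of b] that by simp
  have v_le': "\<bar>?v - 3\<bar> \<le> B" using mem_le(1)[of b] X_B X by simp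
  show ?thesis
  proof (cases "?v > 3")
    case True
    have "nat ?v = nat (?v - 4) + 4" using True by simp
    then have x: "read_input inp (?v - 4) = x" unfolding x_def read_input_def
      by (simp add: nth_append)
    show ?thesis using s i t c'' x x_le True v_le sim_globals(2)[OF s] X X_B(1) unfolding Input
      by (simp add: wp_get_cell) (rule wp_put_next, simp_all)
  next
    case False
    then have "nat ?v \<in> {0, 1, 2, 3}" by auto
    then have "x = m0 (nat ?v)" "nat ?v < 20" unfolding x_def read_input_def by auto
    then have x: "m (nat ?v) = x" using s by (simp add: sim_def)
    have ne: "nat ?v \<noteq> rX" "nat ?v \<noteq> rT" using False by auto
    show ?thesis using s i t c'' x x_le False v_le' ne X X_B(1) unfolding Input
      by (simp add: wp_get_cell) (rule wp_put_next, simp_all)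
  qed
next
  case (Output a)
  have c'': "c' = c\<lparr>pc := Suc (pc c), written := written c @ [mem c a]\<rparr>" using c' Output by simp
  show ?thesis
    using s i t ok c'' unfolding Output
    by (simp add: wp_get_cell) (rule wp_accumulate, simp_all, rule wp_next, simp_all)
next
  case (Jump j)
  show ?thesis using s i c' t unfolding Jump simulate.simps
    by (intro wp_jump) simp_all
next
  case (JumpPos a j)
  show ?thesis
  proof (cases "mem c a > 0")
    case True
    then show ?thesis using s i c' t unfolding JumpPos
      by (simp add: wp_get_cell del: wp_Op) (rule wp_jump, simp_all)
  next
    case False
    then show ?thesis using s i c' t unfolding JumpPos
      by (simp add: wp_get_cell) (rule wp_next, simp_all)
  qed
qed

end

lemma wp_dispatch:
  assumes "m rPC = int (j + i)" "i < length is" "int (j + length is) \<le> B"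
    and "\<And>v t'. t' \<le> t + 4 * length is \<Longrightarrow> wp inp B (simulate (is ! i)) Q (m(rT := v), w, t')"
  shows "wp inp B (dispatch j is) Q (m, w, t)"
  using assms
proof (induction "is" arbitrary: i j m t)
  case (Cons a "is")
  show ?case
  proof (cases i)
    case 0
    then have "wp inp B (simulate a) Q (m(rT := 0), w, Suc (Suc (Suc (Suc t))))"
      using Cons.prems(4)[of "Suc (Suc (Suc (Suc t)))" 0] by (simp add: fun_upd_def)
    then show ?thesis using Cons.prems(1-3) 0 by simp
  next
    case (Suc i')
    have "wp inp B (dispatch (Suc j) is) Q (m(rT := 1 + int i'), w, Suc (Suc (Suc (Suc t))))"
    proof (rule Cons.IH)
      fix v t' assume "t' \<le> Suc (Suc (Suc (Suc t))) + 4 * length is"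
      then show "wp inp B (simulate (is ! i')) Q (m(rT := 1 + int i', rT := v), w, t')"
        using Cons.prems(4)[of t' v] Suc by (simp add: fun_upd_def cong: if_cong)
    qed (use Cons.prems Suc in simp_all)
    then show ?thesis using Cons.prems Suc by simp
  qed
qed simp

lemma pc_exec_instr: "pc (exec_instr i is c) = Suc (pc c) \<or> pc (exec_instr i is c) \<le> instr_max is"
  by (cases "is") (simp_all add: assign_def)

text \<open>A jump may leave the program for any target, so the bound has to involve
  \<open>instr_max\<close> and not only the program length.\<close>

lemma pc_ram_le:
  assumes "int (length A) \<le> X" "\<And>i. i \<in> set A \<Longrightarrow> int (instr_max i) \<le> X"
  shows "int (pc (ram_at A i t)) \<le> X"
proof (induction t)
  case 0
  show ?case using X by (simp add: ram_at_def)
next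
  case (Suc t)
  let ?c = "ram_at A i t"
  show ?case
  proof (cases "pc ?c < length A")
    case True
    then have "int (instr_max (A ! pc ?c)) \<le> X" using assms(2) by simp
    then show ?thesis using pc_exec_instr[of i "A ! pc ?c" ?c] True assms(1)
      by (auto simp: ram_at_Suc ram_step_def)
  next
    case False
    then show ?thesis using Suc by (simp add: ram_at_Suc ram_step_def)
  qed
qed

lemma wp_call:
  assumes k: "2 \<le> k" "k < big" and m: "m rCall = int k - 1" "globals m"
    and fresh: "\<And>a. m (cell a k) = 0"
    and inpA: "inpA = map m [0, 1, 2, 3] @ inp"
    and memA: "\<And>t a. \<bar>mem (ram_at A inpA t) a\<bar> \<le> X"
    and halt: "halted_at A inpA h" "\<And>i. i < h \<Longrightarrow> \<not> halted_at A inpA i"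
    and ok: "\<And>i. i \<le> h \<Longrightarrow> answer_ok (written (ram_at A inpA i))"
    and A: "int (length A) + 1 \<le> X" "\<And>i. i \<in> set A \<Longrightarrow> int (instr_max i) \<le> X"
    and ans: "ans = written (ram_at A inpA h)"
    and Q: "\<And>m' t'. (\<And>r. r < 20 \<Longrightarrow> m' r = m r) \<Longrightarrow> m' rCall = int k \<Longrightarrow>
      (\<And>a k'. k' < 2 \<or> k < k' \<and> k' < big \<Longrightarrow> m' (cell a k') = m (cell a k')) \<Longrightarrow>
      m' rY1 = partial 0 ans \<Longrightarrow> m' rY2 = partial 1 ans \<Longrightarrow>
      m' rFlag = (if ans = [] then 0 else hd ans) \<Longrightarrow>
      t' \<le> t + 10 + h * (4 * length A + 60) \<Longrightarrow> Q (m', w, t')"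
  shows "wp inp B (call A) Q (m, w, t)"
proof -
  \<comment> \<open>The cost of a simulated step: 4 for each instruction tested by
    \<open>dispatch\<close>, at most 45 for the simulation, and the overhead of the loop.\<close>
  let ?T = "4 * length A + 60"
  define c where "c i = ram_at A inpA i" for i
  define Inv :: "nat \<Rightarrow> state \<Rightarrow> bool" where
    "Inv i s \<longleftrightarrow> (case s of (m', w', t') \<Rightarrow> w' = w \<and> sim k (c i) m m'
       \<and> m' rRun = int (length A) - int (pc (c i)) \<and> t' \<le> t + 8 + i * ?T)" for i s
  have pc: "int (pc (c i)) \<le> X" for i
    unfolding c_def using A by (intro pc_ram_le) auto
  have B0: "0 \<le> B" using den_le by simp
  define m1 where "m1 = m(rCall := int k, rRow := int k + int big, rPC := 0, rCnt := 0, rY1 := 0, rY2 := 0,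
    rFlag := 0, rRun := int (length A))"
  have "sim k (c 0) m m1"
    using fresh by (simp add: sim_def c_def ram_at_def m1_def partial_short)
  then have start: "Inv 0 (m1, w, t1)" if "t1 \<le> t + 8" for t1
    using that by (simp add: Inv_def m1_def c_def ram_at_def)
  have loop: "wp inp B (While rRun (dispatch 0 A ;; Op (Const rT (int (length A))) ;; Op (Sub rRun rT rPC))) Q (m1, w, t1)"
    if t1: "t1 \<le> t + 8" for t1
  proof (rule wp_While[where Inv = Inv, OF start[OF t1]])
    fix i m' w' t' assume i: "i < h" and inv: "Inv i (m', w', t')"
    then have s: "sim k (c i) m m'" "w' = w" "t' \<le> t + 8 + i * ?T" "m' rRun = int (length A) - int (pc (c i))"
      by (auto simp: Inv_def)
    have lt: "pc (c i) < length A" using halt(2)[OF i] by (simp add: halted_at_def c_def)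
    define ins where "ins = A ! pc (c i)"
    have c': "c (Suc i) = exec_instr inpA ins (c i)" using lt by (simp add: c_def ram_at_Suc ram_step_def ins_def)
    have "ins \<in> set A" using lt by (simp add: ins_def)
    let ?R = "wp inp B (Op (Const rT (int (length A))) ;; Op (Sub rRun rT rPC)) (Inv (Suc i))"
    have R: "?R (m'', w, t'')" if "sim k (c (Suc i)) m m''" "t'' \<le> t' + 2 + 4 * length A + 45" for m'' t''
    proof -
      have "m'' rPC = int (pc (c (Suc i)))" using that(1) by (simp add: sim_def)
      then show ?thesis using that s(3) A(1) pc[of "Suc i"] X_B(1) by (simp add: Inv_def algebra_simps)
    qed
    have "wp inp B (dispatch 0 A) ?R (m', w, t' + 2)"
    proof (rule wp_dispatch)
      show "m' rPC = int (0 + pc (c i))" using s(1) by (simp add: sim_def)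
      show "pc (c i) < length A" by fact
      show "int (0 + length A) \<le> B" using A(1) X_B(1) by simp
      fix v t'' assume t'': "t'' \<le> t' + 2 + 4 * length A"
      show "wp inp B (simulate (A ! pc (c i))) ?R (m'(rT := v), w, t'')"
        unfolding ins_def[symmetric]
      proof (rule wp_simulate[where c = "c i" and c' = "c (Suc i)" and k = k and ?m0.0 = m and ?t0.0 = t''])
        show "\<bar>mem (c i) a\<bar> \<le> X" "\<bar>mem (c (Suc i)) a\<bar> \<le> X" for a using memA by (auto simp: c_def)
        show "answer_ok (written (c (Suc i)))" using ok i by (simp add: c_def)
        show "c (Suc i) = exec_instr (map m [0, 1, 2, 3] @ inp) ins (c i)" using c' inpA by simp
        show "?R (m'', w, t1)" if "sim k (c (Suc i)) m m''" "t1 \<le> t'' + 45" for m'' t1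
          by (rule R) (use that t'' in auto)
      qed (use k m lt A \<open>ins \<in> set A\<close> s t'' in auto)
    qed
    then show "m' rRun > 0 \<and> wp inp B (dispatch 0 A ;; Op (Const rT (int (length A))) ;; Op (Sub rRun rT rPC)) (Inv (Suc i)) (m', w', t' + 2)"
      using s lt by simp
  next
    fix m' w' t' assume inv: "Inv h (m', w', t')"
    then have s: "sim k (c h) m m'" "w' = w" "t' \<le> t + 8 + h * ?T" "m' rRun = int (length A) - int (pc (c h))"
      by (auto simp: Inv_def)
    moreover have "pc (c h) \<ge> length A" using halt(1) by (simp add: halted_at_def c_def)
    moreover have "Q (m', w, t' + 2)"
      by (rule Q) (use s ans in \<open>auto simp: sim_def c_def\<close>)
    ultimately show "m' rRun \<le> 0 \<and> Q (m', w', t' + 2)" by simp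
  qed simp
  have "k + big \<le> B" using X_B(6)[OF k(2)] by simp
  have g: "m rOne = 1" "m rBig = int big" using m(2) by (simp_all add: globals_def)
  have "int k \<le> B" using \<open>k + big \<le> B\<close> by simp
  moreover have "int (length A) \<le> B" using A(1) X_B(1) by simp
  ultimately show ?thesis
    unfolding call_def using m(1) g B0 \<open>k + big \<le> B\<close> k
    by simp (rule loop[unfolded m1_def], simp)
qed

end

section \<open>Output of reduced fractions, and initialization\<close>

abbreviation "rG \<equiv> 40 :: nat"
abbreviation "rH \<equiv> 41 :: nat"
abbreviation "rS \<equiv> 42 :: nat"

text \<open>Writes the reduced fraction that \<open>enc_rat\<close> prescribes. The Euclidean
  algorithm starts with the denominator and the numerator modulo it, which is nonnegative for
  negative numerators as well.\<close>

definition out_ratio :: "nat \<Rightarrow> com" where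
  "out_ratio y = Op (Add rG rDen rZero) ;; Op (Div rH y rDen) ;; Op (Mul rH rH rDen) ;; Op (Sub rH y rH) ;;
     While rH (Op (Div rS rG rH) ;; Op (Mul rS rS rH) ;; Op (Sub rS rG rS) ;;
       Op (Add rG rH rZero) ;; Op (Add rH rS rZero)) ;;
     Op (Div rS y rG) ;; Op (Output rS) ;; Op (Div rS rDen rG) ;; Op (Output rS)"

text \<open>One loop over all cost entries multiplies their denominators and doubles
  \<open>rBig\<close> each time. \<open>rCall\<close> starts at 1, so that the first call gets row
  2, after the two rows of the stack.\<close>

definition init :: com where
  "init = Op (Const rOne 1) ;; Op (Input rN rZero) ;; Op (Const rBig 64) ;; Op (Const rDen 1) ;;
     Op (Add rCnt rN rN) ;;
     While rCnt (Op (Add rT rCnt rCnt) ;; Op (Input rT rT) ;; Op (Mul rDen rDen rT) ;;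
       Op (Add rBig rBig rBig) ;; Op (Sub rCnt rCnt rOne)) ;;
     Op (Const rCall 1)"

lemma enc_rat_divide:
  assumes "0 < d"
  shows "enc_rat (of_int y / of_int d) = [y div gcd y d, d div gcd y d]"
  using assms by (simp add: enc_rat_def flip: Fract_of_int_quotient)
    (simp add: quotient_of_Fract Rat.normalize_def Let_def)

text \<open>From \<open>a div b >= 1\<close> follows
  \<open>a >= b + a mod b > 2 * (a mod b)\<close>. So each Euclidean step more than halves the
  product of the current pair, and the bit length of that product bounds the number of
  iterations.\<close>

lemma mult_mod_halves:
  fixes a b :: int
  assumes "0 < b" "b \<le> a"
  shows "2 * (b * (a mod b)) < b * a"
proof -
  have "a div b \<ge> 1" using assms by (simp add: pos_imp_zdiv_pos_iff int_one_le_iff_zero_less)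
  then have "b * 1 \<le> b * (a div b)" using assms(1) by (intro mult_left_mono) auto
  then have "b + a mod b \<le> a" using mult_div_mod_eq[of b a] by linarith
  moreover have "a mod b < b" using assms(1) by simp
  ultimately have "2 * (a mod b) < a" by simp
  then have "b * (2 * (a mod b)) < b * a" using assms(1) by (rule mult_strict_left_mono)
  then show ?thesis by (simp add: mult_ac)
qed

context lex_ram
begin

lemma wp_out_ratio:
  assumes m: "globals m" and y: "\<bar>m y\<bar> + den \<le> B" "y < 40" and bits: "den * den < 2 ^ bits"
    and Q: "\<And>m' t'. (\<And>r. r \<notin> {40..42} \<Longrightarrow> m' r = m r) \<Longrightarrow> t' \<le> t + 10 + 7 * bits \<Longrightarrow>
      Q (m', w @ enc_rat (of_int (m y) / of_int den), t')"
  shows "wp inp B (out_ratio y) Q (m, w, t)"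
proof -
  define v where "v = m y"
  have g: "m rDen = den" "m rZero = 0" using m by (simp_all add: globals_def)
  have mod: "v - v div den * den = v mod den" by (simp add: minus_div_mult_eq_mod)
  have mod_le: "0 \<le> v mod den" "v mod den < den" using den_le by simp_all
  have le: "\<bar>v\<bar> + den \<le> B" using y by (simp add: v_def)
  have div_le: "\<bar>v div d\<bar> \<le> B" if "d > 0" for d
  proof (cases "v \<ge> 0")
    case True
    then show ?thesis using that zdiv_mono2[of v 1 d] le den_le by (simp add: pos_imp_zdiv_nonneg_iff)
  next
    case False
    then show ?thesis using that zdiv_mono2_neg[of v 1 d] div_neg_pos_less0[of v d] le den_le by simp
  qed
  have mult_le: "\<bar>v div den * den\<bar> \<le> B" using mod mod_le le by linarith
  define Inv :: "nat \<Rightarrow> state \<Rightarrow> bool" where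
    "Inv j s \<longleftrightarrow> (case s of (m', w', t') \<Rightarrow> w' = w \<and> (\<forall>r. r \<notin> {40..42} \<longrightarrow> m' r = m r)
       \<and> 0 < m' rG \<and> m' rG \<le> den \<and> 0 \<le> m' rH \<and> m' rH < m' rG \<and> gcd (m' rG) (m' rH) = gcd v den
       \<and> m' rG * m' rH < 2 ^ j \<and> t' + 7 * j \<le> t + 4 + 7 * bits)" for j s
  let ?body = "Op (Div rS rG rH) ;; Op (Mul rS rS rH) ;; Op (Sub rS rG rS) ;; Op (Add rG rH rZero) ;; Op (Add rH rS rZero)"
  let ?Q = "wp inp B (Op (Div rS y rG) ;; Op (Output rS) ;; Op (Div rS rDen rG) ;; Op (Output rS)) Q"
  have loop: "wp inp B (While rH ?body) ?Q (m', w, t')" if "Inv bits (m', w, t')" for m' t'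
  proof (rule wp_While_budget[where Inv = Inv, OF that])
    fix j m' w' t' assume inv: "Inv j (m', w', t')" and pos: "m' rH > 0"
    define a b where "a = m' rG" and "b = m' rH"
    have *: "w' = w" "\<And>r. r \<notin> {40..42} \<Longrightarrow> m' r = m r" "0 < b" "b < a" "a \<le> den" "gcd a b = gcd v den"
      "a * b < 2 ^ j" "t' + 7 * j \<le> t + 4 + 7 * bits"
      using inv pos by (auto simp: Inv_def a_def b_def)
    have z: "m' rZero = 0" using *(2)[of rZero] g by simp
    \<comment> \<open>A positive remainder keeps the product at least 1, so the budget cannot be
      exhausted yet.\<close>
    have "1 * 1 \<le> a * b" using *(3,4) by (intro mult_mono) auto
    then have "j \<noteq> 0" using *(7) by (intro notI) simp
    then obtain j' where j: "j = Suc j'" by (cases j) auto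
    have ab: "a - a div b * b = a mod b" by (simp add: minus_div_mult_eq_mod)
    have mod_ab: "0 \<le> a mod b" "a mod b < b" using *(3) by simp_all
    have div_ab: "0 \<le> a div b" "a div b \<le> a"
      using *(3,4) zdiv_mono2[of a 1 b] by (simp_all add: pos_imp_zdiv_nonneg_iff)
    have mult_ab: "0 \<le> a div b * b" using div_ab *(3) by simp
    have "2 * (b * (a mod b)) < b * a" using *(3,4) by (intro mult_mod_halves) auto
    also have "\<dots> < 2 * 2 ^ j'" using *(7) j by (simp add: mult.commute)
    finally have "b * (a mod b) < 2 ^ j'" by simp
    moreover have "gcd b (a mod b) = gcd v den" using *(6) by (simp add: gcd_red_int[of a b])
    ultimately have step: "Inv j' (m'(rG := b, rH := a mod b, rS := a mod b), w, t'')" if "t'' \<le> t' + 7" for t''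
      using * mod_ab that by (simp add: Inv_def j)
    have B: "a div b \<le> B" "a div b * b \<le> B" "a \<le> B" "b \<le> B" "a mod b \<le> B"
      using div_ab ab mod_ab *(4,5) den_le by linarith+
    have "wp inp B ?body (Inv j') (m', w', t' + 2)"
      using * z ab mod_ab div_ab mult_ab B step
      by (simp flip: a_def b_def) (simp add: fun_upd_twist)
    then show "\<exists>j'. j = Suc j' \<and> wp inp B ?body (Inv j') (m', w', t' + 2)" using j by blast
  next
    fix j m' w' t' assume inv: "Inv j (m', w', t')" and neg: "m' rH \<le> 0"
    have *: "w' = w" "\<And>r. r \<notin> {40..42} \<Longrightarrow> m' r = m r" "0 < m' rG" "m' rG = gcd v den"
      "t' + 7 * j \<le> t + 4 + 7 * bits" "m' rH = 0"
      using inv neg by (auto simp: Inv_def)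
    have r: "m' rDen = den" "m' y = v" using *(2) g y(2) by (auto simp: v_def)
    have d: "\<bar>den div gcd v den\<bar> \<le> B" "\<bar>v div gcd v den\<bar> \<le> B"
      using *(3,4) abs_div_le div_le by simp_all
    have "Q (m'(rS := den div gcd v den), w @ enc_rat (of_int (m y) / of_int den), t'')" if "t'' \<le> t' + 6" for t''
      by (rule Q) (use * that in auto)
    then show "?Q (m', w', t' + 2)"
      using * r d y(2) enc_rat_divide[OF den_le(1), of v] by (simp add: v_def)
  qed
  have "Inv bits (m(rG := den, rH := v mod den), w, t')" if "t' \<le> t + 4" for t'
    using that den_le(1) mod_le order_less_trans[OF mult_strict_left_mono[OF mod_le(2) den_le(1)] bits]
    by (simp add: Inv_def gcd.commute[of den] gcd_red_int[of v den, symmetric])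
  then have "wp inp B (While rH ?body) ?Q (m(rG := den, rH := v mod den), w, t')" if "t' \<le> t + 4" for t'
    using that loop by blast
  then show ?thesis
    unfolding out_ratio_def
    using g den_le y mod mod_le le div_le[OF den_le(1)] mult_le
    by (simp flip: v_def)
qed

text \<open>The number of rows \<open>64 * 4 ^ n\<close> exceeds the number of calls, as there are at most \<open>2 ^ n\<close>
  outcomes, and makes all row addresses larger than the registers.\<close>

lemma wp_init:
  assumes n: "read_input inp 0 = int n" and den: "den = (\<Prod>k\<in>{1..2 * n}. read_input inp (int (2 * k)))"
    and big_eq: "big = 64 * 2 ^ (2 * n)"
    and Q: "\<And>m t'. globals m \<Longrightarrow> m rCall = 1 \<Longrightarrow> (\<And>r. r < 20 \<Longrightarrow> r \<notin> {rOne, rN, rBig, rDen} \<Longrightarrow> m r = 0) \<Longrightarrow>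
      (\<And>a k. m (cell a k) = 0) \<Longrightarrow> t' \<le> t + 8 + 14 * n \<Longrightarrow> Q (m, w, t')"
  shows "wp inp B init Q (\<lambda>_. 0, w, t)"
proof -
  define f where "f k = read_input inp (int (2 * k))" for k
  \<comment> \<open>The product of the denominators read in the first \<open>i\<close> rounds, which
    proceed from the last entry to the first.\<close>
  define D where "D i = prod f {2 * n - i + 1..2 * n}" for i
  have f: "0 < f k" "f k \<le> B" if "0 < k" "k \<le> 2 * n" for k
    using denominator_pos[OF that] input_le[of "2 * k"] that by (simp_all add: f_def)
  have D_le: "1 \<le> D i" "D i \<le> B" for i
  proof -
    have "D i \<le> prod f {1..2 * n}" unfolding D_def
    proof (rule prod_mono2)
      show "1 \<le> f b" if "b \<in> {1..2 * n} - {2 * n - i + 1..2 * n}" for b using f(1)[of b] that by auto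
      show "0 \<le> f a" if "a \<in> {2 * n - i + 1..2 * n}" for a using f(1)[of a] that by force
    qed auto
    then show "D i \<le> B" using den_le(2) by (simp add: den f_def)
    have "0 < D i" unfolding D_def using f(1) by (intro prod_pos) force
    then show "1 \<le> D i" by simp
  qed
  have big_le: "64 * 2 ^ i \<le> B" if "i \<le> 2 * n" for i
  proof -
    have "(2::int) ^ i \<le> 2 ^ (2 * n)" using that by (intro power_increasing) auto
    moreover have "64 * 2 ^ (2 * n) \<le> B" using X_B(6)[of 0] big by (simp add: big_eq)
    ultimately show ?thesis by linarith
  qed
  define Inv :: "nat \<Rightarrow> state \<Rightarrow> bool" where
    "Inv i s \<longleftrightarrow> (case s of (m, w', t') \<Rightarrow> w' = w \<and> m rCnt = int (2 * n - i) \<and> m rDen = D i \<and> m rBig = 64 * 2 ^ i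
       \<and> m rOne = 1 \<and> m rN = int n \<and> (\<forall>r. r \<notin> {rOne, rN, rBig, rDen, rCnt, rT} \<longrightarrow> m r = 0) \<and> t' \<le> t + 5 + 7 * i)" for i s
  let ?body = "Op (Add rT rCnt rCnt) ;; Op (Input rT rT) ;; Op (Mul rDen rDen rT) ;;
       Op (Add rBig rBig rBig) ;; Op (Sub rCnt rCnt rOne)"
  have loop: "wp inp B (While rCnt ?body) (wp inp B (Op (Const rCall 1)) Q) (m, w, t')" if "Inv 0 (m, w, t')" for m t'
  proof (rule wp_While[where Inv = Inv and k = "2 * n", OF that])
    fix i m w' t' assume i: "i < 2 * n" and inv: "Inv i (m, w', t')"
    define c where "c = 2 * n - i"
    have c: "0 < c" "c \<le> 2 * n" "2 * n - Suc i = c - 1" using i by (auto simp: c_def)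
    have *: "w' = w" "m rCnt = int c" "m rDen = D i" "m rBig = 64 * 2 ^ i" "m rOne = 1" "m rN = int n"
      "\<forall>r. r \<notin> {rOne, rN, rBig, rDen, rCnt, rT} \<longrightarrow> m r = 0" "t' \<le> t + 5 + 7 * i"
      using inv by (auto simp: Inv_def c_def)
    have "{2 * n - Suc i + 1..2 * n} = insert c {2 * n - i + 1..2 * n}" "c \<notin> {2 * n - i + 1..2 * n}"
      using i by (auto simp: c_def)
    then have D: "D i * f c = D (Suc i)" by (simp add: D_def mult.commute)
    have rd: "read_input inp (int c + int c) = f c" by (simp add: f_def flip: mult_2)
    have cB: "2 * int c \<le> B" using c n_le by simp
    have bB: "128 * 2 ^ i \<le> B" "64 * 2 ^ Suc i = (128 * 2 ^ i :: int)" using big_le[of "Suc i"] i by simp_all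
    have DB: "\<bar>D (Suc i)\<bar> \<le> B" "\<bar>f c\<bar> \<le> B" using D_le[of "Suc i"] f[of c] c by auto
    have step: "Inv (Suc i) (m(rT := f c, rDen := D (Suc i), rBig := 128 * 2 ^ i, rCnt := int c - 1), w, t'')"
      if "t'' \<le> t' + 7" for t''
      using * c that bB(2) by (simp add: Inv_def of_nat_diff)
    have "wp inp B ?body (Inv (Suc i)) (m, w', t' + 2)"
      using * D rd cB bB(1) DB c by simp (rule step, simp)
    then show "m rCnt > 0 \<and> wp inp B ?body (Inv (Suc i)) (m, w', t' + 2)" using * c by simp
  next
    fix m w' t' assume "Inv (2 * n) (m, w', t')"
    then have *: "w' = w" "m rCnt = 0" "m rDen = den" "m rBig = int big" "m rOne = 1" "m rN = int n"
      "\<And>r. r \<notin> {rOne, rN, rBig, rDen, rCnt, rT} \<Longrightarrow> m r = 0" "t' \<le> t + 5 + 14 * n"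
      by (auto simp: Inv_def D_def den f_def big_eq)
    have "Q (m(rCall := 1), w, t'')" if "t'' \<le> t' + 3" for t''
      by (rule Q) (use * that in \<open>simp_all add: globals_def\<close>)
    then show "m rCnt \<le> 0 \<and> wp inp B (Op (Const rCall 1)) Q (m, w', t' + 2)"
      using * D_le[of 0] by simp
  qed simp
  have "Inv 0 ((\<lambda>_. 0)(rOne := 1, rN := int n, rBig := 64, rDen := 1, rCnt := 2 * int n), w, t')" if "t' \<le> t + 5" for t'
    using that by (simp add: Inv_def D_def)
  then have "wp inp B (While rCnt ?body) (wp inp B (Op (Const rCall 1)) Q)
     ((\<lambda>_. 0)(rOne := 1, rN := int n, rBig := 64, rDen := 1, rCnt := 2 * int n), w, t')" if "t' \<le> t + 5" for t'
    using that loop by blast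
  then show ?thesis
    unfolding init_def using n big_le[of 0] n_le D_le[of 0] by simp
qed

end

section \<open>The dichotomic approach on the RAM\<close>

abbreviation "rSP \<equiv> 9 :: nat"
abbreviation "rL1 \<equiv> 10 :: nat"
abbreviation "rL2 \<equiv> 11 :: nat"
abbreviation "rR1 \<equiv> 13 :: nat"
abbreviation "rR2 \<equiv> 14 :: nat"

text \<open>The stack pointer is increased before it is used, because the entry above the old height
  \<open>s\<close> is \<open>cell s 0\<close>, whose address contains the factor
  \<open>s + 1\<close>.\<close>

definition push :: com where
  "push = out_ratio rY1 ;; out_ratio rY2 ;; Op (Add rSP rSP rOne) ;; Op (Mul rT rSP rBig) ;; Op (Store rT rY1) ;;
     Op (Add rT rT rOne) ;; Op (Store rT rY2)"

text \<open>Cells 1 and 3 are the denominators of the integer weights and stay 1. Two extreme points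
  differ exactly if their second coordinates do, so one sign test decides whether the second optimum
  is new.\<close>

definition start :: "instr list \<Rightarrow> com" where
  "start A = init ;; Op (Const 0 1) ;; Op (Const 1 1) ;; Op (Const 3 1) ;; call A ;;
     If rFlag (Op (Add rL1 rY1 rZero) ;; Op (Add rL2 rY2 rZero) ;; out_ratio rY1 ;; out_ratio rY2 ;;
       Op (Const 0 0) ;; Op (Const 2 1) ;; call A ;; Op (Sub rT rL2 rY2) ;; If rT push Skip) Skip"

text \<open>The pair consists of the point \<open>L\<close> in registers and the top
  \<open>R\<close> of the stack. Both have the same weighted sum and the answer is optimal, so the
  sign of one difference decides. A new point is pushed, and its pair with \<open>L\<close> comes
  next; otherwise \<open>R\<close> replaces \<open>L\<close>.\<close>

definition treat_pair :: "instr list \<Rightarrow> com" where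
  "treat_pair A = Op (Mul rT rSP rBig) ;; Op (Load rR1 rT) ;; Op (Add rT rT rOne) ;; Op (Load rR2 rT) ;;
     Op (Sub 0 rL2 rR2) ;; Op (Sub 2 rR1 rL1) ;; call A ;;
     Op (Sub rT rL1 rY1) ;; Op (Mul rT rT 0) ;; Op (Sub rU rL2 rY2) ;; Op (Mul rU rU 2) ;; Op (Add rT rT rU) ;;
     If rT push (Op (Add rL1 rR1 rZero) ;; Op (Add rL2 rR2 rZero) ;; Op (Sub rSP rSP rOne))"

definition program :: "instr list \<Rightarrow> com" where
  "program A = start A ;; While rSP (treat_pair A)"

section \<open>Monotonicity of runs, and layout of the input\<close>

lemma ram_step_halted: "length M \<le> pc c \<Longrightarrow> ram_step M inp c = c"
  by (simp add: ram_step_def)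

lemma ram_at_halted:
  assumes "halted_at M inp t" "t \<le> t'"
  shows "ram_at M inp t' = ram_at M inp t"
  using assms(2)
proof (induction t' rule: dec_induct)
  case (step k)
  then show ?case using assms(1) by (simp add: ram_at_Suc halted_at_def ram_step_halted)
qed simp

lemma written_step: "\<exists>zs. written (ram_step M inp c) = written c @ zs"
proof (cases "pc c < length M")
  case True
  then show ?thesis by (cases "M ! pc c") (simp_all add: ram_step_def assign_def)
qed (simp add: ram_step_def)

lemma written_mono:
  assumes "t \<le> t'"
  shows "\<exists>zs. written (ram_at M inp t') = written (ram_at M inp t) @ zs"
  using assms
proof (induction t' rule: dec_induct)
  case (step k)
  then show ?case using written_step[of M inp "ram_at M inp k"] by (auto simp: ram_at_Suc)
qed simp

lemma nth_concat_enc_rat: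
  "k < length rs \<Longrightarrow> concat (map enc_rat rs) ! (2 * k) = fst (quotient_of (rs ! k))"
  "k < length rs \<Longrightarrow> concat (map enc_rat rs) ! (2 * k + 1) = snd (quotient_of (rs ! k))"
proof (induction rs arbitrary: k)
  case (Cons r rs)
  case 1 then show ?case using Cons.IH(1)[of "k - 1"] by (cases k) (auto simp: enc_rat_def split: prod.splits)
  case 2 then show ?case using Cons.IH(2)[of "k - 1"] by (cases k) (auto simp: enc_rat_def split: prod.splits)
qed simp_all

lemma length_concat_enc_rat: "length (concat (map enc_rat rs)) = 2 * length rs"
  by (induction rs) (auto simp: enc_rat_def split: prod.splits)

context boco
begin

lemma read_input_enc_instance:
  "read_input (enc_instance I) 0 = int (nvars I)"
  "i < 2 \<Longrightarrow> j < nvars I \<Longrightarrow>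
    read_input (enc_instance I) (int (2 * (i * nvars I + j) + 1)) = fst (quotient_of (cost I $$ (i, j)))"
  "i < 2 \<Longrightarrow> j < nvars I \<Longrightarrow>
    read_input (enc_instance I) (int (2 * (i * nvars I + j) + 2)) = snd (quotient_of (cost I $$ (i, j)))"
proof -
  let ?n = "nvars I"
  define rs where "rs = list_of_vec (row (cost I) 0) @ list_of_vec (row (cost I) 1)"
  have inp: "enc_instance I = int ?n # concat (map enc_rat rs) @ descr I"
    by (simp add: enc_instance_def rs_def)
  have dim: "dim_col (cost I) = ?n" "dim_row (cost I) = 2" using cost_carrier by auto
  have len: "length rs = 2 * ?n" using dim by (simp add: rs_def)
  show "read_input (enc_instance I) 0 = int ?n" by (simp add: read_input_def inp)
  assume i: "i < 2" and j: "j < ?n"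
  let ?k = "i * ?n + j"
  have "i = 0 \<or> i = 1" using i by auto
  then have k: "?k < length rs" and nth: "rs ! ?k = cost I $$ (i, j)"
    using j dim len by (auto simp: nth_append list_of_vec_index rs_def)
  show "read_input (enc_instance I) (int (2 * ?k + 1)) = fst (quotient_of (cost I $$ (i, j)))"
    using nth_concat_enc_rat(1)[OF k] length_concat_enc_rat[of rs] k
    unfolding read_input_def inp nat_int nth by (simp add: nth_append)
  show "read_input (enc_instance I) (int (2 * ?k + 2)) = snd (quotient_of (cost I $$ (i, j)))"
    using nth_concat_enc_rat(2)[OF k] length_concat_enc_rat[of rs] k
    unfolding read_input_def inp nat_int nth by (simp add: nth_append)
qed

lemma row_index:
  assumes "0 < k" "k \<le> 2 * nvars I"
  obtains i j where "i < 2" "j < nvars I" "k = i * nvars I + j + 1"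
proof (cases "k \<le> nvars I")
  case True
  then show ?thesis using that[of 0 "k - 1"] assms by simp
next
  case False
  then show ?thesis using that[of 1 "k - nvars I - 1"] assms by simp
qed

text \<open>A product instead of the least common multiple: it is computed without gcds, and its bit
  length is still bounded by the encoding length of the matrix.\<close>

definition common_den :: int where
  "common_den = (\<Prod>k\<in>{1..2 * nvars I}. read_input (enc_instance I) (int (2 * k)))"

lemma denominator_pos:
  assumes "0 < k" "k \<le> 2 * nvars I"
  shows "0 < read_input (enc_instance I) (int (2 * k))"
proof -
  obtain i j where ij: "i < 2" "j < nvars I" "k = i * nvars I + j + 1" using assms by (rule row_index)
  have k: "2 * k = 2 * (i * nvars I + j) + 2" using ij(3) by simp
  show ?thesis unfolding k read_input_enc_instance(3)[OF ij(1,2)]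
    using quotient_of_denom_pos'[of "cost I $$ (i, j)"] .
qed

lemma common_den_pos: "0 < common_den"
  unfolding common_den_def by (intro prod_pos ballI denominator_pos) auto

text \<open>Every denominator is a factor of \<open>common_den\<close>, so the integer division in
  \<open>coef\<close> is exact.\<close>

lemma of_int_coef:
  assumes "i < 2" "j < nvars I"
  shows "of_int (coef (enc_instance I) (nvars I) common_den i j) = of_int common_den * cost I $$ (i, j)"
proof -
  let ?n = "nvars I" and ?c = "cost I $$ (i, j)"
  define p q where "p = fst (quotient_of ?c)" and "q = snd (quotient_of ?c)"
  have q: "q > 0" "?c = of_int p / of_int q"
    using quotient_of_denom_pos'[of ?c] quotient_of_div[of ?c p q] by (simp_all add: p_def q_def)
  have "i = 0 \<or> i = 1" using assms by auto
  then have "i * ?n + j + 1 \<in> {1..2 * ?n}" using assms(2) by auto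
  then have "read_input (enc_instance I) (int (2 * (i * ?n + j + 1))) dvd common_den"
    unfolding common_den_def by (intro dvd_prodI) auto
  then have "q dvd common_den"
    using read_input_enc_instance(3)[OF assms] by (simp add: q_def algebra_simps)
  then obtain r where r: "common_den = q * r" by (rule dvdE)
  have "coef (enc_instance I) ?n common_den i j = p * r"
    unfolding coef_def read_input_enc_instance(2,3)[OF assms] p_def[symmetric] q_def[symmetric]
    using q r by simp
  then show ?thesis using q r by simp
qed

definition to_point :: "int \<times> int \<Rightarrow> rat \<times> rat" where
  "to_point y = (of_int (fst y) / of_int common_den, of_int (snd y) / of_int common_den)"

lemma to_point_less: "fst (to_point y) < fst (to_point z) \<longleftrightarrow> fst y < fst z"
  "snd (to_point y) < snd (to_point z) \<longleftrightarrow> snd y < snd z"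
  using common_den_pos by (simp_all add: to_point_def divide_less_cancel)

lemma to_point_inject: "to_point y = to_point z \<longleftrightarrow> y = z"
  using common_den_pos by (auto simp: to_point_def prod_eq_iff)

lemma enc_point_to_point: "enc_point (to_point y) =
  enc_rat (of_int (fst y) / of_int common_den) @ enc_rat (of_int (snd y) / of_int common_den)"
  by (simp add: enc_point_def to_point_def)

lemma partial_img:
  assumes ram: "lex_ram (enc_instance I) B X common_den big (nvars I)" and x: "x \<in> sols I"
  shows "to_point (lex_ram.partial (enc_instance I) common_den (nvars I) 0 (1 # list_of_vec x),
    lex_ram.partial (enc_instance I) common_den (nvars I) 1 (1 # list_of_vec x)) = img I x"
proof -
  have c: "x \<in> carrier_vec (nvars I)" using x sols_01 by auto
  have "of_int (lex_ram.partial (enc_instance I) common_den (nvars I) i (1 # list_of_vec x)) / of_int common_den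
      = (cost I *\<^sub>v map_vec rat_of_int x) $ i" if i: "i < 2" for i
  proof -
    have "of_int (lex_ram.partial (enc_instance I) common_den (nvars I) i (1 # list_of_vec x))
      = (\<Sum>j<nvars I. of_int common_den * cost I $$ (i, j) * rat_of_int (x $ j))"
      unfolding lex_ram.partial_def[OF ram] using c i
      by (auto simp: list_of_vec_index of_int_coef intro!: sum.cong)
    also have "\<dots> = of_int common_den * (cost I *\<^sub>v map_vec rat_of_int x) $ i"
      unfolding img_nth[OF i c] sum_distrib_left by (simp add: mult.assoc)
    finally show ?thesis using common_den_pos by simp
  qed
  from this[of 0] this[of 1] show ?thesis by (simp add: to_point_def img_def Let_def)
qed

end

text \<open>All points are represented by integers, scaled by the common denominator of the cost matrix; so are the
  weights, which does not change the image of a lexicographic optimum. \<open>X\<close> and \<open>G\<close> bound the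
  cells of the simulated machine and the scaled points, \<open>T\<close> is the time of a call, and \<open>bits\<close>
  bounds the number of iterations of the Euclidean algorithm.\<close>

locale dichotomic = lex_solver +
  fixes A :: "instr list" and X G :: int and T bits :: nat
  assumes X_ge: "3 \<le> X" "int (length A) + 1 \<le> X" "\<And>i. i \<in> set A \<Longrightarrow> int (instr_max i) \<le> X"
    and G: "1 \<le> G" "4 * int (nvars I) + 4 \<le> G" "common_den \<le> G"
      "\<And>k. k \<le> 4 * nvars I \<Longrightarrow> \<bar>read_input (enc_instance I) (int k)\<bar> \<le> G"
      "\<And>i. i < 2 \<Longrightarrow> (\<Sum>j<nvars I. \<bar>coef (enc_instance I) (nvars I) common_den i j\<bar>) \<le> G"
    and bits: "common_den * common_den < 2 ^ bits"
    and alg_mem_le: "\<And>a b t c. 0 \<le> a \<Longrightarrow> a \<le> 2 * G \<Longrightarrow> 0 \<le> b \<Longrightarrow> b \<le> 2 * G \<Longrightarrow>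
      \<bar>mem (ram_at A ([a, 1, b, 1] @ enc_instance I) t) c\<bar> \<le> X"
    and alg_answer: "\<And>a b. 0 \<le> a \<Longrightarrow> a \<le> 2 * G \<Longrightarrow> 0 \<le> b \<Longrightarrow> b \<le> 2 * G \<Longrightarrow>
      \<exists>t\<le>T. halted_at A ([a, 1, b, 1] @ enc_instance I) t \<and>
        written (ram_at A ([a, 1, b, 1] @ enc_instance I) t) = enc_answer (alg I (of_int a, of_int b))"
begin

abbreviation "inp \<equiv> enc_instance I"
abbreviation "n \<equiv> nvars I"

definition big :: nat where "big = 64 * 2 ^ (2 * n)"

text \<open>The summands serve the cells of simulated calls, the addresses of the stack, and the two
  products in the test of \<open>treat_pair\<close>, each of which is at most
  \<open>4 * (G * G)\<close> in absolute value.\<close>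

definition B :: int where "B = (X + 2 + int big) * int big + 16 * (G * G)"

lemma big_ge: "64 \<le> big" by (simp add: big_def)

lemma B_bounds: "(X + 2) * int big \<le> B" "int big * int big \<le> B" "16 * (G * G) \<le> B" "16 * G \<le> B"
proof -
  have "0 \<le> (X + 2) * int big" "0 \<le> int big * int big" using X_ge(1) by auto
  moreover have "G * 1 \<le> G * G" using G(1) by (intro mult_left_mono) auto
  moreover have "B = (X + 2) * int big + int big * int big + 16 * (G * G)"
    by (simp add: B_def algebra_simps)
  moreover have "0 \<le> G" using G(1) by simp
  ultimately show "(X + 2) * int big \<le> B" "int big * int big \<le> B" "16 * (G * G) \<le> B" "16 * G \<le> B"
    by linarith+
qed

sublocale lex_ram inp B X common_den big n
proof
  show "64 \<le> big" "(X + 2) * int big \<le> B" "3 \<le> X" "0 < common_den"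
    using big_ge B_bounds X_ge common_den_pos by auto
  show "4 * int n + 4 \<le> B" "common_den \<le> B" using G B_bounds by linarith+
  show "\<bar>read_input inp (int k)\<bar> \<le> B" if "k \<le> 4 * n" for k using G(1) G(4)[OF that] B_bounds by linarith
  show "0 < read_input inp (int (2 * k))" if "0 < k" "k \<le> 2 * n" for k using that by (rule denominator_pos)
  show "(\<Sum>j<n. \<bar>coef inp n common_den i j\<bar>) \<le> B" if "i < 2" for i using G(1) G(5)[OF that] B_bounds by linarith
qed

lemma to_point_img:
  "x \<in> sols I \<Longrightarrow> to_point (partial 0 (1 # list_of_vec x), partial 1 (1 # list_of_vec x)) = img I x"
  by (rule partial_img) (rule lex_ram_axioms)

lemma answer_ok_enc_answer:
  assumes "\<And>x. a = Some x \<Longrightarrow> x \<in> sols I"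
  shows "answer_ok (enc_answer a)"
proof (cases a)
  case (Some x)
  then have "x \<in> carrier_vec n" "\<forall>j<n. x $ j \<in> {0, 1}" using assms sols_01 by auto
  then show ?thesis using Some by (auto simp: answer_ok_def set_list_of_vec vec_set_def)
qed (simp add: answer_ok_def)

lemma outcome_bound:
  assumes "to_point y \<in> outcomes"
  shows "\<bar>fst y\<bar> \<le> G" "\<bar>snd y\<bar> \<le> G"
proof -
  obtain x where x: "x \<in> sols I" "to_point y = img I x" using assms by (auto simp: outcomes_def)
  then have "y = (partial 0 (1 # list_of_vec x), partial 1 (1 # list_of_vec x))"
    using to_point_img to_point_inject by metis
  moreover have "answer_ok (1 # list_of_vec x)"
    using answer_ok_enc_answer[of "Some x"] x by simp
  ultimately show "\<bar>fst y\<bar> \<le> G" "\<bar>snd y\<bar> \<le> G"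
    using abs_partial_le[of "1 # list_of_vec x"] G(5)[of 0] G(5)[of 1] by (auto intro: order_trans)
qed

lemma answer_ok_prefix: "answer_ok (ws @ zs) \<Longrightarrow> answer_ok ws"
  by (simp add: answer_ok_def)

definition call_time :: nat where
  "call_time = 10 + T * (4 * length A + 60)"

lemma wp_call_alg:
  assumes k: "2 \<le> k" "k < big" and m: "m rCall = int k - 1" "globals m"
    and fresh: "\<And>a. m (cell a k) = 0"
    and l: "m 0 = a" "m 1 = 1" "m 2 = b" "m 3 = 1" "0 \<le> a" "a \<le> 2 * G" "0 \<le> b" "b \<le> 2 * G"
    and Q: "\<And>m' t'. (\<And>r. r < 20 \<Longrightarrow> m' r = m r) \<Longrightarrow> m' rCall = int k \<Longrightarrow>
      (\<And>a k'. k' < 2 \<or> k < k' \<and> k' < big \<Longrightarrow> m' (cell a k') = m (cell a k')) \<Longrightarrow>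
      case alg I (of_int a, of_int b) of None \<Rightarrow> m' rFlag = 0
        | Some x \<Rightarrow> m' rFlag = 1 \<and> to_point (m' rY1, m' rY2) = img I x \<Longrightarrow>
      t' \<le> t + call_time \<Longrightarrow> Q (m', w, t')"
  shows "wp inp B (call A) Q (m, w, t)"
proof -
  define inpA where "inpA = [a, 1, b, 1] @ inp"
  define h where "h = (LEAST t. halted_at A inpA t)"
  obtain t1 where t1: "t1 \<le> T" "halted_at A inpA t1" "written (ram_at A inpA t1) = enc_answer (alg I (of_int a, of_int b))"
    using alg_answer[OF l(5-8)] by (auto simp: inpA_def)
  have h: "halted_at A inpA h" "h \<le> t1" using t1(2) by (auto simp: h_def intro: LeastI Least_le)
  have ans: "written (ram_at A inpA h) = enc_answer (alg I (of_int a, of_int b))"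
    using ram_at_halted[OF h] t1(3) by simp
  have sol: "x \<in> sols I" if "alg I (of_int a, of_int b) = Some x" for x
    using alg_Some[OF _ _ that] l(5,7) by (simp add: lex_optimal_def)
  have ok: "answer_ok (enc_answer (alg I (of_int a, of_int b)))" by (rule answer_ok_enc_answer) (rule sol)
  show ?thesis
  proof (rule wp_call[OF k m fresh])
    show "inpA = map m [0, 1, 2, 3] @ inp" using l by (simp add: inpA_def)
    show "\<bar>mem (ram_at A inpA t) c\<bar> \<le> X" for t c unfolding inpA_def using l by (intro alg_mem_le)
    show "halted_at A inpA h" by fact
    show "\<not> halted_at A inpA i" if "i < h" for i using that not_less_Least by (auto simp: h_def)
    show "answer_ok (written (ram_at A inpA i))" if "i \<le> h" for i
      using written_mono[OF that, of A inpA] ok ans answer_ok_prefix by metis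
    show "enc_answer (alg I (of_int a, of_int b)) = written (ram_at A inpA h)" using ans by simp
    fix m' t'
    assume m': "\<And>r. r < 20 \<Longrightarrow> m' r = m r" "m' rCall = int k"
      "\<And>a k'. k' < 2 \<or> k < k' \<and> k' < big \<Longrightarrow> m' (cell a k') = m (cell a k')"
      "m' rY1 = partial 0 (enc_answer (alg I (of_int a, of_int b)))" "m' rY2 = partial 1 (enc_answer (alg I (of_int a, of_int b)))"
      "m' rFlag = (if enc_answer (alg I (of_int a, of_int b)) = [] then 0 else hd (enc_answer (alg I (of_int a, of_int b))))"
      and t': "t' \<le> t + 10 + h * (4 * length A + 60)"
    have "h * (4 * length A + 60) \<le> T * (4 * length A + 60)" using h(2) t1(1) by (intro mult_right_mono) auto
    then have "t' \<le> t + call_time" using t' unfolding call_time_def by linarith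
    moreover have "case alg I (of_int a, of_int b) of None \<Rightarrow> m' rFlag = 0
        | Some x \<Rightarrow> m' rFlag = 1 \<and> to_point (m' rY1, m' rY2) = img I x"
      using m'(4-6) to_point_img[OF sol] by (auto split: option.split)
    ultimately show "Q (m', w, t')" using m' by (intro Q) auto
  qed (use X_ge in auto)
qed

definition out_time :: nat where
  "out_time = 10 + 7 * bits"

lemma wp_out_point:
  assumes m: "globals m" "\<bar>m rY1\<bar> \<le> G" "\<bar>m rY2\<bar> \<le> G"
    and Q: "\<And>m' t'. (\<And>r. r \<notin> {40..42} \<Longrightarrow> m' r = m r) \<Longrightarrow> t' \<le> t + 2 * out_time \<Longrightarrow>
      Q (m', w @ enc_point (to_point (m rY1, m rY2)), t')"
  shows "wp inp B (out_ratio rY1) (wp inp B (out_ratio rY2) Q) (m, w, t)"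
proof (rule wp_out_ratio[OF m(1) _ _ bits])
  have le: "G + common_den \<le> B" using G(1,3) B_bounds by linarith
  then show "\<bar>m rY1\<bar> + common_den \<le> B" using m by simp
  fix m' t' assume m': "\<And>r. r \<notin> {40..42} \<Longrightarrow> m' r = m r" "t' \<le> t + 10 + 7 * bits"
  have g: "globals m'" using m(1) m'(1) by (simp add: globals_def)
  have y: "m' rY2 = m rY2" using m'(1) by simp
  show "wp inp B (out_ratio rY2) Q (m', w @ enc_rat (of_int (m rY1) / of_int common_den), t')"
  proof (rule wp_out_ratio[OF g _ _ bits])
    show "\<bar>m' rY2\<bar> + common_den \<le> B" using m y le by simp
    fix m'' t'' assume m'': "\<And>r. r \<notin> {40..42} \<Longrightarrow> m'' r = m' r" "t'' \<le> t' + 10 + 7 * bits"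
    have "Q (m'', w @ enc_point (to_point (m rY1, m rY2)), t'')"
      by (rule Q) (use m' m'' in \<open>auto simp: out_time_def\<close>)
    then show "Q (m'', (w @ enc_rat (of_int (m rY1) / of_int common_den)) @ enc_rat (of_int (m' rY2) / of_int common_den), t'')"
      by (simp add: enc_point_to_point y)
  qed simp
qed simp

lemma cell_ge: "64 \<le> cell a k"
  using big_ge by (simp add: cell_def)

lemma stack_address:
  assumes "Suc s < big"
  shows "(int s + 1) * int big = int (cell s 0)" "int (cell s 0) + 1 = int (cell s 1)"
    "int (cell s 1) \<le> B" "int (cell s 0) \<le> B" "int s + 1 \<le> B"
proof -
  show c: "(int s + 1) * int big = int (cell s 0)" "int (cell s 0) + 1 = int (cell s 1)"
    by (simp_all add: cell_def algebra_simps)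
  have "(s + 2) * big \<le> big * big" using assms by (intro mult_right_mono) auto
  moreover have "cell s 1 \<le> (s + 2) * big" using big_ge by (simp add: cell_def)
  ultimately have "int (cell s 1) \<le> int (big * big)" by linarith
  then show "int (cell s 1) \<le> B" "int (cell s 0) \<le> B" "int s + 1 \<le> B"
    using B_bounds(2) c(2) big_ge assms X_B(6)[of 0] by (simp_all add: cell_def)
qed

lemma wp_push:
  assumes m: "globals m" "\<bar>m rY1\<bar> \<le> G" "\<bar>m rY2\<bar> \<le> G" "m rSP = int s" "Suc s < big"
    and Q: "\<And>m' t'. (\<And>r. r < 20 \<Longrightarrow> r \<noteq> rSP \<Longrightarrow> m' r = m r) \<Longrightarrow> m' rSP = int (Suc s) \<Longrightarrow> m' rCall = m rCall \<Longrightarrow>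
      (\<And>a k. k < big \<Longrightarrow> (a, k) \<notin> {(s, 0), (s, 1)} \<Longrightarrow> m' (cell a k) = m (cell a k)) \<Longrightarrow>
      m' (cell s 0) = m rY1 \<Longrightarrow> m' (cell s 1) = m rY2 \<Longrightarrow> t' \<le> t + 2 * out_time + 5 \<Longrightarrow>
      Q (m', w @ enc_point (to_point (m rY1, m rY2)), t')"
  shows "wp inp B push Q (m, w, t)"
  unfolding push_def wp_Seq
proof (rule wp_out_point[OF m(1-3)])
  fix m' t' assume m': "\<And>r. r \<notin> {40..42} \<Longrightarrow> m' r = m r" and t': "t' \<le> t + 2 * out_time"
  let ?w = "w @ enc_point (to_point (m rY1, m rY2))"
  have r: "m' rSP = int s" "m' rBig = int big" "m' rOne = 1" "m' rY1 = m rY1" "m' rY2 = m rY2"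
    using m m' by (auto simp: globals_def)
  note c = stack_address[OF m(5)]
  have yB: "\<bar>m rY1\<bar> \<le> B" "\<bar>m rY2\<bar> \<le> B" using m G(1) B_bounds by linarith+
  have ne: "cell a k \<noteq> cell s 0" "cell a k \<noteq> cell s 1" if "k < big" "(a, k) \<notin> {(s, 0), (s, 1)}" for a k
    using that big_ge cell_eq_iff[of k 0 a s] cell_eq_iff[of k 1 a s] by auto
  have ne': "cell s 0 \<noteq> cell s (Suc 0)" using cell_eq_iff[of 0 1 s s] big_ge by auto
  have m'_cell: "m' (cell a k) = m (cell a k)" for a k
    by (rule m') (use cell_ge[of a k] in auto)
  have fin: "Q (m'(rSP := int s + 1, cell s 0 := m rY1, rT := int (cell s 1), cell s 1 := m rY2), ?w, t'')"
    if "t'' \<le> t' + 5" for t''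
    by (rule Q) (use m' m'_cell t' that ne ne' in auto)
  show "wp inp B (Op (Add rSP rSP rOne)) (wp inp B (Op (Mul rT rSP rBig)) (wp inp B (Op (Store rT rY1))
     (wp inp B (Op (Add rT rT rOne)) (wp inp B (Op (Store rT rY2)) Q)))) (m', ?w, t')"
    using r c yB fin by (simp add: fun_upd_twist)
qed

end

section \<open>One iteration of the main loop\<close>

definition sort_pair :: "(rat \<times> rat) \<times> (rat \<times> rat) \<Rightarrow> (rat \<times> rat) \<times> (rat \<times> rat)" where
  "sort_pair p = (if fst (fst p) < fst (snd p) then p else (snd p, fst p))"

context dichotomic
begin

text \<open>The queue consists of the pairs of neighbours in the sequence of the point \<open>L\<close> and the stack
  entries, which is sorted by the first objective; only the orientation of the queued pairs is lost.\<close>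

definition loop_inv :: "da_state \<Rightarrow> nat \<Rightarrow> nat \<Rightarrow> state \<Rightarrow> bool" where
  "loop_inv s j u c \<longleftrightarrow> (case c of (m, w, t) \<Rightarrow> \<exists>L st.
     (da_step alg I ^^ j) (da_start alg I) s \<and> w = concat (map enc_point (fst s)) \<and>
     globals m \<and> m 1 = 1 \<and> m 3 = 1 \<and> m rSP = int (length st) \<and>
     (st \<noteq> [] \<longrightarrow> m rCall = int j + 3 \<and> (\<forall>a k. j + 3 < k \<longrightarrow> k < big \<longrightarrow> m (cell a k) = 0)
       \<and> L = (m rL1, m rL2)) \<and>
     (\<forall>i<length st. st ! i = (m (cell i 0), m (cell i 1))) \<and>
     sorted_wrt (\<lambda>p q. fst p < fst q) (L # rev st) \<and>
     image_mset sort_pair (snd s) = mset (zip (map to_point (L # rev st)) (map to_point (rev st))) \<and>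
     t \<le> u)"

definition start_time :: nat where
  "start_time = 60 + 14 * n + 2 * call_time + 4 * out_time"

definition step_time :: nat where
  "step_time = 60 + call_time + 2 * out_time"

text \<open>Each step raises \<open>progress\<close> by 1, and \<open>progress\<close> is at most
  twice the number of outputs, of which there are at most \<open>2 ^ n\<close>. Hence neither the
  calls nor the stack outgrow \<open>big\<close>.\<close>

lemma run_bounds:
  assumes "(da_step alg I ^^ j) (da_start alg I) s"
  shows "da_inv s" "j + 5 < big" "size (snd s) + 1 < big" "j \<le> 2 * length (fst s)"
proof -
  show inv: "da_inv s" using da_inv_steps[OF relpowp_imp_rtranclp[OF assms] da_inv_start] .
  have pr: "progress s = progress (da_start alg I) + int j" using progress_steps[OF assms] .
  have len: "length (fst s) \<le> 2 ^ n"
    using da_inv_length[of "fst s" "snd s"] inv card_outcomes_le by simp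
  show j: "j \<le> 2 * length (fst s)" using pr progress_start_nonneg by (simp add: progress_def)
  have "size (snd s) \<le> 2 * length (fst s)" using pr progress_start_nonneg by (simp add: progress_def)
  moreover have "(2::nat) ^ n * 1 \<le> 2 ^ n * 2 ^ n" by (intro mult_left_mono) auto
  then have "64 * 2 ^ n \<le> big" by (simp add: big_def mult_2 power_add)
  moreover have "(1::nat) \<le> 2 ^ n" by simp
  ultimately show "j + 5 < big" "size (snd s) + 1 < big" using j len by linarith+
qed

lemma loop_step:
  assumes inv: "loop_inv s j u (m, w, t)" and pos: "m rSP > 0"
  shows "\<exists>s'. da_step alg I s s' \<and> wp inp B (treat_pair A) (loop_inv s' (Suc j) (u + step_time)) (m, w, t + 2)"
proof -
  obtain L st where run: "(da_step alg I ^^ j) (da_start alg I) s" and w: "w = concat (map enc_point (fst s))"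
    and glob: "globals m" and ones: "m 1 = 1" "m 3 = 1" and sp: "m rSP = int (length st)"
    and st: "st \<noteq> [] \<Longrightarrow> m rCall = int j + 3" "\<And>a k. st \<noteq> [] \<Longrightarrow> j + 3 < k \<Longrightarrow> k < big \<Longrightarrow> m (cell a k) = 0"
      "st \<noteq> [] \<Longrightarrow> L = (m rL1, m rL2)"
    and stack: "\<And>i. i < length st \<Longrightarrow> st ! i = (m (cell i 0), m (cell i 1))"
    and sorted: "sorted_wrt (\<lambda>p q. fst p < fst q) (L # rev st)"
    and chain: "image_mset sort_pair (snd s) = mset (zip (map to_point (L # rev st)) (map to_point (rev st)))"
    and t: "t \<le> u"
    using inv unfolding loop_inv_def by auto
  obtain out Q where s: "s = (out, Q)" by (cases s)
  have ne: "st \<noteq> []" using pos sp by auto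
  then obtain st' R where st': "st = st' @ [R]" by (cases st rule: rev_cases) auto
  define h where "h = length st'"
  have len: "length st = Suc h" by (simp add: st' h_def)
  note rb = run_bounds[OF run]
  have "length st = size Q" using arg_cong[OF chain, of size] s by simp
  then have h: "Suc (Suc h) < big" using rb(3) s len by simp
  \<comment> \<open>\<open>L\<close> and the top of the stack form the first link of the chain. Its
    preimage under \<open>sort_pair\<close> is the queued pair that \<open>da_step\<close> is made
    to choose, in unknown orientation.\<close>
  obtain y2 y3 Q' where Q: "Q = add_mset (y2, y3) Q'" and y23: "sort_pair (y2, y3) = (to_point L, to_point R)"
    and chain': "image_mset sort_pair Q' = mset (zip (map to_point (R # rev st')) (map to_point (rev st')))"
    using msed_map_invR[of sort_pair Q "(to_point L, to_point R)"] chain s st' by auto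
  have y23': "(y2, y3) = (to_point L, to_point R) \<or> (y2, y3) = (to_point R, to_point L)"
    using y23 by (auto simp: sort_pair_def split: if_splits)
  have ex: "extreme (to_point L)" "extreme (to_point R)" using rb(1) s Q y23' by (auto simp: da_inv_def)
  have LR: "fst L < fst R" using sorted st' by simp
  then have LR': "fst (to_point L) < fst (to_point R)" by (simp add: to_point_less)
  have LR2: "snd R < snd L" using extreme_snd_less[OF ex LR'] by (simp add: to_point_less)
  note le = outcome_bound[OF extreme_outcome[OF ex(1)]] outcome_bound[OF extreme_outcome[OF ex(2)]]
  define l where "l = da_weight (to_point L) (to_point R)"
  have l_eq: "da_weight y2 y3 = l" using y23' by (auto simp: l_def da_weight_commute)
  \<comment> \<open>The integer weight. Coordinates are at most \<open>G\<close> in absolute value,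
    so these differences are at most \<open>2 * G\<close>, the range in which the behaviour of the
    simulated program is assumed.\<close>
  define a b where "a = snd L - snd R" and "b = fst R - fst L"
  have ab: "0 \<le> a" "a \<le> 2 * G" "0 \<le> b" "b \<le> 2 * G" using LR LR2 le by (auto simp: a_def b_def)
  have scale: "(rat_of_int a, rat_of_int b) = (of_int common_den * fst l, of_int common_den * snd l)"
    unfolding l_def da_weight_sorted[OF ex LR'] a_def b_def
    using common_den_pos by (simp add: to_point_def diff_divide_distrib[symmetric])
  have l_nn: "fst l \<ge> 0" "snd l \<ge> 0" by (simp_all add: l_def da_weight_def)
  have "sols I \<noteq> {}" using extreme_outcome[OF ex(1)] by (auto simp: outcomes_def)
  then obtain x x' where x: "alg I l = Some x" and x': "alg I (of_int a, of_int b) = Some x'"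
    using alg_None_iff[of l] alg_None_iff[of "(of_int a, of_int b)"] l_nn ab by auto
  have opt: "lex_optimal I l x" by (rule alg_Some[OF l_nn x])
  have "lex_optimal I (of_int common_den * fst l, of_int common_den * snd l) x'"
    using alg_Some[OF _ _ x'] ab unfolding scale[symmetric] by simp
  then have "lex_optimal I l x'" by (rule lex_optimal_scale) (use common_den_pos in simp)
  then have imgs: "img I x' = img I x" using opt by (rule lex_optimal_img_unique)
  have same: "wsum l (to_point L) = wsum l (to_point R)" unfolding l_def by (rule wsum_da_weight[OF ex LR'])
  have split_iff: "(wsum l y2 = wsum l (img I x) \<and> wsum l (img I x) = wsum l y3)
      \<longleftrightarrow> wsum l (img I x) = wsum l (to_point L)"
    using y23' same by auto
  have opt_le: "wsum l (img I x) \<le> wsum l (to_point L)"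
    using lex_optimal_le(1)[OF opt extreme_outcome[OF ex(1)]] .
  define splits where "splits \<longleftrightarrow> wsum l (img I x) < wsum l (to_point L)"
  define s' where "s' = (if splits then (out @ [img I x], add_mset (img I x, y2) (add_mset (img I x, y3) Q')) else (out, Q'))"
  have step: "da_step alg I s s'"
  proof (cases splits)
    case True
    then show ?thesis unfolding s Q s'_def
      using da_step.split[of l y2 y3 alg I x out Q'] l_eq x split_iff by (simp add: splits_def)
  next
    case False
    then show ?thesis unfolding s Q s'_def
      using da_step.discard[of l y2 y3 alg I x out Q'] l_eq x split_iff opt_le by (simp add: splits_def)
  qed
  have run': "(da_step alg I ^^ Suc j) (da_start alg I) s'" using run step by auto
  let ?R = "loop_inv s' (Suc j) (u + step_time)"
  have R: "R = (m (cell h 0), m (cell h 1))" using stack[of h] st' by (simp add: h_def)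
  have L: "L = (m rL1, m rL2)" using st(3)[OF ne] .
  have R_le: "\<bar>fst R\<bar> \<le> B" "\<bar>snd R\<bar> \<le> B" using le(3,4) B_bounds(4) G(1) by simp_all
  have addr: "Suc h < big" using h by simp
  note addr = stack_address[OF addr]
  let ?m = "m(rT := int (cell h 1), rR1 := fst R, rR2 := snd R, 0 := a, 2 := b)"
  let ?branch = "If rT push (Op (Add rL1 rR1 rZero) ;; Op (Add rL2 rR2 rZero) ;; Op (Sub rSP rSP rOne))"
  let ?tail = "Op (Sub rT rL1 rY1) ;; Op (Mul rT rT 0) ;; Op (Sub rU rL2 rY2) ;; Op (Mul rU rU 2) ;; Op (Add rT rT rU) ;; ?branch"
  have call: "wp inp B (call A) (wp inp B ?tail ?R) (?m, w, t0)" if t0: "t0 \<le> t + 8" for t0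
  \<comment> \<open>Rows 0 and 1 hold the stack and rows 2 and 3 served the two initial calls, so
    iteration \<open>j\<close> uses row \<open>j + 4\<close>, which is still blank.\<close>
  proof (rule wp_call_alg[where a = a and b = b and k = "j + 4"])
    show "2 \<le> j + 4" "j + 4 < big" using rb(2) by auto
    show "?m rCall = int (j + 4) - 1" using st(1)[OF ne] by simp
    show "globals ?m" using glob by (simp add: globals_def)
    show "?m (cell a (j + 4)) = 0" for a using st(2)[OF ne, of "j + 4" a] rb(2) by simp
    fix m' t'
    assume m': "\<And>r. r < 20 \<Longrightarrow> m' r = ?m r" "m' rCall = int (j + 4)"
      "\<And>a k'. k' < 2 \<or> j + 4 < k' \<and> k' < big \<Longrightarrow> m' (cell a k') = ?m (cell a k')"
      and ans: "case alg I (of_int a, of_int b) of None \<Rightarrow> m' rFlag = 0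
        | Some x \<Rightarrow> m' rFlag = 1 \<and> to_point (m' rY1, m' rY2) = img I x"
      and t': "t' \<le> t0 + call_time"
    define Y where "Y = (m' rY1, m' rY2)"
    have Y: "to_point Y = img I x" using ans x' imgs by (simp add: Y_def)
    have Y_le: "\<bar>fst Y\<bar> \<le> G" "\<bar>snd Y\<bar> \<le> G"
      using outcome_bound[of Y] lex_optimal_outcome[OF opt] Y by auto
    define d where "d = (fst L - fst Y) * a + (snd L - snd Y) * b"
    \<comment> \<open>\<open>common_den\<close> enters twice, through the points and through the
      weight, so \<open>d\<close> has the sign of the true difference.\<close>
    have "rat_of_int d = (wsum l (to_point L) - wsum l (to_point Y)) * (of_int common_den * of_int common_den)"
    proof -
      have "of_int common_den * fst l = rat_of_int a" "of_int common_den * snd l = rat_of_int b" using scale by auto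
      moreover have "of_int common_den * fst (to_point y) = rat_of_int (fst y)"
        "of_int common_den * snd (to_point y) = rat_of_int (snd y)" for y
        using common_den_pos by (simp_all add: to_point_def)
      ultimately have "rat_of_int d = (of_int common_den * fst (to_point L) - of_int common_den * fst (to_point Y)) * (of_int common_den * fst l)
         + (of_int common_den * snd (to_point L) - of_int common_den * snd (to_point Y)) * (of_int common_den * snd l)"
        by (simp add: d_def)
      then show ?thesis by (simp add: wsum_def algebra_simps)
    qed
    then have "0 < rat_of_int d \<longleftrightarrow> splits"
      using common_den_pos by (simp add: zero_less_mult_iff splits_def Y)
    then have d: "0 < d \<longleftrightarrow> splits" by simp
    have prod: "\<bar>(p - q) * c\<bar> \<le> 4 * (G * G)" if "\<bar>p\<bar> \<le> G" "\<bar>q\<bar> \<le> G" "0 \<le> c" "c \<le> 2 * G" for p q c :: int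
    proof -
      have "\<bar>(p - q) * c\<bar> = \<bar>p - q\<bar> * \<bar>c\<bar>" by (rule abs_mult)
      also have "\<dots> \<le> (2 * G) * (2 * G)" using that by (intro mult_mono) auto
      finally show ?thesis by simp
    qed
    note prods = prod[OF le(1) Y_le(1) ab(1,2)] prod[OF le(2) Y_le(2) ab(3,4)]
    have "\<bar>(fst L - fst Y) * a\<bar> \<le> B" using prods(1) B_bounds(3) by linarith
    moreover have "\<bar>(snd L - snd Y) * b\<bar> \<le> B" using prods(2) B_bounds(3) by linarith
    moreover have "\<bar>d\<bar> \<le> B" unfolding d_def using prods B_bounds(3) by linarith
    moreover have "\<bar>fst L - fst Y\<bar> \<le> B" using le(1) Y_le(1) B_bounds(4) by linarith
    moreover have "\<bar>snd L - snd Y\<bar> \<le> B" using le(2) Y_le(2) B_bounds(4) by linarith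
    ultimately have bounds: "\<bar>(fst L - fst Y) * a\<bar> \<le> B" "\<bar>(snd L - snd Y) * b\<bar> \<le> B" "\<bar>d\<bar> \<le> B"
      "\<bar>fst L - fst Y\<bar> \<le> B" "\<bar>snd L - snd Y\<bar> \<le> B" by blast+
    have regs: "m' rL1 = fst L" "m' rL2 = snd L" "m' rY1 = fst Y" "m' rY2 = snd Y" "m' 0 = a" "m' 2 = b"
      "m' rR1 = fst R" "m' rR2 = snd R" "m' rZero = 0" "m' rOne = 1" "m' rSP = int (Suc h)" "m' 1 = 1" "m' 3 = 1"
      using m'(1) L glob ones sp len by (simp_all add: Y_def globals_def)
    have glob': "globals m'" using m'(1) glob by (simp add: globals_def)
    let ?m2 = "m'(rT := d, rU := (snd L - snd Y) * b)"
    have cells: "m' (cell i 0) = m (cell i 0)" "m' (cell i 1) = m (cell i 1)" for i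
      using m'(3)[of 0 i] m'(3)[of 1 i] by simp_all
    have fresh: "m' (cell i k) = 0" if "j + 4 < k" "k < big" for i k
      using m'(3)[of k i] that st(2)[OF ne, of k i] by simp
    have branch: "wp inp B ?branch ?R (?m2, w, t'')" if t'': "t'' \<le> t' + 5" for t''
    proof (cases splits)
      case True
      have bt: "fst L < fst Y" "fst Y < fst R"
        using split_between[OF ex LR' lex_optimal_outcome[OF opt]] True
        by (simp_all add: splits_def l_def flip: Y to_point_less)
      have push: "wp inp B push ?R (?m2, w, t'' + 2)"
      proof (rule wp_push[where s = "Suc h"])
        show "globals ?m2" using glob' by (simp add: globals_def)
        show "\<bar>?m2 rY1\<bar> \<le> G" "\<bar>?m2 rY2\<bar> \<le> G" "?m2 rSP = int (Suc h)" "Suc (Suc h) < big"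
          using regs Y_le h by simp_all
        fix m3 t3
        assume m3: "\<And>r. r < 20 \<Longrightarrow> r \<noteq> rSP \<Longrightarrow> m3 r = ?m2 r" "m3 rSP = int (Suc (Suc h))" "m3 rCall = ?m2 rCall"
          "\<And>a k. k < big \<Longrightarrow> (a, k) \<notin> {(Suc h, 0), (Suc h, 1)} \<Longrightarrow> m3 (cell a k) = ?m2 (cell a k)"
          "m3 (cell (Suc h) 0) = ?m2 rY1" "m3 (cell (Suc h) 1) = ?m2 rY2"
          and t3: "t3 \<le> t'' + 2 + 2 * out_time + 5"
        have "st ! i = (m3 (cell i 0), m3 (cell i 1))" if "i < length st" for i
          using stack[OF that] m3(4)[of 0 i] m3(4)[of 1 i] cells[of i] that len big_ge by simp
        then have stack': "(st @ [Y]) ! i = (m3 (cell i 0), m3 (cell i 1))" if "i < length (st @ [Y])" for i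
          using that m3(5,6) regs len by (cases "i < length st") (auto simp: nth_append less_Suc_eq)
        have fresh': "m3 (cell i k) = 0" if "Suc j + 3 < k" "k < big" for i k
          using m3(4)[of k i] fresh[of k i] that by simp
        have "image_mset sort_pair (snd s') = mset (zip (map to_point (L # rev (st @ [Y]))) (map to_point (rev (st @ [Y]))))"
          using chain' y23' bt True st' by (auto simp: s'_def sort_pair_def to_point_less simp flip: Y)
        moreover have "sorted_wrt (\<lambda>p q. fst p < fst q) (L # rev (st @ [Y]))"
          using sorted bt st' by auto
        moreover have "concat (map enc_point (fst s')) = w @ enc_point (to_point (?m2 rY1, ?m2 rY2))"
          using True w s regs by (simp add: s'_def flip: Y)
        moreover have "globals m3" "m3 1 = 1" "m3 3 = 1" "L = (m3 rL1, m3 rL2)"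
          using m3(1) glob' regs by (simp_all add: globals_def)
        moreover have "m3 rCall = int (Suc j) + 3" using m3(3) m'(2) by simp
        moreover have "t3 \<le> u + step_time" using t3 t'' t' t0 t by (simp add: step_time_def)
        ultimately show "?R (m3, w @ enc_point (to_point (?m2 rY1, ?m2 rY2)), t3)"
          unfolding loop_inv_def prod.case using run' stack' fresh' m3(2) len
          by (intro exI[of _ L] exI[of _ "st @ [Y]"] conjI) auto
      qed
      then show ?thesis using True d by simp
    next
      case False
      let ?m3 = "?m2(rL1 := fst R, rL2 := snd R, rSP := int h)"
      have fin: "?R (?m3, w, t3)" if t3: "t3 \<le> t'' + 5" for t3
      proof -
        have "st' ! i = (?m3 (cell i 0), ?m3 (cell i 1))" if "i < length st'" for i
          using stack[of i] that cells[of i] st' by (simp add: nth_append)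
        moreover have "image_mset sort_pair (snd s') = mset (zip (map to_point (R # rev st')) (map to_point (rev st')))"
          using chain' False by (simp add: s'_def)
        moreover have "sorted_wrt (\<lambda>p q. fst p < fst q) (R # rev st')" using sorted st' by simp
        moreover have "concat (map enc_point (fst s')) = w" using False w s by (simp add: s'_def)
        moreover have "globals ?m3" "?m3 1 = 1" "?m3 3 = 1" "R = (?m3 rL1, ?m3 rL2)"
          using glob' regs by (simp_all add: globals_def)
        moreover have "?m3 rCall = int (Suc j) + 3" using m'(2) by simp
        moreover have "t3 \<le> u + step_time" using t3 t'' t' t0 t by (simp add: step_time_def)
        ultimately show ?thesis
          unfolding loop_inv_def prod.case using run' fresh h_def
          by (intro exI[of _ R] exI[of _ st'] conjI) auto
      qed
      have "int h \<le> B" using addr(5) by simp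
      then show ?thesis using False d regs R_le by (simp add: fin)
    qed
    show "wp inp B ?tail ?R (m', w, t')"
      using regs bounds by (simp del: wp_If add: d_def[symmetric] fun_upd_twist) (rule branch, simp)
  qed (use ab ones in simp_all)
  have "\<bar>a\<bar> \<le> B" "\<bar>b\<bar> \<le> B" using ab B_bounds(4) G(1) by simp_all
  with R_le have "wp inp B (treat_pair A) ?R (m, w, t + 2)"
    unfolding treat_pair_def
    using glob ones sp len addr R L call by (simp add: globals_def a_def b_def fun_upd_twist add.commute)
  then show ?thesis using step by blast
qed

lemma wp_start:
  "wp inp B (start A) (loop_inv (da_start alg I) 0 start_time) (\<lambda>_. 0, [], 0)"
proof -
  let ?R = "loop_inv (da_start alg I) 0 start_time"
  have run: "(da_step alg I ^^ 0) (da_start alg I) (da_start alg I)" by simp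
  have B1: "1 \<le> B" using G(1) B_bounds(4) by simp
  have G2: "1 \<le> 2 * G" using G(1) by simp
  have big5: "4 < big" using big_ge by simp
  let ?second = "Op (Const 0 0) ;; Op (Const 2 1) ;; call A ;; Op (Sub rT rL2 rY2) ;; If rT push Skip"
  let ?first = "If rFlag (Op (Add rL1 rY1 rZero) ;; Op (Add rL2 rY2 rZero) ;; out_ratio rY1 ;; out_ratio rY2 ;; ?second) Skip"
  show ?thesis
    unfolding start_def wp_Seq
  proof (rule wp_init)
    show "read_input inp 0 = int n" by (rule read_input_enc_instance)
    show "common_den = (\<Prod>k\<in>{1..2 * n}. read_input inp (int (2 * k)))" by (rule common_den_def)
    show "big = 64 * 2 ^ (2 * n)" by (rule big_def)
    fix m t
    assume m: "globals m" "m rCall = 1" "\<And>r. r < 20 \<Longrightarrow> r \<notin> {rOne, rN, rBig, rDen} \<Longrightarrow> m r = 0"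
      "\<And>a k. m (cell a k) = 0" and t: "t \<le> 0 + 8 + 14 * n"
    let ?m = "m(0 := 1, 1 := 1, 3 := 1)"
    have first: "wp inp B (call A) (wp inp B ?first ?R) (?m, [], t0)" if t0: "t0 \<le> t + 3" for t0
    proof (rule wp_call_alg[where a = 1 and b = 0 and k = 2])
      show "globals ?m" using m(1) by (simp add: globals_def)
      fix m1 t1
      assume m1: "\<And>r. r < 20 \<Longrightarrow> m1 r = ?m r" "m1 rCall = int 2"
        "\<And>a k'. k' < 2 \<or> 2 < k' \<and> k' < big \<Longrightarrow> m1 (cell a k') = ?m (cell a k')"
        and ans: "case alg I (of_int 1, of_int 0) of None \<Rightarrow> m1 rFlag = 0
          | Some x \<Rightarrow> m1 rFlag = 1 \<and> to_point (m1 rY1, m1 rY2) = img I x"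
        and t1: "t1 \<le> t0 + call_time"
      have g1: "globals m1" and r1: "m1 0 = 1" "m1 1 = 1" "m1 2 = 0" "m1 3 = 1" "m1 rSP = 0" "m1 rZero = 0"
        using m1(1) m by (simp_all add: globals_def)
      have cells1: "m1 (cell a k) = 0" if "2 < k" "k < big" for a k using m1(3)[of k a] that m(4) by simp
      show "wp inp B ?first ?R (m1, [], t1)"
      proof (cases "alg I (1, 0)")
        case None
        then have "da_start alg I = ([], {#})" by (simp add: da_start_def)
        moreover have "m1 rFlag = 0" using ans None by simp
        ultimately show ?thesis using r1 g1 t1 t0 t run
          by (simp add: loop_inv_def start_time_def)
      next
        case (Some x0)
        have opt0: "lex_optimal I (1, 0) x0" using Some by (intro alg_Some) auto
        then have "sols I \<noteq> {}" by (auto simp: lex_optimal_def)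
        then obtain x1 where x1: "alg I (0, 1) = Some x1" using alg_None_iff[of "(0, 1)"] by auto
        have opt1: "lex_optimal I (0, 1) x1" using x1 by (intro alg_Some) auto
        note end_points = da_start_endpoints[OF opt0 opt1]
        define L where "L = (m1 rY1, m1 rY2)"
        have flag: "m1 rFlag = 1" and L: "to_point L = img I x0" using ans Some by (simp_all add: L_def)
        have L_le: "\<bar>fst L\<bar> \<le> G" "\<bar>snd L\<bar> \<le> G"
          using outcome_bound[of L] L lex_optimal_outcome[OF opt0] by auto
        then have L_B: "\<bar>fst L\<bar> \<le> B" "\<bar>snd L\<bar> \<le> B" using B_bounds(4) G(1) by simp_all
        let ?m1 = "m1(rL1 := fst L, rL2 := snd L)"
        let ?w = "enc_point (to_point L)"
        have "wp inp B (out_ratio rY1) (wp inp B (out_ratio rY2) (wp inp B ?second ?R)) (?m1, [], t2)"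
          if t2: "t2 \<le> t1 + 4" for t2
        proof (rule wp_out_point)
          show "globals ?m1" using g1 by (simp add: globals_def)
          show "\<bar>?m1 rY1\<bar> \<le> G" "\<bar>?m1 rY2\<bar> \<le> G" using L_le by (simp_all add: L_def)
          fix m2 t3
          assume m2: "\<And>r. r \<notin> {40..42} \<Longrightarrow> m2 r = ?m1 r" and t3: "t3 \<le> t2 + 2 * out_time"
          have g2: "globals m2" using m2 g1 by (simp add: globals_def)
          have cell2: "m2 (cell a k) = m1 (cell a k)" for a k
            using m2[of "cell a k"] cell_ge[of a k] by simp
          let ?m2 = "m2(0 := 0, 2 := 1)"
          have "wp inp B (call A) (wp inp B (Op (Sub rT rL2 rY2)) (wp inp B (If rT push Skip) ?R)) (?m2, ?w, t4)"
            if t4: "t4 \<le> t3 + 2" for t4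
          proof (rule wp_call_alg[where a = 0 and b = 1 and k = 3])
            show "globals ?m2" using g2 by (simp add: globals_def)
            show "?m2 rCall = int 3 - 1" using m2 m1(2) by simp
            show "?m2 (cell a 3) = 0" for a using cell2 cells1 big5 by simp
            show "?m2 1 = 1" "?m2 3 = 1" using m2 r1 by simp_all
            fix m3 t5
            assume m3: "\<And>r. r < 20 \<Longrightarrow> m3 r = ?m2 r" "m3 rCall = int 3"
              "\<And>a k'. k' < 2 \<or> 3 < k' \<and> k' < big \<Longrightarrow> m3 (cell a k') = ?m2 (cell a k')"
              and ans3: "case alg I (of_int 0, of_int 1) of None \<Rightarrow> m3 rFlag = 0
                | Some x \<Rightarrow> m3 rFlag = 1 \<and> to_point (m3 rY1, m3 rY2) = img I x"
              and t5: "t5 \<le> t4 + call_time"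
            define Y where "Y = (m3 rY1, m3 rY2)"
            have Y: "to_point Y = img I x1" using ans3 x1 by (simp add: Y_def)
            have Y_le: "\<bar>fst Y\<bar> \<le> G" "\<bar>snd Y\<bar> \<le> G"
              using outcome_bound[of Y] Y lex_optimal_outcome[OF opt1] by auto
            have g3: "globals m3" and r3: "m3 1 = 1" "m3 3 = 1" "m3 rSP = 0" "m3 rL1 = fst L" "m3 rL2 = snd L"
              using m3(1) m2 g2 r1 by (simp_all add: globals_def)
            have cells3: "m3 (cell a k) = 0" if "3 < k" "k < big" for a k
              using m3(3)[of k a] that cell2[of a k] cells1[of k a] by simp
            have d_B: "\<bar>snd L - snd Y\<bar> \<le> B" using L_le(2) Y_le(2) B_bounds(4) by linarith
            let ?m3 = "m3(rT := snd L - snd Y)"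
            have "wp inp B (If rT push Skip) ?R (?m3, ?w, Suc t5)"
            proof (cases "snd L - snd Y > 0")
              case True
              have neq: "img I x0 \<noteq> img I x1" using True by (auto simp: to_point_inject simp flip: L Y)
              have lt: "fst L < fst Y" using end_points(5)[OF neq] by (simp add: to_point_less flip: L Y)
              have start: "da_start alg I = ([to_point L, to_point Y], {#(to_point L, to_point Y)#})"
                using Some x1 neq by (simp add: da_start_def L Y Let_def)
              have "wp inp B push ?R (?m3, ?w, Suc t5 + 2)"
              proof (rule wp_push[where s = 0])
                show "globals ?m3" using g3 by (simp add: globals_def)
                show "\<bar>?m3 rY1\<bar> \<le> G" "\<bar>?m3 rY2\<bar> \<le> G" using Y_le by (simp_all add: Y_def)
                show "?m3 rSP = int 0" "Suc 0 < big" using r3 big5 by simp_all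
                fix m4 t6
                assume m4: "\<And>r. r < 20 \<Longrightarrow> r \<noteq> rSP \<Longrightarrow> m4 r = ?m3 r" "m4 rSP = int (Suc 0)" "m4 rCall = ?m3 rCall"
                  "\<And>a k. k < big \<Longrightarrow> (a, k) \<notin> {(0, 0), (0, 1)} \<Longrightarrow> m4 (cell a k) = ?m3 (cell a k)"
                  "m4 (cell 0 0) = ?m3 rY1" "m4 (cell 0 1) = ?m3 rY2"
                  and t6: "t6 \<le> Suc t5 + 2 + 2 * out_time + 5"
                have "m4 (cell a k) = 0" if "3 < k" "k < big" for a k
                  using m4(4)[of k a] cells3[OF that] that by simp
                moreover have "globals m4" "m4 1 = 1" "m4 3 = 1" "L = (m4 rL1, m4 rL2)"
                  using m4(1) g3 r3 by (simp_all add: globals_def)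
                moreover have "m4 rCall = 3" using m4(3) m3(2) by simp
                moreover have "Y = (m4 (cell 0 0), m4 (cell 0 1))" using m4(5,6) by (simp add: Y_def)
                moreover have "sort_pair (to_point L, to_point Y) = (to_point L, to_point Y)"
                  using lt by (simp add: sort_pair_def to_point_less)
                moreover have "t6 \<le> start_time" using t6 t5 t4 t3 t2 t1 t0 t by (simp add: start_time_def)
                moreover have "to_point (?m3 rY1, ?m3 rY2) = to_point Y" by (simp add: Y_def)
                ultimately show "?R (m4, ?w @ enc_point (to_point (?m3 rY1, ?m3 rY2)), t6)"
                  unfolding loop_inv_def prod.case start using m4(2) lt
                  by (intro exI[of _ L] exI[of _ "[Y]"]) simp
              qed
              then show ?thesis using True by simp
            next
              case False
              have eq: "img I x0 = img I x1"
              proof (rule ccontr)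
                assume neq: "img I x0 \<noteq> img I x1"
                then show False
                  using extreme_snd_less[OF end_points(1,2) end_points(5)[OF neq]] False
                  by (simp add: to_point_less flip: L Y)
              qed
              have start: "da_start alg I = ([to_point L], {#})"
                using Some x1 eq by (simp add: da_start_def L Let_def)
              have "?R (?m3, ?w, t6)" if "t6 \<le> Suc t5 + 2" for t6
                unfolding loop_inv_def prod.case start
                using g3 r3 t5 t4 t3 t2 t1 t0 t that
                by (intro exI[of _ L] exI[of _ "[]"]) (simp add: globals_def start_time_def)
              then show ?thesis using False by simp
            qed
            then show "wp inp B (Op (Sub rT rL2 rY2)) (wp inp B (If rT push Skip) ?R) (m3, ?w, t5)"
              using r3 d_B by (simp add: Y_def)
          qed (use G2 big5 in simp_all)
          then show "wp inp B ?second ?R (m2, [] @ enc_point (to_point (?m1 rY1, ?m1 rY2)), t3)"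
            using B1 by (simp add: L_def)
        qed
        then show ?thesis using flag r1 L_B by (simp add: L_def)
      qed
    qed (use m G2 big5 in simp_all)
    then show "wp inp B (Op (Const 0 1)) (wp inp B (Op (Const 1 1)) (wp inp B (Op (Const 3 1)) (wp inp B (call A) (wp inp B ?first ?R)))) (m, [], t)"
      using B1 by simp
  qed
qed

end

text \<open>For delays the machine has to be observed at every loop head, while executing the whole
  loop at once would show only its end.\<close>

lemma while_iteration:
  assumes code: "code_at M p (code p (While r c))" and pos: "m r > 0"
    and body: "big_step inp B c (m, w, t + 2) s'" and bounded: "bounded_mem B m"
  shows "\<exists>k. reach M inp B k (conf p (m, w, t)) (conf p s') \<and> bounded_mem B (fst s') \<and> t + k \<le> snd (snd s')"
proof -
  have "code_at M (p + 2) (code (p + 2) c)" using code by (simp add: code_at_append code_at_Cons)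
  from big_step_reach[OF body _ this] bounded obtain k where
    k: "reach M inp B k (conf (p + 2) (m, w, t)) (conf (p + 2 + code_len c) s')" "bounded_mem B (fst s')"
      "t + 2 + k \<le> snd (snd s')" by auto
  have "reach M inp B 1 (conf p (m, w, t)) (conf (p + 2) (m, w, t))"
    using code pos bounded by (intro reach_step) (auto simp: ram_step_at)
  moreover have "reach M inp B 1 (conf (p + 2 + code_len c) s') (conf p s')"
    using code k(2) by (intro reach_step) (auto simp: code_at_Cons code_at_append ram_step_def)
  ultimately have "reach M inp B (1 + k + 1) (conf p (m, w, t)) (conf p s')"
    using k by (blast intro: reach_trans)
  then show ?thesis using k by (intro exI[of _ "1 + k + 1"]) auto
qed

section \<open>Output times and delays\<close>

lemma length_enc_point: "length (enc_point y) = 4"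
  by (simp add: enc_point_def enc_rat_def split: prod.splits)

lemma length_concat_enc_point: "length (concat (map enc_point ys)) = 4 * length ys"
  by (induction ys) (simp_all add: length_enc_point)

lemma halting_time_le: "halted_at M inp t \<Longrightarrow> halting_time M inp \<le> t"
  unfolding halting_time_def by (rule Least_le)

lemma ram_at_halting_time:
  assumes "halted_at M inp t"
  shows "ram_at M inp (halting_time M inp) = ram_at M inp t"
proof -
  have "halted_at M inp (halting_time M inp)" unfolding halting_time_def using assms by (rule LeastI)
  then show ?thesis using ram_at_halted halting_time_le[OF assms] by metis
qed

lemma output_time_le: "4 * i \<le> length (written (ram_at M inp t)) \<Longrightarrow> output_time M inp i \<le> t"
  unfolding output_time_def by (rule Least_le)

context dichotomic
begin

abbreviation "M \<equiv> code 0 (program A)"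
abbreviation "loop_pc \<equiv> code_len (start A)"

text \<open>\<open>K\<close> is the actual machine time at the loop head, \<open>t\<close> the
  charged time, which may exceed it.\<close>

definition reaches_loop :: "da_state \<Rightarrow> nat \<Rightarrow> (nat \<Rightarrow> int) \<Rightarrow> nat \<Rightarrow> bool" where
  "reaches_loop s j m K \<longleftrightarrow> (\<exists>w t. loop_inv s j (start_time + j * step_time) (m, w, t) \<and> K \<le> t \<and>
     bounded_mem B m \<and> reach M inp B K (conf 0 (\<lambda>_. 0, [], 0)) (conf loop_pc (m, w, t)))"

lemma code_at_parts: "code_at M 0 (code 0 (start A))" "code_at M loop_pc (code loop_pc (While rSP (treat_pair A)))"
proof -
  have "code_at M 0 M" by (simp add: code_at_def)
  then show "code_at M 0 (code 0 (start A))" "code_at M loop_pc (code loop_pc (While rSP (treat_pair A)))"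
    unfolding program_def code.simps(3) code_at_append by simp_all
qed

lemma reaches_loop_start: "\<exists>m K. reaches_loop (da_start alg I) 0 m K"
proof -
  obtain m w t where bs: "big_step inp B (start A) (\<lambda>_. 0, [], 0) (m, w, t)" and inv: "loop_inv (da_start alg I) 0 start_time (m, w, t)"
    using wp_start by (rule wp_elim)
  have "bounded_mem B (\<lambda>_. 0)" using den_le by (simp add: bounded_mem_def)
  then show ?thesis
    using big_step_reach[OF bs _ code_at_parts(1)] inv unfolding reaches_loop_def by auto
qed

lemma reaches_loop_step:
  assumes "reaches_loop s j m K" "m rSP > 0"
  shows "\<exists>s' m' K'. reaches_loop s' (Suc j) m' K'"
proof -
  obtain w t where c: "loop_inv s j (start_time + j * step_time) (m, w, t)" "K \<le> t" "bounded_mem B m"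
    "reach M inp B K (conf 0 (\<lambda>_. 0, [], 0)) (conf loop_pc (m, w, t))"
    using assms(1) unfolding reaches_loop_def by blast
  obtain s' where "wp inp B (treat_pair A) (loop_inv s' (Suc j) (start_time + j * step_time + step_time)) (m, w, t + 2)"
    using loop_step[OF c(1) assms(2)] by blast
  then obtain m' w' t' where bs: "big_step inp B (treat_pair A) (m, w, t + 2) (m', w', t')"
    and inv: "loop_inv s' (Suc j) (start_time + j * step_time + step_time) (m', w', t')"
    by (rule wp_elim)
  obtain k where k: "reach M inp B k (conf loop_pc (m, w, t)) (conf loop_pc (m', w', t'))" "bounded_mem B m'" "t + k \<le> t'"
    using while_iteration[OF code_at_parts(2) assms(2) bs c(3)] by auto
  have "reaches_loop s' (Suc j) m' (K + k)"
    unfolding reaches_loop_def using inv k c reach_trans[OF c(4) k(1)]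
    by (intro exI[of _ w'] exI[of _ t']) (simp add: add.commute add.left_commute)
  then show ?thesis by blast
qed

lemma reaches_loop_or_ends:
  "(\<exists>s m K. reaches_loop s j m K) \<or> (\<exists>i<j. \<exists>s m K. reaches_loop s i m K \<and> m rSP \<le> 0)"
proof (induction j)
  case 0
  then show ?case using reaches_loop_start by blast
next
  case (Suc j)
  then show ?case using reaches_loop_step by (metis less_SucI lessI not_le)
qed

lemma reaches_loopD:
  assumes "reaches_loop s j m K"
  shows "K \<le> start_time + j * step_time" "length (written (ram_at M inp K)) = 4 * length (fst s)"
    "j \<le> 2 * length (fst s)" "j + 5 < big"
proof -
  obtain w t where c: "loop_inv s j (start_time + j * step_time) (m, w, t)" "K \<le> t" "bounded_mem B m"
    "reach M inp B K (conf 0 (\<lambda>_. 0, [], 0)) (conf loop_pc (m, w, t))"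
    using assms(1) unfolding reaches_loop_def by blast
  then have inv: "t \<le> start_time + j * step_time" "(da_step alg I ^^ j) (da_start alg I) s" "w = concat (map enc_point (fst s))"
    by (auto simp: loop_inv_def)
  show "K \<le> start_time + j * step_time" using inv c by simp
  have "ram_at M inp K = conf loop_pc (m, w, t)" using c(4) by (simp add: reach_def ram_at_def)
  then show "length (written (ram_at M inp K)) = 4 * length (fst s)" by (simp add: inv length_concat_enc_point)
  show "j \<le> 2 * length (fst s)" "j + 5 < big" using run_bounds[OF inv(2)] by auto
qed

lemma loop_end:
  assumes "reaches_loop s j m K" "m rSP \<le> 0"
  shows "halted_at M inp (K + 2)" "written (ram_at M inp (K + 2)) = concat (map enc_point (fst s))"
    "da_run alg I (fst s)" "lists_nondominated_extreme_points I (fst s)"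
    "\<bar>mem (ram_at M inp t) a\<bar> \<le> B"
proof -
  obtain w t0 where c: "loop_inv s j (start_time + j * step_time) (m, w, t0)" "K \<le> t0" "bounded_mem B m"
    "reach M inp B K (conf 0 (\<lambda>_. 0, [], 0)) (conf loop_pc (m, w, t0))"
    using assms(1) unfolding reaches_loop_def by blast
  then have inv: "(da_step alg I ^^ j) (da_start alg I) s" "w = concat (map enc_point (fst s))"
    by (auto simp: loop_inv_def)
  obtain L st where st: "m rSP = int (length st)" "image_mset sort_pair (snd s) = mset (zip (map to_point (L # rev st)) (map to_point (rev st)))"
    using c(1) unfolding loop_inv_def by auto
  then have "snd s = {#}" using assms(2) by simp
  then have s: "s = (fst s, {#})" by (simp add: prod_eq_iff)
  have run: "(da_step alg I)\<^sup>*\<^sup>* (da_start alg I) (fst s, {#})"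
    using relpowp_imp_rtranclp[OF inv(1)] s by simp
  then show "da_run alg I (fst s)" by (simp add: da_run_def)
  show "lists_nondominated_extreme_points I (fst s)"
    using da_inv_steps[OF run da_inv_start] by (rule da_inv_final)
  have len: "length M = loop_pc + code_len (While rSP (treat_pair A))" by (simp add: program_def)
  let ?c = "conf (length M) (m, w, t0)"
  have "reach M inp B 1 (conf loop_pc (m, w, t0)) (conf (loop_pc + 1) (m, w, t0))"
    using code_at_parts(2) c assms(2) by (intro reach_step) (auto simp: ram_step_at)
  moreover have "reach M inp B 1 (conf (loop_pc + 1) (m, w, t0)) ?c"
    unfolding len using code_at_parts(2) c by (intro reach_step) (auto simp: code_at_Cons ram_step_def)
  ultimately have "reach M inp B (K + 1 + 1) (conf 0 (\<lambda>_. 0, [], 0)) ?c"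
    using c(4) by (blast intro: reach_trans)
  then have r: "reach M inp B (K + 2) (conf 0 (\<lambda>_. 0, [], 0)) ?c" by simp
  then have at: "ram_at M inp (K + 2) = ?c" by (simp add: reach_def ram_at_def)
  then show h: "halted_at M inp (K + 2)" by (simp add: halted_at_def)
  show "written (ram_at M inp (K + 2)) = concat (map enc_point (fst s))" using at inv by simp
  show "\<bar>mem (ram_at M inp t) a\<bar> \<le> B"
  proof (cases "t \<le> K + 2")
    case True
    then show ?thesis using r by (simp add: reach_def ram_at_def bounded_mem_def)
  next
    case False
    then have "ram_at M inp t = ?c" using ram_at_halted[OF h, of t] at by simp
    then show ?thesis using c(3) by (simp add: bounded_mem_def)
  qed
qed

text \<open>After \<open>j\<close> iterations at least \<open>j / 2\<close> points have been output, so the time of the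
  \<open>i\<close>-th output alone already bounds the preceding delay.\<close>

lemma program_correct:
  "\<bar>mem (ram_at M inp t) a\<bar> \<le> B"
  "\<exists>t. halted_at M inp t"
  "\<exists>ys. written (ram_at M inp (halting_time M inp)) = concat (map enc_point ys) \<and>
     (da_run alg I ys \<and> lists_nondominated_extreme_points I ys) \<and>
     (\<forall>i\<le>length ys. delay M inp (length ys) i \<le> (2 * i + 3) * (start_time + step_time))"
proof -
  \<comment> \<open>The loop head cannot be reached with iteration number \<open>big\<close>, as
    these numbers satisfy \<open>j + 5 < big\<close>; so the loop ends.\<close>
  obtain j s m K where J: "reaches_loop s j m K" "m rSP \<le> 0"
    using reaches_loop_or_ends[of big] reaches_loopD(4) by fastforce
  note end_J = loop_end[OF J]
  show "\<bar>mem (ram_at M inp t) a\<bar> \<le> B" by (rule end_J(5))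
  show "\<exists>t. halted_at M inp t" using end_J(1) by blast
  have out: "output_time M inp (Suc i) \<le> start_time + (2 * i + 2) * step_time" if i: "i < length (fst s)" for i
  proof -
    \<comment> \<open>After \<open>2 * i + 2\<close> iterations at least \<open>i + 1\<close> points
      are out. If the loop ends earlier, both descriptions of its end refer to the same halted run,
      so all points are out.\<close>
    consider s' m' K' where "reaches_loop s' (2 * i + 2) m' K'"
      | i' s' m' K' where "i' < 2 * i + 2" "reaches_loop s' i' m' K'" "m' rSP \<le> 0"
      using reaches_loop_or_ends[of "2 * i + 2"] by blast
    then show ?thesis
    proof cases
      case (1 s' m' K')
      note d = reaches_loopD[OF 1]
      have "output_time M inp (Suc i) \<le> K'" by (rule output_time_le) (use d in simp)
      then show ?thesis using d(1) by simp
    next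
      case (2 i' s' m' K')
      note d = reaches_loopD[OF 2(2)]
      have "ram_at M inp (K' + 2) = ram_at M inp (K + 2)"
        using ram_at_halting_time[OF end_J(1)] ram_at_halting_time[OF loop_end(1)[OF 2(2,3)]] by simp
      then have "4 * length (fst s') = 4 * length (fst s)"
        using end_J(2) loop_end(2)[OF 2(2,3)] by (metis length_concat_enc_point)
      then have "output_time M inp (Suc i) \<le> K'" by (intro output_time_le) (use d i in simp)
      moreover have "i' * step_time \<le> (2 * i + 2) * step_time" using 2(1) by (intro mult_right_mono) auto
      ultimately show ?thesis using d(1) by linarith
    qed
  qed
  have halt: "halting_time M inp \<le> start_time + 2 * length (fst s) * step_time + 2"
  proof -
    have "j * step_time \<le> 2 * length (fst s) * step_time" using reaches_loopD(3)[OF J(1)] by (intro mult_right_mono) auto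
    then show ?thesis using halting_time_le[OF end_J(1)] reaches_loopD(1)[OF J(1)] by linarith
  qed
  have "delay M inp (length (fst s)) i \<le> (2 * i + 3) * (start_time + step_time)" if i: "i \<le> length (fst s)" for i
  proof (cases "i < length (fst s)")
    case True
    have "delay M inp (length (fst s)) i \<le> start_time + (2 * i + 2) * step_time"
      using out[OF True] True by (simp add: delay_def)
    also have "\<dots> \<le> (2 * i + 3) * (start_time + step_time)" by (simp add: algebra_simps)
    finally show ?thesis .
  next
    case False
    then have "delay M inp (length (fst s)) i \<le> start_time + 2 * i * step_time + 2"
      using halt i by (simp add: delay_def)
    also have "\<dots> \<le> (2 * i + 3) * (start_time + step_time)"
      by (simp add: algebra_simps start_time_def)
    finally show ?thesis .
  qed
  then show "\<exists>ys. written (ram_at M inp (halting_time M inp)) = concat (map enc_point ys) \<and>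
     (da_run alg I ys \<and> lists_nondominated_extreme_points I ys) \<and>
     (\<forall>i\<le>length ys. delay M inp (length ys) i \<le> (2 * i + 3) * (start_time + step_time))"
    using end_J(2-4) ram_at_halting_time[OF end_J(1)] by (intro exI[of _ "fst s"]) simp
qed

end

section \<open>Polynomial bounds\<close>

lemma poly_nat_mono: "x \<le> y \<Longrightarrow> poly p x \<le> poly p y" for p :: "nat poly"
  by (induction p) (auto intro!: add_mono mult_mono)

text \<open>Lifting the coefficients makes a polynomial in the first variable one in two variables
  that is constant in the second.\<close>

lemma poly_map_poly_const: "poly (map_poly (\<lambda>c. [:c:]) p) [:x:] = [:poly p x:]" for p :: "nat poly"
  by (induction p) (simp_all add: map_poly_pCons)

lemma abs_less_int_size: "\<bar>p\<bar> < 2 ^ int_size p"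
proof -
  have "\<bar>p\<bar> < 2 ^ nat (bitlen \<bar>p\<bar>)" using bitlen_le_iff_power[of "\<bar>p\<bar>" "bitlen \<bar>p\<bar>"] by simp
  also have "\<dots> \<le> 2 ^ int_size p" by (intro power_increasing) (auto simp: int_size_def)
  finally show ?thesis .
qed

lemma quotient_of_rat_size:
  "\<bar>fst (quotient_of r)\<bar> < 2 ^ rat_size r" "snd (quotient_of r) < 2 ^ rat_size r"
proof -
  obtain p q where pq: "quotient_of r = (p, q)" by (cases "quotient_of r")
  have "\<bar>p\<bar> < 2 ^ int_size p" "\<bar>q\<bar> < 2 ^ int_size q" by (rule abs_less_int_size)+
  moreover have "(2::int) ^ int_size p \<le> 2 ^ rat_size r" "(2::int) ^ int_size q \<le> 2 ^ rat_size r"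
    by (auto simp: rat_size_def pq intro!: power_increasing)
  ultimately show "\<bar>fst (quotient_of r)\<bar> < 2 ^ rat_size r" "snd (quotient_of r) < 2 ^ rat_size r"
    unfolding pq fst_conv snd_conv by linarith+
qed

lemma rat_size_of_int_le:
  assumes "0 \<le> a" "a \<le> 2 ^ k"
  shows "rat_size (of_int a) \<le> k + 4"
proof -
  have "a < 2 ^ Suc k" using assms(2) zero_less_power[of "2::int" k] by (simp only: power_Suc) linarith
  then have "bitlen a \<le> int (Suc k)" using bitlen_le_iff_power[of a "int (Suc k)"] by (simp add: nat_add_distrib)
  moreover have "bitlen 1 \<le> 1" using bitlen_le_iff_power[of 1 1] by simp
  ultimately show ?thesis using assms(1) by (simp add: rat_size_def int_size_def)
qed

section \<open>Bit lengths of the instance data\<close>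

context boco
begin

abbreviation "size_bound \<equiv> input_size I"

lemma nvars_le: "nvars I \<le> size_bound"
  by (simp add: input_size_def)

lemma mat_size_eq: "mat_size (cost I) = (\<Sum>i<2. \<Sum>j<nvars I. rat_size (cost I $$ (i, j)))"
  using cost_carrier by (simp add: mat_size_def)

lemma rat_size_le:
  assumes "i < 2" "j < nvars I"
  shows "rat_size (cost I $$ (i, j)) \<le> size_bound"
proof -
  have "rat_size (cost I $$ (i, j)) \<le> (\<Sum>j<nvars I. rat_size (cost I $$ (i, j)))"
    using assms by (intro member_le_sum) auto
  also have "\<dots> \<le> (\<Sum>i<2. \<Sum>j<nvars I. rat_size (cost I $$ (i, j)))"
    using assms by (intro member_le_sum[of i "{..<2}" "\<lambda>i. \<Sum>j<nvars I. rat_size (cost I $$ (i, j))"]) auto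
  finally show ?thesis by (simp add: input_size_def mat_size_eq)
qed

lemma entry_le:
  assumes "i < 2" "j < nvars I"
  shows "\<bar>fst (quotient_of (cost I $$ (i, j)))\<bar> \<le> 2 ^ size_bound" "snd (quotient_of (cost I $$ (i, j))) \<le> 2 ^ size_bound"
proof -
  have "(2::int) ^ rat_size (cost I $$ (i, j)) \<le> 2 ^ size_bound"
    using rat_size_le[OF assms] by (intro power_increasing) auto
  then show "\<bar>fst (quotient_of (cost I $$ (i, j)))\<bar> \<le> 2 ^ size_bound" "snd (quotient_of (cost I $$ (i, j))) \<le> 2 ^ size_bound"
    using quotient_of_rat_size[of "cost I $$ (i, j)"] by linarith+
qed

text \<open>Each denominator is at most 2 to the size of its entry, and in the product these sizes
  add up to \<open>mat_size\<close>.\<close>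

lemma common_den_le: "common_den \<le> 2 ^ size_bound"
proof -
  let ?n = "nvars I"
  let ?g = "\<lambda>k. read_input (enc_instance I) (int (2 * Suc k))"
  have "common_den = prod ?g {..<2 * ?n}"
    unfolding common_den_def One_nat_def by (rule prod.atLeast1_atMost_eq)
  also have "\<dots> = (\<Prod>i<2. \<Prod>k\<in>{i * ?n..<i * ?n + ?n}. ?g k)"
    by (rule prod.nat_group[symmetric])
  also have "\<dots> = (\<Prod>i<2. \<Prod>j<?n. snd (quotient_of (cost I $$ (i, j))))"
  proof (rule prod.cong[OF refl])
    fix i :: nat assume i: "i \<in> {..<2}"
    have "(\<Prod>k\<in>{i * ?n..<i * ?n + ?n}. ?g k) = (\<Prod>j<?n. ?g (i * ?n + j))"
      by (subst prod.atLeastLessThan_shift_0) (simp add: atLeast0LessThan)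
    also have "\<dots> = (\<Prod>j<?n. snd (quotient_of (cost I $$ (i, j))))"
      using i read_input_enc_instance(3)[of i] by (intro prod.cong refl) (simp add: algebra_simps)
    finally show "(\<Prod>k\<in>{i * ?n..<i * ?n + ?n}. ?g k) = (\<Prod>j<?n. snd (quotient_of (cost I $$ (i, j))))" .
  qed
  also have "\<dots> \<le> (\<Prod>i<2. \<Prod>j<?n. 2 ^ rat_size (cost I $$ (i, j)))"
  proof (intro prod_mono conjI prod_nonneg ballI)
    fix i j
    show "0 \<le> snd (quotient_of (cost I $$ (i, j)))" "0 \<le> snd (quotient_of (cost I $$ (i, j)))"
      using quotient_of_denom_pos'[of "cost I $$ (i, j)"] by simp_all
    show "snd (quotient_of (cost I $$ (i, j))) \<le> 2 ^ rat_size (cost I $$ (i, j))"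
      using quotient_of_rat_size(2)[of "cost I $$ (i, j)"] by simp
  qed
  also have "\<dots> = 2 ^ mat_size (cost I)" by (simp add: mat_size_eq power_sum)
  also have "\<dots> \<le> 2 ^ size_bound" by (intro power_increasing) (auto simp: input_size_def)
  finally show ?thesis .
qed

lemma nvars_less: "int (nvars I) < 2 ^ size_bound"
proof -
  have "int (nvars I) \<le> int size_bound" using nvars_le by simp
  also have "\<dots> < 2 ^ size_bound" by (rule of_nat_less_two_power)
  finally show ?thesis .
qed

lemma input_entry_le:
  assumes "k \<le> 4 * nvars I"
  shows "\<bar>read_input (enc_instance I) (int k)\<bar> \<le> 2 ^ size_bound"
proof (cases "k = 0")
  case True
  then show ?thesis using read_input_enc_instance(1) nvars_less by simp
next
  case False
  then have "0 < (k + 1) div 2" "(k + 1) div 2 \<le> 2 * nvars I" using assms by auto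
  then obtain i j where ij: "i < 2" "j < nvars I" "(k + 1) div 2 = i * nvars I + j + 1" by (rule row_index)
  have "k + 1 = 2 * ((k + 1) div 2) \<or> k + 1 = 2 * ((k + 1) div 2) + 1" by presburger
  then have "k = 2 * (i * nvars I + j) + 1 \<or> k = 2 * (i * nvars I + j) + 2" unfolding ij(3) by auto
  then show ?thesis
    using read_input_enc_instance(2,3)[OF ij(1,2)] entry_le[OF ij(1,2)] quotient_of_denom_pos'[of "cost I $$ (i, j)"]
    by auto
qed

text \<open>Three factors \<open>2 ^ size_bound\<close>: for the number of columns, the numerator,
  and the cofactor of the common denominator.\<close>

lemma coef_sum_le:
  assumes "i < 2"
  shows "(\<Sum>j<nvars I. \<bar>coef (enc_instance I) (nvars I) common_den i j\<bar>) \<le> 2 ^ (3 * size_bound)"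
proof -
  have "\<bar>coef (enc_instance I) (nvars I) common_den i j\<bar> \<le> 2 ^ size_bound * 2 ^ size_bound" if j: "j < nvars I" for j
  proof -
    let ?q = "snd (quotient_of (cost I $$ (i, j)))"
    have q: "0 < ?q" by (rule quotient_of_denom_pos')
    have "0 \<le> common_den div ?q" using common_den_pos q by (simp add: pos_imp_zdiv_nonneg_iff)
    moreover have "common_den div ?q \<le> common_den div 1" using common_den_pos q by (intro zdiv_mono2) auto
    ultimately have "\<bar>common_den div ?q\<bar> \<le> 2 ^ size_bound" using common_den_le by simp
    then show ?thesis
      unfolding coef_def read_input_enc_instance(2,3)[OF assms j] abs_mult
      using entry_le(1)[OF assms j] by (intro mult_mono) auto
  qed
  then have "(\<Sum>j<nvars I. \<bar>coef (enc_instance I) (nvars I) common_den i j\<bar>) \<le> (\<Sum>j<nvars I. 2 ^ size_bound * 2 ^ size_bound)"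
    by (intro sum_mono) simp
  also have "\<dots> = int (nvars I) * (2 ^ size_bound * 2 ^ size_bound)" by simp
  also have "\<dots> \<le> 2 ^ size_bound * (2 ^ size_bound * 2 ^ size_bound)"
    using nvars_less by (intro mult_right_mono) auto
  also have "\<dots> = 2 ^ (3 * size_bound)" by (simp add: power_add[symmetric])
  finally show ?thesis .
qed

end

section \<open>Choice of explicit polynomials\<close>

definition program_size :: "instr list \<Rightarrow> nat" where
  "program_size A = length A + 4 + sum_list (map instr_max A)"

context lex_solver
begin

text \<open>With \<open>S\<close> the input size, integer weights are at most
  \<open>2 ^ (3 * S + 3)\<close>, so each component has size at most \<open>3 * S + 7\<close>;
  together with the instance this makes \<open>7 * S + 14\<close>.\<close>

lemma dichotomicI:
  fixes q w :: "nat poly"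
  defines "N \<equiv> 7 * input_size I + 14"
  assumes poly_time: "\<And>l. fst l \<ge> 0 \<and> snd l \<ge> 0 \<Longrightarrow>
     (let inp = enc_point l @ enc_instance I; N = input_size I + point_size l
      in cells_bounded A inp (poly w N) \<and>
         (\<exists>t\<le>poly q N. halted_at A inp t \<and> written (ram_at A inp t) = enc_answer (alg I l)))"
  shows "dichotomic I alg A (2 ^ poly w N + int (program_size A)) (2 ^ (3 * input_size I + 2)) (poly q N) (2 * input_size I + 1)"
proof
  let ?S = "input_size I"
  let ?G = "2 ^ (3 * ?S + 2) :: int" and ?X = "2 ^ poly w N + int (program_size A)"
  have G4: "?G = 4 * 2 ^ (3 * ?S)" by (simp add: power_add)
  have pow: "(2::int) ^ ?S \<le> 2 ^ (3 * ?S)" by (intro power_increasing) auto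
  have pos: "(0::int) < 2 ^ (3 * ?S)" "(0::int) < 2 ^ poly w N" by simp_all
  show "3 \<le> ?X" "int (length A) + 1 \<le> ?X" using pos(2) by (simp_all add: program_size_def)
  show "int (instr_max i) \<le> ?X" if "i \<in> set A" for i
  proof -
    have "instr_max i \<le> sum_list (map instr_max A)" using that by (intro member_le_sum_list) auto
    then have "int (instr_max i) \<le> int (program_size A)" by (simp add: program_size_def)
    then show ?thesis using pos(2) by linarith
  qed
  show "1 \<le> ?G" unfolding G4 using pos by linarith
  show "4 * int (nvars I) + 4 \<le> ?G" using nvars_less pow unfolding G4 by linarith
  show "common_den \<le> ?G" using common_den_le pow pos unfolding G4 by linarith
  show "\<bar>read_input (enc_instance I) (int k)\<bar> \<le> ?G" if "k \<le> 4 * nvars I" for k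
    using input_entry_le[OF that] pow pos unfolding G4 by linarith
  show "(\<Sum>j<nvars I. \<bar>coef (enc_instance I) (nvars I) common_den i j\<bar>) \<le> ?G" if "i < 2" for i
    using coef_sum_le[OF that] pos unfolding G4 by linarith
  have "common_den * common_den \<le> 2 ^ ?S * 2 ^ ?S" using common_den_le common_den_pos by (intro mult_mono) auto
  also have "\<dots> = 2 ^ (2 * ?S)" by (simp add: mult_2 power_add)
  also have "\<dots> < 2 ^ (2 * ?S + 1)" by simp
  finally show "common_den * common_den < 2 ^ (2 * ?S + 1)" .
  fix a b :: int assume ab: "0 \<le> a" "a \<le> 2 * ?G" "0 \<le> b" "b \<le> 2 * ?G"
  let ?l = "(rat_of_int a, rat_of_int b)"
  have inp: "enc_point ?l = [a, 1, b, 1]" by (simp add: enc_point_def enc_rat_def)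
  have "2 * ?G = 2 ^ (3 * ?S + 3)" by (simp add: power_add)
  then have "point_size ?l \<le> 2 * (3 * ?S + 3 + 4)"
    using ab rat_size_of_int_le[of a "3 * ?S + 3"] rat_size_of_int_le[of b "3 * ?S + 3"]
    by (simp add: point_size_def)
  then have le: "?S + point_size ?l \<le> N" by (simp add: N_def)
  note pt = poly_time[of ?l, unfolded Let_def inp]
  have "cells_bounded A ([a, 1, b, 1] @ enc_instance I) (poly w (?S + point_size ?l))" using pt ab by simp
  then have c: "bitlen \<bar>mem (ram_at A ([a, 1, b, 1] @ enc_instance I) t) c\<bar> \<le> int (poly w N)" for t c
    unfolding cells_bounded_def using poly_nat_mono[OF le, of w] by (meson of_nat_mono order_trans)
  show "\<bar>mem (ram_at A ([a, 1, b, 1] @ enc_instance I) t) c\<bar> \<le> ?X" for t c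
    using c[of t c] by (simp add: bitlen_le_iff_power)
  obtain t where "t \<le> poly q (?S + point_size ?l)" "halted_at A ([a, 1, b, 1] @ enc_instance I) t"
    "written (ram_at A ([a, 1, b, 1] @ enc_instance I) t) = enc_answer (alg I ?l)" using pt ab by auto
  then show "\<exists>t\<le>poly q N. halted_at A ([a, 1, b, 1] @ enc_instance I) t \<and>
      written (ram_at A ([a, 1, b, 1] @ enc_instance I) t) = enc_answer (alg I ?l)"
    using poly_nat_mono[OF le, of q] by (blast intro: order_trans)
qed

end

text \<open>The reason is \<open>(a - 1) * (b - 1) >= 1\<close>. It merges sums of powers of two
  into one power whose exponent is the sum, which keeps the bound on \<open>B\<close> readable as a
  bit length.\<close>

lemma add_le_mult_int: "2 \<le> a \<Longrightarrow> 2 \<le> b \<Longrightarrow> a + b \<le> a * b" for a b :: int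
  using mult_mono[of 1 "a - 1" 1 "b - 1"] by (simp add: algebra_simps)

lemma dichotomic_B_less:
  assumes d: "dichotomic I alg A (2 ^ W + int c) (2 ^ (3 * S + 2)) T bits" and n: "nvars I \<le> S"
  shows "dichotomic.B I (2 ^ W + int c) (2 ^ (3 * S + 2)) < 2 ^ (W + c + 12 * S + 30)"
proof -
  let ?big = "64 * 2 ^ (2 * nvars I) :: int"
  have B: "dichotomic.B I (2 ^ W + int c) (2 ^ (3 * S + 2)) =
      (2 ^ W + int c + 2 + ?big) * ?big + 16 * (2 ^ (3 * S + 2) * 2 ^ (3 * S + 2))"
    using dichotomic.B_def[OF d] dichotomic.big_def[OF d] by simp
  have "(2::int) ^ (2 * nvars I) \<le> 2 ^ (2 * S)" using n by (intro power_increasing) auto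
  then have big: "?big \<le> 2 ^ (2 * S + 6)" by (simp add: power_add)
  then have big': "?big \<le> 2 ^ Suc (2 * S + 5)" by (simp add: power_add)
  have p2: "(2::int) \<le> 2 ^ Suc k" for k by simp
  have "int c + 1 \<le> 2 ^ c" using of_nat_less_two_power[of c, where 'a = int] by linarith
  then have c: "int c + 2 \<le> 2 ^ Suc c" using one_le_power[of "2::int" c] unfolding power_Suc by linarith
  have "2 ^ W + (int c + 2) \<le> 2 ^ Suc W + 2 ^ Suc c" using c by (intro add_mono) auto
  also have "\<dots> \<le> 2 ^ Suc W * 2 ^ Suc c" by (rule add_le_mult_int[OF p2 p2])
  also have "\<dots> = 2 ^ Suc (W + c + 1)" by (simp add: power_add)
  finally have "2 ^ W + int c + 2 + ?big \<le> 2 ^ Suc (W + c + 1) + 2 ^ Suc (2 * S + 5)"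
    using big' by linarith
  also have "\<dots> \<le> 2 ^ Suc (W + c + 1) * 2 ^ Suc (2 * S + 5)" by (rule add_le_mult_int[OF p2 p2])
  also have "\<dots> = 2 ^ (W + c + 2 * S + 8)" by (simp add: power_add)
  finally have "(2 ^ W + int c + 2 + ?big) * ?big \<le> 2 ^ (W + c + 2 * S + 8) * 2 ^ (2 * S + 6)"
    using big by (intro mult_mono) auto
  also have "\<dots> = 2 ^ Suc (W + c + 4 * S + 13)" by (simp flip: power_add del: power_Suc)
  finally have 1: "(2 ^ W + int c + 2 + ?big) * ?big \<le> 2 ^ Suc (W + c + 4 * S + 13)" .
  have "3 * S + 2 + (3 * S + 2) = 6 * S + 4" by simp
  then have "2 ^ (3 * S + 2) * 2 ^ (3 * S + 2) = (2 ^ (6 * S + 4) :: int)" by (metis power_add)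
  then have 2: "16 * (2 ^ (3 * S + 2) * 2 ^ (3 * S + 2)) = (2 ^ Suc (6 * S + 7) :: int)" by (simp add: power_add)
  have "dichotomic.B I (2 ^ W + int c) (2 ^ (3 * S + 2)) \<le> 2 ^ Suc (W + c + 4 * S + 13) + 2 ^ Suc (6 * S + 7)"
    unfolding B 2 using 1 by simp
  also have "\<dots> \<le> 2 ^ Suc (W + c + 4 * S + 13) * 2 ^ Suc (6 * S + 7)" by (rule add_le_mult_int[OF p2 p2])
  also have "\<dots> = 2 ^ (W + c + 10 * S + 22)" by (simp flip: power_add del: power_Suc)
  also have "\<dots> < 2 ^ (W + c + 12 * S + 30)" by (rule power_strict_increasing) auto
  finally show ?thesis .
qed

theorem corollary5p9:
  fixes P :: "boco_instance set"
  assumes "boco_problem P"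
  shows "(\<forall>alg. solves_lex P alg \<longrightarrow> (\<forall>I\<in>P. da_enumerates alg I)) \<and>
    (\<forall>alg A. solves_lex P alg \<and> computes_lex_in_poly_time P A alg \<longrightarrow>
      (\<exists>M. outputs_with_incremental_delay P M
             (\<lambda>I ys. da_run alg I ys \<and> lists_nondominated_extreme_points I ys)))"
proof -
  have solver: "lex_solver I alg" if "solves_lex P alg" "I \<in> P" for alg I
  proof
    show "cost I \<in> carrier_mat 2 (nvars I)" "sols I \<subseteq> {x \<in> carrier_vec (nvars I). \<forall>j<nvars I. x $ j \<in> {0, 1}}"
      using assms that(2) by (auto simp: boco_problem_def)
    show "case alg I l of None \<Rightarrow> sols I = {} | Some x \<Rightarrow> lex_optimal I l x" if "0 \<le> fst l" "0 \<le> snd l" for l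
      using \<open>solves_lex P alg\<close> \<open>I \<in> P\<close> that unfolding solves_lex_def by blast
  qed
  have "\<exists>M. outputs_with_incremental_delay P M (\<lambda>I ys. da_run alg I ys \<and> lists_nondominated_extreme_points I ys)"
    if alg: "solves_lex P alg" and A: "computes_lex_in_poly_time P A alg" for alg A
  proof -
    obtain q w :: "nat poly" where poly_time: "\<And>I l. I \<in> P \<Longrightarrow> fst l \<ge> 0 \<and> snd l \<ge> 0 \<Longrightarrow>
     (let inp = enc_point l @ enc_instance I; N = input_size I + point_size l
      in cells_bounded A inp (poly w N) \<and>
         (\<exists>t\<le>poly q N. halted_at A inp t \<and> written (ram_at A inp t) = enc_answer (alg I l)))"
      using A unfolding computes_lex_in_poly_time_def by blast
    \<comment> \<open>The exponent in \<open>dichotomic_B_less\<close>, with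
      \<open>[:14, 7:]\<close> for the size of the input of a call.\<close>
    define w' where "w' = pcompose w [:14, 7:] + [:program_size A + 30, 12:]"
    \<comment> \<open>\<open>start_time + step_time\<close> contains three calls and six times
      \<open>out_time\<close>. With \<open>bits = 2 * S + 1\<close> for the input size
      \<open>S\<close>, the constants give 120 + 3 * 10 + 6 * 17 = 252 and the linear terms 14 + 6 *
      14 = 98, as \<open>nvars I\<close> is at most \<open>S\<close>.\<close>
    define r where "r = Polynomial.smult (3 * (4 * length A + 60)) (pcompose q [:14, 7:]) + [:252, 98:]"
    \<comment> \<open>The outer variable is the input size, the inner one the number of outputs;
      \<open>[:3, 2:]\<close> is the factor \<open>2 * i + 3\<close> from
      \<open>program_correct\<close>.\<close>
    define q' where "q' = Polynomial.smult [:3, 2:] (map_poly (\<lambda>c. [:c:]) r)"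
    let ?M = "code 0 (program A)"
    have "let inp = enc_instance I in
        cells_bounded ?M inp (poly w' (input_size I)) \<and> (\<exists>t. halted_at ?M inp t) \<and>
        (\<exists>ys. written (ram_at ?M inp (halting_time ?M inp)) = concat (map enc_point ys) \<and>
           (da_run alg I ys \<and> lists_nondominated_extreme_points I ys) \<and>
           (\<forall>i\<le>length ys. delay ?M inp (length ys) i \<le> poly2 q' (input_size I) i))" if I: "I \<in> P" for I
    proof -
      let ?S = "input_size I"
      let ?N = "7 * ?S + 14"
      interpret lex_solver I alg using alg I by (rule solver)
      interpret D: dichotomic I alg A "2 ^ poly w ?N + int (program_size A)" "2 ^ (3 * ?S + 2)" "poly q ?N" "2 * ?S + 1"
        using poly_time[OF I] by (rule dichotomicI)
      have "D.B < 2 ^ (poly w ?N + program_size A + 12 * ?S + 30)"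
        using D.dichotomic_axioms nvars_le by (rule dichotomic_B_less)
      also have "poly w ?N + program_size A + 12 * ?S + 30 = poly w' ?S"
        by (simp add: w'_def poly_pcompose algebra_simps)
      finally have "cells_bounded ?M (enc_instance I) (poly w' ?S)"
        unfolding cells_bounded_def bitlen_le_iff_power using D.program_correct(1) by (auto intro: le_less_trans)
      moreover have "D.start_time + D.step_time \<le> poly r ?S"
        unfolding D.start_time_def D.step_time_def D.call_time_def D.out_time_def
        using nvars_le by (simp add: r_def poly_pcompose algebra_simps)
      then have "(2 * i + 3) * (D.start_time + D.step_time) \<le> poly2 q' ?S i" for i
        using mult_left_mono[of "D.start_time + D.step_time" "poly r ?S" "2 * i + 3"]
        by (simp add: poly2_def q'_def poly_map_poly_const algebra_simps)
      ultimately show ?thesis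
        using D.program_correct(2,3) unfolding Let_def by (meson order_trans)
    qed
    then show ?thesis unfolding outputs_with_incremental_delay_def by blast
  qed
  then show ?thesis using lex_solver.da_enumerates[OF solver] by blast
qed

end
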